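(* Let $X$ be a compact connected abelian group with $\dim X=d<\infty$, and let $T_1,\ldots,T_s$ be epimorphisms of $X$. (a) If for every $l\ge 1$ and $i,j=1,\ldots,s$, $i\neq j$, one has $\mathrm{Spec}(T_i^l)\cap\mathrm{Spec}(T_j^l)=\emptyset$, then $\{T_1,\ldots,T_s\}$ is mixing. (b) If for some $l\ge 1$ and some $S\subset\{1,\ldots,s\}$ with $|S|>d$ one has $\bigcap_{i\in S}\mathrm{Spec}(T_i^l)\neq\emptyset$, then $\{T_1,\ldots,T_s\}$ is not mixing. (c) If for every $l\ge 1$ and every $S\subset\{1,\ldots,s\}$ with $|S|>d$ one has $\bigcap_{i\in S}\mathrm{Spec}(T_i^l)=\emptyset$, then $\{T_1,\ldots,T_s\}$ is mixing if and only if every subset of cardinality $d$ is mixing.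
   Context: $m$ is the normalized Haar measure on $X$ and $\mathcal{B}$ is the completion of the Borel $\sigma$-algebra of $X$. An epimorphism of $X$ is a continuous surjective homomorphism $X\to X$. A finite set $F$, $|F|>1$, of epimorphisms of $X$ is called mixing if for every collection $B_\gamma\in\mathcal{B}$, $\gamma\in F$, one has $m\left(\bigcap_{\gamma\in F}\gamma^{-n}(B_\gamma)\right)\to\prod_{\gamma\in F}m(B_\gamma)$ as $n\to\infty$. The character group $\hat X$ is a discrete torsion-free abelian group of rank $d$ and is identified with a group satisfying $\mathbb{Z}^d\subset\hat X\subset\mathbb{Q}^d$. A continuous endomorphism $T$ of $X$ induces an endomorphism $\hat T:\chi\mapsto\chi\circ T$ of $\hat X$, which extends to a linear map of $\mathbb{Q}^d$. $\mathrm{Spec}(T)$ denotes the set of (complex) eigenvalues of $\hat T$.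
   Formalization: In (c) it is assumed that d ≤ s, since for s < d there are no subsets of cardinality d and the claim fails; T_1,…,T_s are taken to be pairwise distinct, without which (b) fails; sets with at most one element count as mixing, as (c) needs for d = 1. *)

theory Defs
  imports "HOL-Analysis.Analysis" "Jordan_Normal_Form.Spectral_Radius"
begin

text \<open>
  The compact abelian group \<open>X\<close> is the universe of a type \<open>'a\<close>, written additively.
\<close>

text \<open>
  \<open>X\<close> has dimension \<open>d\<close>, in the sense of the small inductive dimension \<open>dim_le\<close> of the library.
  On compact groups it agrees with the large inductive and the covering dimension.
\<close>

definition has_dim :: "'a topology \<Rightarrow> nat \<Rightarrow> bool" where
  "has_dim X d \<longleftrightarrow> X dim_le int d \<and> \<not> X dim_le (int d - 1)"

definition normalized_haar :: "'a::{topological_ab_group_add, t2_space} measure \<Rightarrow> bool" where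
  "normalized_haar m \<longleftrightarrow>
     sets m = sets borel \<and> emeasure m UNIV = 1 \<and>
     (\<forall>B\<in>sets borel. \<forall>x. emeasure m ((+) x ` B) = emeasure m B) \<and>
     (\<forall>B\<in>sets borel. emeasure m B = (INF U\<in>{U. B \<subseteq> U \<and> open U}. emeasure m U)) \<and>
     (\<forall>B\<in>sets borel. emeasure m B = (SUP K\<in>{K. K \<subseteq> B \<and> compact K}. emeasure m K))"

definition epimorphism :: "('a::topological_ab_group_add \<Rightarrow> 'a) \<Rightarrow> bool" where
  "epimorphism T \<longleftrightarrow> continuous_on UNIV T \<and> surj T \<and> (\<forall>x y. T (x + y) = T x + T y)"

text \<open>
  The notion is usually reserved for \<open>card F > 1\<close>.  For \<open>card F \<le> 1\<close> the condition below still
  makes sense, and it holds for every set of epimorphisms because these preserve the Haar measure.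
\<close>

definition mixing :: "'a measure \<Rightarrow> ('a \<Rightarrow> 'a) set \<Rightarrow> bool" where
  "mixing m F \<longleftrightarrow> finite F \<and>
     (\<forall>B. (\<forall>\<gamma>\<in>F. B \<gamma> \<in> sets (completion m)) \<longrightarrow>
        (\<lambda>n. measure (completion m) (\<Inter>\<gamma>\<in>F. (\<gamma> ^^ n) -` B \<gamma>))
          \<longlonglongrightarrow> (\<Prod>\<gamma>\<in>F. measure (completion m) (B \<gamma>)))"

text \<open>
  The underlying set of the character group; the group operation is pointwise multiplication.
\<close>

definition characters :: "('a::topological_ab_group_add \<Rightarrow> complex) set" where
  "characters = {\<phi>. continuous_on UNIV \<phi> \<and> (\<forall>x. cmod (\<phi> x) = 1) \<and>
                    (\<forall>x y. \<phi> (x + y) = \<phi> x * \<phi> y)}"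

text \<open>
  \<open>\<iota>\<close> identifies the character group with a group between \<open>\<int>\<^sup>d\<close> and \<open>\<rat>\<^sup>d\<close>.
  Such an \<open>\<iota>\<close> exists for every compact connected abelian group of dimension \<open>d\<close>, since
  its character group is torsion-free of rank \<open>d\<close>.
\<close>

definition dual_identification ::
    "nat \<Rightarrow> (('a::topological_ab_group_add \<Rightarrow> complex) \<Rightarrow> rat vec) \<Rightarrow> bool" where
  "dual_identification d \<iota> \<longleftrightarrow>
     \<iota> ` characters \<subseteq> carrier_vec d \<and>
     inj_on \<iota> characters \<and>
     (\<forall>\<phi>\<in>characters. \<forall>\<psi>\<in>characters. \<iota> (\<lambda>x. \<phi> x * \<psi> x) = \<iota> \<phi> + \<iota> \<psi>) \<and>
     {v \<in> carrier_vec d. \<forall>i<d. vec_index v i \<in> \<int>} \<subseteq> \<iota> ` characters"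

text \<open>
  The matrix of the linear map of \<open>\<rat>\<^sup>d\<close> that extends the dual endomorphism \<open>\<phi> \<mapsto> \<phi> \<circ> T\<close>.
  If \<open>\<iota>\<close> is an identification as above and \<open>T\<close> is a continuous endomorphism, then there is
  exactly one.
\<close>

definition dual_matrix ::
    "nat \<Rightarrow> (('a::topological_ab_group_add \<Rightarrow> complex) \<Rightarrow> rat vec) \<Rightarrow> ('a \<Rightarrow> 'a) \<Rightarrow> rat mat" where
  "dual_matrix d \<iota> T =
     (THE A. A \<in> carrier_mat d d \<and> (\<forall>\<phi>\<in>characters. \<iota> (\<phi> \<circ> T) = A *\<^sub>v \<iota> \<phi>))"

text \<open>
  A different choice of \<open>\<iota>\<close> conjugates the matrix, so this set does not depend on \<open>\<iota>\<close>.
\<close>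

definition Spec ::
    "nat \<Rightarrow> (('a::topological_ab_group_add \<Rightarrow> complex) \<Rightarrow> rat vec) \<Rightarrow> ('a \<Rightarrow> 'a) \<Rightarrow> complex set" where
  "Spec d \<iota> T = spectrum (map_mat of_rat (dual_matrix d \<iota> T))"

end

theory Submission
  imports Defs
begin

text \<open>
  Mixing is a statement about characters: \<open>F\<close> is mixing iff no nontrivial family of characters satisfies
  \<open>\<Prod>\<gamma>\<in>F. \<chi>\<^sub>\<gamma> \<circ> \<gamma>^n = 1\<close> for infinitely many \<open>n\<close>, since trigonometric polynomials are dense
  (Peter--Weyl). On the dual side this is a relation \<open>\<Sum>i. A\<^sub>i^n v\<^sub>i = 0\<close> between orbits of rational matrices.
  By the Skolem--Mahler--Lech theorem infinitely many such \<open>n\<close> contain an arithmetic progression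
  \<open>l n + r\<close>; the cyclic space which the relation then generates contains vectors \<open>u\<^sub>i\<close>, not all zero and of sum
  zero, with \<open>A\<^sub>i^l u\<^sub>i = \<mu> u\<^sub>i\<close> for a single \<open>\<mu>\<close>. At least two of them are nonzero, which gives (a), and at
  most \<open>d\<close> of them under the hypothesis of (c). Conversely more than \<open>d\<close> eigenvectors for the same \<open>\<mu>\<close> are
  linearly dependent, and a \<open>\<rat>\<close>-linear functional on \<open>\<complex>\<close> turns the dependence into a rational relation.
\<close>

unbundle no vec_syntax
no_notation fps_nth (infixl \<open>$\<close> 75)

section \<open>Linear recurrences\<close>

text \<open>The progression cannot be avoided: a relation may hold at infinitely many times without
  holding at all times, for instance when the ratio of two eigenvalues is a root of unity. This is
  why the hypotheses speak of all powers \<open>T i ^^ l\<close>. Surjectivity of the maps enters as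
  invertibility of the dual matrices. It lets a prime p be chosen that divides no determinant once
  denominators are cleared, so that a common power of the matrices is 1 mod p and the orbits extend
  p-adically; it also keeps the relation nontrivial after the shift by r. Eigenvectors live over
  \<complex> whereas \<open>\<iota>\<close> takes rational values and is only known to reach the
  integral vectors, so a rational relation is realised by characters after multiplication by a
  common denominator. Characters are produced inside the algebra of continuous functions under
  convolution, where minimal projections turn out to be multiples of characters. For (c) the point
  is that the subfamily carrying the nonzero eigenvectors is itself not mixing; it has at most d
  members and is enlarged to exactly d.\<close>

lemma homogeneous_system_nontrivial:
  fixes a :: "'i \<Rightarrow> 'j \<Rightarrow> 'f::field"
  assumes "finite I" "finite J" "card I < card J"
  shows "\<exists>c. (\<exists>j\<in>J. c j \<noteq> 0) \<and> (\<forall>i\<in>I. (\<Sum>j\<in>J. a i j * c j) = 0)"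
  using assms
proof (induction I arbitrary: a J rule: finite_induct)
  case empty
  then obtain j where "j \<in> J" by fastforce
  then show ?case by (intro exI[of _ "\<lambda>_. 1"]) auto
next
  case (insert i I)
  show ?case
  proof (cases "\<forall>j\<in>J. a i j = 0")
    case True
    have "card I < card J" using insert by simp
    from insert.IH[OF insert.prems(1) this, of a] obtain c where
      "\<exists>j\<in>J. c j \<noteq> 0" "\<forall>i\<in>I. (\<Sum>j\<in>J. a i j * c j) = 0" by blast
    then show ?thesis using True by (intro exI[of _ c]) (auto intro!: sum.neutral)
  next
    case False
    then obtain j0 where j0: "j0 \<in> J" "a i j0 \<noteq> 0" by blast
    define J' where "J' = J - {j0}"
    have J': "finite J'" "card I < card J'" "J = insert j0 J'" "j0 \<notin> J'"
      using insert j0 by (auto simp: J'_def)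
    \<comment> \<open>The system left after the unknown j0 is eliminated through equation i;
      \<open>x\<close> below is the value of that unknown which then solves equation i.\<close>
    define b where "b = (\<lambda>k j. a k j - a k j0 * a i j / a i j0)"
    from insert.IH[OF J'(1,2), of b] obtain c where
      c: "\<exists>j\<in>J'. c j \<noteq> 0" "\<forall>k\<in>I. (\<Sum>j\<in>J'. b k j * c j) = 0" by blast
    define x where "x = - (\<Sum>j\<in>J'. a i j * c j) / a i j0"
    define c' where "c' = (\<lambda>j. if j = j0 then x else c j)"
    have expand: "(\<Sum>j\<in>J. a k j * c' j) = a k j0 * x + (\<Sum>j\<in>J'. a k j * c j)" for k
    proof -
      have "(\<Sum>j\<in>J'. a k j * c' j) = (\<Sum>j\<in>J'. a k j * c j)"
        by (rule sum.cong) (use J'(4) in \<open>auto simp: c'_def\<close>)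
      then show ?thesis using J' by (simp add: c'_def)
    qed
    have "(\<Sum>j\<in>J. a k j * c' j) = 0" if "k \<in> insert i I" for k
    proof (cases "k = i")
      case True
      then show ?thesis unfolding expand using j0 by (simp add: x_def)
    next
      case False
      then have "0 = (\<Sum>j\<in>J'. b k j * c j)" using c that by simp
      also have "\<dots> = (\<Sum>j\<in>J'. a k j * c j) - (\<Sum>j\<in>J'. a k j0 / a i j0 * (a i j * c j))"
        unfolding sum_subtractf[symmetric] by (rule sum.cong) (auto simp: b_def algebra_simps)
      also have "\<dots> = a k j0 * x + (\<Sum>j\<in>J'. a k j * c j)"
        unfolding sum_distrib_left[symmetric] by (simp add: x_def)
      finally show ?thesis unfolding expand by simp
    qed
    moreover have "\<exists>j\<in>J. c' j \<noteq> 0"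
      using c(1) J'(3,4) by (auto simp: c'_def)
    ultimately show ?thesis by blast
  qed
qed

text \<open>Taking \<open>e n = L^n w\<close> this finds an eigenvector of \<open>L\<close> in the cyclic space of \<open>w\<close>.\<close>

lemma eigenvector_from_powers:
  fixes e :: "nat \<Rightarrow> 'j \<Rightarrow> complex"
  assumes "finite J" "\<exists>t\<in>J. e 0 t \<noteq> 0"
  obtains q :: "complex poly" and \<mu> :: complex where
    "\<exists>t\<in>J. (\<Sum>n\<le>degree q. coeff q n * e n t) \<noteq> 0"
    "\<And>t. t \<in> J \<Longrightarrow> (\<Sum>n\<le>degree q. coeff q n * e (Suc n) t) = \<mu> * (\<Sum>n\<le>degree q. coeff q n * e n t)"
proof -
  \<comment> \<open>\<open>E p\<close> is the vector p(L) w. The card J + 1 vectors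
    \<open>e 0\<close>, ..., \<open>e (card J)\<close> have only card J coordinates, and a
    dependence between them is a nonzero polynomial \<open>p0\<close> for which \<open>E p0\<close>
    vanishes on J.\<close>
  define E where "E = (\<lambda>p t. \<Sum>n\<le>degree p. coeff p n * e n t)"
  have E_ge: "E p t = (\<Sum>n\<le>N. coeff p n * e n t)" if "degree p \<le> N" for p t N
    unfolding E_def by (rule sum.mono_neutral_left) (use that in \<open>auto simp: coeff_eq_0\<close>)
  obtain c where c: "\<exists>n\<in>{..card J}. c n \<noteq> 0"
    "\<forall>t\<in>J. (\<Sum>n\<in>{..card J}. e n t * c n) = 0"
    using homogeneous_system_nontrivial[of J "{..card J}" "\<lambda>t n. e n t"] assms(1) by auto
  define p0 where "p0 = (\<Sum>n\<le>card J. monom (c n) n)"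
  have coeff_p0: "coeff p0 n = (if n \<le> card J then c n else 0)" for n
    by (simp add: p0_def coeff_sum if_distrib cong: if_cong)
  have "degree p0 \<le> card J"
    by (rule degree_le) (simp add: coeff_p0)
  then have "E p0 t = 0" if "t \<in> J" for t
    using c(2) that by (simp add: E_ge coeff_p0 mult.commute)
  moreover have "p0 \<noteq> 0" using c(1) coeff_p0 by (metis atMost_iff coeff_0)
  \<comment> \<open>Descent on an annihilating polynomial: split off a root \<mu>. If the cofactor q
    does not annihilate w, then q(L) w is an eigenvector; otherwise q takes the place of p. Degree 0
    is excluded because \<open>e 0\<close> is nonzero.\<close>
  moreover have "\<exists>q \<mu>. (\<exists>t\<in>J. E q t \<noteq> 0) \<and> 
      (\<forall>t\<in>J. (\<Sum>n\<le>degree q. coeff q n * e (Suc n) t) = \<mu> * E q t)"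
    if "p \<noteq> 0" "\<And>t. t \<in> J \<Longrightarrow> E p t = 0" for p
    using that
  proof (induction "degree p" arbitrary: p rule: less_induct)
    case less
    show ?case
    proof (cases "degree p = 0")
      case True
      then have "E p t = lead_coeff p * e 0 t" for t by (simp add: E_def)
      then show ?thesis using less.prems assms(2) by auto
    next
      case False
      then obtain \<mu> where "poly p \<mu> = 0"
        using fundamental_theorem_of_algebra[of p] constant_degree[of p] by auto
      then obtain q where pq: "p = [:- \<mu>, 1:] * q" by (auto simp: poly_eq_0_iff_dvd)
      have "q \<noteq> 0" using less.prems pq by auto
      have deg: "degree p = Suc (degree q)"
        unfolding pq using \<open>q \<noteq> 0\<close> by (subst degree_mult_eq) auto
      have E_p: "E p t = (\<Sum>n\<le>degree q. coeff q n * e (Suc n) t) - \<mu> * E q t" for t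
      proof -
        have coeff_p: "coeff p n = coeff (pCons 0 q) n - \<mu> * coeff q n" for n by (simp add: pq)
        have "E p t = (\<Sum>n\<le>Suc (degree q). coeff (pCons 0 q) n * e n t - \<mu> * (coeff q n * e n t))"
          unfolding E_def deg coeff_p by (intro sum.cong refl) (simp add: algebra_simps)
        also have "\<dots> = (\<Sum>n\<le>Suc (degree q). coeff (pCons 0 q) n * e n t) - \<mu> * E q t"
          by (simp only: sum_subtractf sum_distrib_left[symmetric] E_ge[of q "Suc (degree q)", symmetric])
        also have "(\<Sum>n\<le>Suc (degree q). coeff (pCons 0 q) n * e n t) = (\<Sum>n\<le>degree q. coeff q n * e (Suc n) t)"
          by (subst sum.atMost_Suc_shift) simp
        finally show ?thesis .
      qed
      show ?thesis
      proof (cases "\<exists>t\<in>J. E q t \<noteq> 0")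
        case True
        then show ?thesis using E_p less.prems(2) by (intro exI[of _ q] exI[of _ \<mu>]) auto
      next
        case False
        then show ?thesis using less.hyps[of q] deg \<open>q \<noteq> 0\<close> by auto
      qed
    qed
  qed
  ultimately show ?thesis using that unfolding E_def by blast
qed

section \<open>Forward differences and p-adic zeros of integer sequences\<close>

text \<open>Only multiples of p contribute, so v(k!) = r + v(r!) with r = k div p, and induction
  gives 2 v(k!) <= 3 r <= p r <= k. Hence p^k / k! still contains at least k/2 factors p. The bound
  fails for p = 2, at k = 4.\<close>

lemma multiplicity_fact_le:
  fixes p :: nat
  assumes "prime p" "p \<ge> 3"
  shows "2 * multiplicity p (fact k :: nat) \<le> k"
proof (induction k rule: less_induct)
  case (less k)
  have sum_eq: "multiplicity p (fact n :: nat) = (\<Sum>j\<in>{1..n}. multiplicity p j)" for n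
    unfolding fact_prod of_nat_id using assms(1)
    by (subst prime_elem_multiplicity_prod_distrib) auto
  define r where "r = k div p"
  have "(\<Sum>j\<in>{1..k}. multiplicity p j) = (\<Sum>j\<in>(*) p ` {1..r}. multiplicity p j)"
  proof (rule sum.mono_neutral_right)
    show "(*) p ` {1..r} \<subseteq> {1..k}"
    proof clarify
      fix i assume i: "i \<in> {1..r}"
      have "p * i \<le> p * r" using i by simp
      also have "\<dots> \<le> k" by (simp add: r_def)
      finally show "p * i \<in> {1..k}" using i assms by auto
    qed
    show "\<forall>i\<in>{1..k} - (*) p ` {1..r}. multiplicity p i = 0"
    proof (intro ballI not_dvd_imp_multiplicity_0 notI)
      fix i assume i: "i \<in> {1..k} - (*) p ` {1..r}" and "p dvd i"
      then obtain j where "i = p * j" by auto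
      moreover have "j \<le> r" using i \<open>i = p * j\<close> assms unfolding r_def
        by (metis DiffD1 atLeastAtMost_iff div_le_mono nonzero_mult_div_cancel_left not_numeral_le_zero)
      moreover have "j \<ge> 1" using i \<open>i = p * j\<close> by (cases j) auto
      ultimately show False using i by auto
    qed
  qed auto
  also have "\<dots> = (\<Sum>i\<in>{1..r}. multiplicity p (p * i))"
    using assms by (subst sum.reindex) (auto simp: inj_on_def o_def)
  also have "\<dots> = (\<Sum>i\<in>{1..r}. Suc (multiplicity p i))"
    by (intro sum.cong refl multiplicity_times_same) (use assms in auto)
  also have "\<dots> = r + multiplicity p (fact r :: nat)"
    by (simp add: sum_eq sum_Suc)
  finally have eq: "multiplicity p (fact k :: nat) = r + multiplicity p (fact r :: nat)"
    using sum_eq by simp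
  show ?case
  proof (cases "k = 0")
    case False
    then have "r < k" using assms by (simp add: r_def)
    then have "2 * multiplicity p (fact r :: nat) \<le> r" by (rule less)
    then have "2 * multiplicity p (fact k :: nat) \<le> 3 * r" using eq by simp
    also have "\<dots> \<le> p * r" using assms by simp
    also have "\<dots> \<le> k" by (simp add: r_def)
    finally show ?thesis .
  qed (use assms in auto)
qed

definition fdiff :: "(nat \<Rightarrow> int) \<Rightarrow> nat \<Rightarrow> int" where
  "fdiff f n = f (Suc n) - f n"

text \<open>The hypothesis is applied to f and to \<open>fdiff f\<close>, whose differences are
  those of f shifted by one; Pascal's rule combines the two sums.\<close>

lemma newton_forward:
  "f n = (\<Sum>k\<le>n. of_nat (n choose k) * (fdiff ^^ k) f 0)"
proof (induction n arbitrary: f)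
  case 0
  then show ?case by simp
next
  case (Suc n)
  let ?D = "\<lambda>k. (fdiff ^^ k) f 0"
  have "f (Suc n) = f n + fdiff f n" by (simp add: fdiff_def)
  also have "f n = (\<Sum>k\<le>n. of_nat (n choose k) * ?D k)" by (rule Suc)
  also have "\<dots> = (\<Sum>k\<le>Suc n. of_nat (n choose k) * ?D k)" by simp
  also have "fdiff f n = (\<Sum>k\<le>n. of_nat (n choose k) * ?D (Suc k))"
    by (subst Suc) (simp add: funpow_swap1)
  finally have "f (Suc n) = (\<Sum>k\<le>Suc n. of_nat (n choose k) * ?D k)
     + (\<Sum>k\<le>n. of_nat (n choose k) * ?D (Suc k))" .
  also have "\<dots> = f 0 + (\<Sum>k\<le>n. of_nat (Suc n choose Suc k) * ?D (Suc k))"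
    by (simp only: sum.atMost_Suc_shift) (simp add: sum.distrib algebra_simps)
  also have "\<dots> = (\<Sum>k\<le>Suc n. of_nat (Suc n choose k) * ?D k)"
    by (simp only: sum.atMost_Suc_shift) simp
  finally show ?case .
qed

text \<open>The falling factorial x (x - 1) ... (x - k + 1). Newton's series multiplied by M!
  becomes an integral combination of these polynomials, and they can be divided by a monic
  polynomial without leaving the integers.\<close>

definition ffact_poly :: "nat \<Rightarrow> int poly" where
  "ffact_poly k = (\<Prod>i<k. [:- int i, 1:])"

lemma degree_ffact_poly: "degree (ffact_poly k) = k"
  unfolding ffact_poly_def by (subst degree_prod_eq_sum_degree) auto

lemma poly_ffact_poly: "poly (ffact_poly k) (int n) = fact k * int (n choose k)"
proof -
  have "poly (ffact_poly k) (int n) = (\<Prod>i<k. int n - int i)"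
    by (simp add: ffact_poly_def poly_prod)
  moreover have "rat_of_int (\<Prod>i<k. int n - int i) = fact k * (rat_of_nat n gchoose k)"
    by (simp add: gbinomial_mult_fact atLeast0LessThan)
  then have "rat_of_int (\<Prod>i<k. int n - int i) = rat_of_int (fact k * int (n choose k))"
    by (simp add: binomial_gbinomial)
  ultimately show ?thesis by (simp only: of_int_eq_iff)
qed

text \<open>A function whose Newton coefficients decay \<open>p\<close>-adically extends to a \<open>p\<close>-adic analytic function,
  and such a function with infinitely many zeros in \<open>\<int>\<^sub>p\<close> is zero. The proof is made elementary by
  dividing each falling factorial by \<open>\<Prod>z\<in>Z. (x - z)\<close> for a large set \<open>Z\<close> of zeros: the remainders
  cancel, and only quotients of falling factorials of degree at least \<open>card Z\<close> survive.\<close>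

lemma zero_of_infinitely_many_zeros:
  fixes f :: "nat \<Rightarrow> int" and p :: nat
  assumes p: "prime p" "p \<ge> 3"
    and dvd: "\<And>k. int p ^ k dvd (fdiff ^^ k) f 0"
    and inf: "infinite {n. f n = 0}"
  shows "f t = 0"
proof -
  have "int p ^ h dvd f t" for h
  proof (cases "f t = 0")
    case False
    \<comment> \<open>The number 2 h is dictated by \<open>multiplicity_fact_le\<close>: a term of
      index k >= 2 h keeps at least k/2 >= h factors p after division by k!.\<close>
    obtain Z where Z: "Z \<subseteq> {n. f n = 0}" "finite Z" "card Z = 2 * h"
      using infinite_arbitrarily_large[OF inf] by blast
    \<comment> \<open>All points at issue are at most M, so Newton's series can be cut at M for each
      of them, and M! clears its denominators.\<close>
    define M where "M = Max (insert t (insert (2 * h) Z))"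
    have M: "2 * h \<le> M" "t \<le> M" "\<And>z. z \<in> Z \<Longrightarrow> z \<le> M"
      using Z unfolding M_def by (auto intro!: Max_ge simp del: Max_insert)
    define W where "W = (\<Prod>z\<in>Z. [:- int z, 1:])"
    have degW: "degree W = 2 * h" unfolding W_def using Z
      by (subst degree_prod_eq_sum_degree) auto
    have lcW: "lead_coeff W = 1" unfolding W_def by (simp add: lead_coeff_prod)
    then have "W \<noteq> 0" by auto
    have "\<exists>q r. ffact_poly k = W * q + r \<and> (r = 0 \<or> degree r < 2 * h) \<and> (k < 2 * h \<longrightarrow> q = 0)" for k
    proof (cases "k < 2 * h")
      case True
      then show ?thesis by (intro exI[of _ 0] exI[of _ "ffact_poly k"]) (auto simp: degree_ffact_poly)
    next
      case False
      \<comment> \<open>W is monic, so pseudo-division is division with remainder over the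
        integers.\<close>
      obtain q r where qr: "pseudo_divmod (ffact_poly k) W = (q, r)" by fastforce
      from pseudo_divmod[OF \<open>W \<noteq> 0\<close> qr] show ?thesis
        using lcW degW False by (intro exI[of _ q] exI[of _ r]) auto
    qed
    then obtain q r where qr: "\<And>k. ffact_poly k = W * q k + r k"
      "\<And>k. r k = 0 \<or> degree (r k) < 2 * h" "\<And>k. k < 2 * h \<Longrightarrow> q k = 0" by metis
    define a where "a = (\<lambda>k. (fdiff ^^ k) f 0 * int (fact M div fact k))"
    have f_eq: "fact M * f n = poly W (int n) * (\<Sum>k\<le>M. a k * poly (q k) (int n))
      + (\<Sum>k\<le>M. a k * poly (r k) (int n))" if "n \<le> M" for n
    proof -
      have "fact M * f n = (\<Sum>k\<le>n. fact M * (int (n choose k) * (fdiff ^^ k) f 0))"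
        by (subst newton_forward) (simp add: sum_distrib_left)
      also have "\<dots> = (\<Sum>k\<le>M. fact M * (int (n choose k) * (fdiff ^^ k) f 0))"
        by (rule sum.mono_neutral_left) (use that in auto)
      also have "\<dots> = (\<Sum>k\<le>M. a k * poly (ffact_poly k) (int n))"
      proof (rule sum.cong)
        fix k assume "k \<in> {..M}"
        then have "(fact k :: nat) dvd fact M" by (auto intro: fact_dvd)
        then have "fact M = int (fact M div fact k) * fact k"
          by (metis dvd_div_mult_self of_nat_fact of_nat_mult)
        then show "fact M * (int (n choose k) * (fdiff ^^ k) f 0) = a k * poly (ffact_poly k) (int n)"
          unfolding a_def poly_ffact_poly by (simp only: mult_ac)
      qed auto
      also have "\<dots> = poly W (int n) * (\<Sum>k\<le>M. a k * poly (q k) (int n))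
        + (\<Sum>k\<le>M. a k * poly (r k) (int n))"
        by (subst qr(1)) (simp add: algebra_simps sum.distrib sum_distrib_left)
      finally show ?thesis .
    qed
    \<comment> \<open>The remainders add up to a polynomial of degree below 2 h that vanishes at the
      2 h points of Z, hence to zero.\<close>
    define G where "G = (\<Sum>k\<le>M. Polynomial.smult (a k) (r k))"
    have poly_G: "poly G x = (\<Sum>k\<le>M. a k * poly (r k) x)" for x by (simp add: G_def poly_sum)
    have "G = 0"
    proof (rule ccontr)
      assume "G \<noteq> 0"
      have "poly G (int z) = 0" if "z \<in> Z" for z
      proof -
        have "poly W (int z) = 0" using that Z by (auto simp: W_def poly_prod)
        then show ?thesis using f_eq[of z] M(3)[OF that] that Z by (auto simp: poly_G)
      qed
      then have "int ` Z \<subseteq> {x. poly G x = 0}" by auto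
      then have "2 * h \<le> card {x. poly G x = 0}"
        using card_mono[OF poly_roots_finite[OF \<open>G \<noteq> 0\<close>]] Z(3) by (metis card_image inj_on_of_nat)
      also have "\<dots> \<le> degree G" by (rule card_poly_roots_bound) fact
      finally have *: "2 * h \<le> degree G" .
      have "coeff G n = 0" if "n \<ge> 2 * h" for n
      proof -
        have "coeff (r k) n = 0" for k using qr(2)[of k] that by (auto intro: coeff_eq_0)
        then show ?thesis by (simp add: G_def coeff_sum)
      qed
      then show False using * \<open>G \<noteq> 0\<close> leading_coeff_0_iff by blast
    qed
    then have "fact M * f t = poly W (int t) * (\<Sum>k\<le>M. a k * poly (q k) (int t))"
      using f_eq[OF M(2)] poly_G[of "int t"] by simp
    moreover define v where "v = multiplicity p (fact M :: nat)"
    \<comment> \<open>The k-th difference supplies p^k and the quotient M! / k! supplies v - v(k!)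
      further factors, together at least v + h. Cancelling the p-part p^v of M! afterwards leaves
      p^h.\<close>
    have "int p ^ (v + h) dvd a k * poly (q k) (int t)" if "k \<le> M" for k
    proof (cases "k < 2 * h")
      case False
      have mult: "multiplicity p (fact M div fact k :: nat) + multiplicity p (fact k :: nat) = v"
      proof -
        have "(fact k :: nat) dvd fact M" using that by (rule fact_dvd)
        then have "(fact M :: nat) = fact M div fact k * fact k" by simp
        moreover have "(fact M div fact k :: nat) \<noteq> 0" using calculation by (metis fact_nonzero mult_0)
        ultimately show ?thesis unfolding v_def using p
          by (metis fact_nonzero prime_elem_multiplicity_mult_distrib prime_imp_prime_elem)
      qed
      have "2 * multiplicity p (fact k :: nat) \<le> k" using multiplicity_fact_le[OF p] .
      then have "v + h \<le> k + multiplicity p (fact M div fact k :: nat)" using mult False by simp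
      then have "int p ^ (v + h) dvd int p ^ (k + multiplicity p (fact M div fact k :: nat))"
        by (rule le_imp_power_dvd)
      also have "\<dots> dvd (fdiff ^^ k) f 0 * int (fact M div fact k)"
        unfolding power_add by (intro mult_dvd_mono dvd) (metis multiplicity_dvd of_nat_dvd_iff of_nat_power)
      finally show ?thesis by (simp add: a_def)
    qed (use qr(3) in simp)
    ultimately have "int p ^ (v + h) dvd fact M * f t"
      by (metis (no_types, lifting) atMost_iff dvd_mult dvd_sum)
    moreover obtain u where u: "(fact M :: nat) = p ^ v * u" "\<not> p dvd u"
      using multiplicity_decompose'[of "fact M :: nat" p] p unfolding v_def
      by (metis fact_nonzero not_prime_unit)
    moreover have "fact M = int p ^ v * int u"
      using arg_cong[OF u(1), of int] by simp
    ultimately have "int p ^ v * int p ^ h dvd int p ^ v * (int u * f t)"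
      by (simp add: power_add mult.assoc)
    then have "int p ^ h dvd int u * f t" using p by auto
    moreover have "coprime (int p ^ h) (int u)"
      using u(2) p(1) by (simp add: coprime_power_left_iff prime_imp_coprime)
    ultimately show ?thesis by (simp add: coprime_dvd_mult_right_iff)
  qed auto
  \<comment> \<open>The exponent h = |f t| already suffices, as p^|f t| > |f t|.\<close>
  then have *: "int p ^ nat \<bar>f t\<bar> dvd f t" .
  show ?thesis
  proof (rule ccontr)
    assume "f t \<noteq> 0"
    then have "int p ^ nat \<bar>f t\<bar> \<le> \<bar>f t\<bar>" using dvd_imp_le_int[OF _ *] by simp
    moreover have "nat \<bar>f t\<bar> < p ^ nat \<bar>f t\<bar>" using p by (intro power_gt_expt) auto
    then have "int (nat \<bar>f t\<bar>) < int (p ^ nat \<bar>f t\<bar>)" by (simp only: of_nat_less_iff)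
    then have "\<bar>f t\<bar> < int p ^ nat \<bar>f t\<bar>" by simp
    ultimately show False by simp
  qed
qed

section \<open>Matrix powers and the Skolem--Mahler--Lech theorem\<close>

lemma index_mult_mat_vec_sum:
  assumes "A \<in> carrier_mat r c" "v \<in> carrier_vec c" "i < r"
  shows "(A *\<^sub>v v) $ i = (\<Sum>j<c. A $$ (i, j) * v $ j)"
  using assms by (auto simp: scalar_prod_def lessThan_atLeast0)

lemma index_mult_mat_sum:
  assumes "A \<in> carrier_mat r n" "B \<in> carrier_mat n c" "i < r" "j < c"
  shows "(A * B) $$ (i, j) = (\<Sum>k<n. A $$ (i, k) * B $$ (k, j))"
  using assms by (auto simp: scalar_prod_def lessThan_atLeast0)

lemma pow_mat_add:
  assumes "A \<in> carrier_mat n n"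
  shows "A ^\<^sub>m (a + b) = A ^\<^sub>m a * A ^\<^sub>m b"
proof (induction b)
  case 0
  then show ?case using assms by (auto intro!: right_mult_one_mat[symmetric, of _ _ n])
next
  case (Suc b)
  then show ?case using assms
    by (auto intro!: assoc_mult_mat[of _ n n _ n _ n])
qed

lemma pow_mat_mult:
  assumes "A \<in> carrier_mat n n"
  shows "A ^\<^sub>m (a * b) = (A ^\<^sub>m a) ^\<^sub>m b"
  by (induction b) (use assms in \<open>auto simp: pow_mat_add[OF assms] add.commute[of a]\<close>)

lemma pow_mat_Suc_mult_vec:
  assumes "A \<in> carrier_mat n n" "v \<in> carrier_vec n"
  shows "A ^\<^sub>m Suc k *\<^sub>v v = A ^\<^sub>m k *\<^sub>v (A *\<^sub>v v)"
    and "A ^\<^sub>m Suc k *\<^sub>v v = A *\<^sub>v (A ^\<^sub>m k *\<^sub>v v)"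
proof -
  show "A ^\<^sub>m Suc k *\<^sub>v v = A ^\<^sub>m k *\<^sub>v (A *\<^sub>v v)"
    using assms by (simp add: assoc_mult_mat_vec[of _ n n _ n])
  have "A ^\<^sub>m Suc k = A * A ^\<^sub>m k"
    using pow_mat_add[OF assms(1), of 1 k] assms by (simp add: left_mult_one_mat[of _ n n])
  then show "A ^\<^sub>m Suc k *\<^sub>v v = A *\<^sub>v (A ^\<^sub>m k *\<^sub>v v)"
    using assms by (simp add: assoc_mult_mat_vec[of _ n n _ n])
qed

lemma mult_mat_vec_smult:
  fixes A :: "'a::comm_ring_1 mat"
  assumes "A \<in> carrier_mat r c" "v \<in> carrier_vec c"
  shows "A *\<^sub>v (k \<cdot>\<^sub>v v) = k \<cdot>\<^sub>v (A *\<^sub>v v)"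
  using assms by (intro eq_vecI) (auto simp: scalar_prod_def sum_distrib_left intro!: sum.cong)

lemma smult_mat_mult_vec:
  fixes A :: "'a::comm_ring_1 mat"
  assumes "A \<in> carrier_mat r c" "v \<in> carrier_vec c"
  shows "(k \<cdot>\<^sub>m A) *\<^sub>v v = k \<cdot>\<^sub>v (A *\<^sub>v v)"
  using assms by (intro eq_vecI) (auto simp: scalar_prod_def sum_distrib_left intro!: sum.cong)

lemma det_pow_mat:
  fixes A :: "'a::comm_ring_1 mat"
  assumes "A \<in> carrier_mat d d"
  shows "det (A ^\<^sub>m n) = det A ^ n"
  by (induction n) (use assms in \<open>auto simp: det_mult[of _ d]\<close>)

text \<open>Modulo p the matrices lie in a finite group. By the pigeonhole principle two powers of
  the whole family agree mod p, and the lower one is cancelled by its adjugate, since its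
  determinant is prime to p.\<close>

lemma power_congruent_one_mod_prime:
  fixes A :: "'i \<Rightarrow> int mat" and p :: nat
  assumes "finite I" "prime p" "\<And>i. i \<in> I \<Longrightarrow> A i \<in> carrier_mat d d"
    and ndvd: "\<And>i. i \<in> I \<Longrightarrow> \<not> int p dvd det (A i)"
  shows "\<exists>l\<ge>1. \<exists>M. \<forall>i\<in>I. M i \<in> carrier_mat d d \<and> A i ^\<^sub>m l = 1\<^sub>m d + int p \<cdot>\<^sub>m M i"
proof -
  \<comment> \<open>\<open>g n\<close> records the residues of all entries for all i at once, so
    that one exponent l serves the whole family.\<close>
  define g where "g = (\<lambda>n. restrict (\<lambda>(i, a, b). (A i ^\<^sub>m n) $$ (a, b) mod int p) (I \<times> {..<d} \<times> {..<d}))"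
  have "range g \<subseteq> (I \<times> {..<d} \<times> {..<d}) \<rightarrow>\<^sub>E {0..<int p}"
  proof (rule image_subsetI)
    fix n
    have "int p > 0" using assms(2) prime_gt_0_nat by simp
    then show "g n \<in> (I \<times> {..<d} \<times> {..<d}) \<rightarrow>\<^sub>E {0..<int p}"
      unfolding g_def restrict_PiE_iff by (simp add: case_prod_beta)
  qed
  moreover have "finite ((I \<times> {..<d} \<times> {..<d}) \<rightarrow>\<^sub>E {0..<int p})"
    by (rule finite_PiE[OF finite_cartesian_product[OF assms(1) finite_cartesian_product[OF finite_lessThan finite_lessThan]]])
      (rule finite_atLeastLessThan_int)
  ultimately have "finite (range g)" by (rule finite_subset)
  then have "\<not> inj g" using finite_imageD infinite_UNIV_nat by blast
  then obtain a b where "g a = g b" "a < b"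
    by (metis injI linorder_neqE_nat)
  define l where "l = b - a"
  have dvd: "int p dvd (A i ^\<^sub>m l - 1\<^sub>m d) $$ (x, y)" if "i \<in> I" "x < d" "y < d" for i x y
  proof -
    let ?B = "A i ^\<^sub>m a" and ?C = "A i ^\<^sub>m l - 1\<^sub>m d"
    have B: "?B \<in> carrier_mat d d" and C: "?C \<in> carrier_mat d d" and adj: "adj_mat ?B \<in> carrier_mat d d"
      using assms(3)[OF that(1)] by (auto intro!: adj_mat(1) minus_carrier_mat)
    have "?B * ?C = A i ^\<^sub>m b - ?B"
      using assms(3)[OF that(1)] \<open>a < b\<close> pow_mat_add[of "A i" d a l]
      by (simp add: mult_minus_distrib_mat[of _ d d _ d] l_def right_mult_one_mat[of _ d d])
    moreover have "int p dvd (A i ^\<^sub>m b - ?B) $$ (x, y)" if "x < d" "y < d" for x y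
    proof -
      have "(A i ^\<^sub>m a) $$ (x, y) mod int p = (A i ^\<^sub>m b) $$ (x, y) mod int p"
        using fun_cong[OF \<open>g a = g b\<close>, of "(i, x, y)"] that \<open>i \<in> I\<close> by (simp add: g_def)
      then show ?thesis using assms(3)[OF \<open>i \<in> I\<close>] that by (simp add: mod_eq_dvd_iff dvd_diff_commute)
    qed
    ultimately have BC: "int p dvd (?B * ?C) $$ (x, y)" if "x < d" "y < d" for x y
      using that by simp
    have "adj_mat ?B * (?B * ?C) = det ?B \<cdot>\<^sub>m ?C"
      using B C adj adj_mat(3)[OF B]
      by (simp add: assoc_mult_mat[symmetric, of _ d d _ d _ d] mult_smult_assoc_mat[of _ d d _ d] left_mult_one_mat[of _ d d])
    moreover have "int p dvd (adj_mat ?B * (?B * ?C)) $$ (x, y)"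
      unfolding index_mult_mat_sum[OF adj mult_carrier_mat[OF B C] that(2,3)]
      using BC that by (intro dvd_sum dvd_mult) auto
    ultimately have "int p dvd det ?B * ?C $$ (x, y)"
      using B C that by simp
    moreover have "\<not> int p dvd det ?B"
      using ndvd[OF that(1)] assms(2) det_pow_mat[OF assms(3)[OF that(1)]]
      by (metis prime_dvd_power prime_nat_int_transfer)
    ultimately show ?thesis
      using assms(2) by (metis prime_dvd_mult_iff prime_nat_int_transfer)
  qed
  show ?thesis
  proof (intro exI conjI ballI)
    show "l \<ge> 1" using \<open>a < b\<close> by (simp add: l_def)
    fix i assume i: "i \<in> I"
    let ?M = "\<lambda>i. map_mat (\<lambda>x. x div int p) (A i ^\<^sub>m l - 1\<^sub>m d)"
    show "?M i \<in> carrier_mat d d" using assms(3)[OF i] by auto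
    show "A i ^\<^sub>m l = 1\<^sub>m d + int p \<cdot>\<^sub>m ?M i"
    proof (rule eq_matI)
      fix x y assume "x < dim_row (1\<^sub>m d + int p \<cdot>\<^sub>m ?M i)" "y < dim_col (1\<^sub>m d + int p \<cdot>\<^sub>m ?M i)"
      then have xy: "x < d" "y < d" using assms(3)[OF i] by auto
      then show "(A i ^\<^sub>m l) $$ (x, y) = (1\<^sub>m d + int p \<cdot>\<^sub>m ?M i) $$ (x, y)"
        using assms(3)[OF i] dvd[OF i xy] by (auto simp: dvd_mult_div_cancel)
    qed (use assms(3)[OF i] in auto)
  qed
qed

lemma fdiff_scale: "(fdiff ^^ k) (\<lambda>n. c * f n) = (\<lambda>n. c * (fdiff ^^ k) f n)"
proof (induction k arbitrary: f)
  case (Suc k)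
  have "fdiff (\<lambda>n. c * f n) = (\<lambda>n. c * fdiff f n)" by (auto simp: fdiff_def algebra_simps)
  then show ?case using Suc by (simp del: funpow.simps add: funpow_Suc_right)
qed simp

text \<open>With B = 1 + p M one has B^(n+1) w - B^n w = p B^n (M w): each difference releases one
  factor p and replaces \<open>w i\<close> by \<open>M i *\<^sub>v w i\<close>. Hence the induction
  over arbitrary w.\<close>

lemma power_dvd_fdiff:
  fixes B M :: "'i \<Rightarrow> int mat" and w :: "'i \<Rightarrow> int vec"
  assumes "\<And>i. i \<in> I \<Longrightarrow> M i \<in> carrier_mat d d" "\<And>i. i \<in> I \<Longrightarrow> w i \<in> carrier_vec d"
    and "\<And>i. i \<in> I \<Longrightarrow> B i = 1\<^sub>m d + p \<cdot>\<^sub>m M i" and j: "j < d"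
  shows "p ^ k dvd (fdiff ^^ k) (\<lambda>n. \<Sum>i\<in>I. (B i ^\<^sub>m n *\<^sub>v w i) $ j) 0"
  using assms(2)
proof (induction k arbitrary: w)
  case (Suc k)
  have B: "B i \<in> carrier_mat d d" if "i \<in> I" for i using assms that by auto
  have "fdiff (\<lambda>n. \<Sum>i\<in>I. (B i ^\<^sub>m n *\<^sub>v w i) $ j) =
      (\<lambda>n. p * (\<Sum>i\<in>I. (B i ^\<^sub>m n *\<^sub>v (M i *\<^sub>v w i)) $ j))"
  proof
    fix n
    have "(B i ^\<^sub>m Suc n *\<^sub>v w i) $ j - (B i ^\<^sub>m n *\<^sub>v w i) $ j = p * (B i ^\<^sub>m n *\<^sub>v (M i *\<^sub>v w i)) $ j"
      if i: "i \<in> I" for i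
    proof -
      note c = assms(1)[OF i] Suc.prems[OF i] B[OF i]
      have "B i *\<^sub>v w i = w i + p \<cdot>\<^sub>v (M i *\<^sub>v w i)"
        using c by (simp add: assms(3)[OF i] add_mult_distrib_mat_vec[of _ d d] smult_mat_mult_vec[of _ d d])
      then have "B i ^\<^sub>m Suc n *\<^sub>v w i = B i ^\<^sub>m n *\<^sub>v w i + p \<cdot>\<^sub>v (B i ^\<^sub>m n *\<^sub>v (M i *\<^sub>v w i))"
        using c by (simp only: pow_mat_Suc_mult_vec(1)[of _ d])
          (simp add: mult_add_distrib_mat_vec[of _ d d] mult_mat_vec_smult[of _ d d])
      then show ?thesis using c j by simp
    qed
    then show "fdiff (\<lambda>n. \<Sum>i\<in>I. (B i ^\<^sub>m n *\<^sub>v w i) $ j) n =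
        p * (\<Sum>i\<in>I. (B i ^\<^sub>m n *\<^sub>v (M i *\<^sub>v w i)) $ j)"
      unfolding fdiff_def sum_subtractf[symmetric] sum_distrib_left by (rule sum.cong[OF refl])
  qed
  moreover have "p ^ k dvd (fdiff ^^ k) (\<lambda>n. \<Sum>i\<in>I. (B i ^\<^sub>m n *\<^sub>v (M i *\<^sub>v w i)) $ j) 0"
    by (rule Suc.IH) (use assms(1) Suc.prems in \<open>auto intro!: mult_mat_vec_carrier\<close>)
  ultimately show ?case
    by (simp del: funpow.simps add: funpow_Suc_right fdiff_scale)
qed simp

lemma infinite_residue_class:
  assumes "infinite Z" "(l::nat) \<ge> 1"
  obtains r where "infinite {k. l * k + r \<in> Z}"
proof -
  have "\<exists>r\<in>{..<l}. infinite {n \<in> Z. n mod l = r}"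
  proof (rule ccontr)
    assume "\<not> ?thesis"
    then have "finite (\<Union>r\<in>{..<l}. {n \<in> Z. n mod l = r})" by auto
    moreover have "Z \<subseteq> (\<Union>r\<in>{..<l}. {n \<in> Z. n mod l = r})" using assms(2) by auto
    ultimately show False using assms(1) finite_subset by blast
  qed
  then obtain r where r: "infinite {n \<in> Z. n mod l = r}" by blast
  have "{n \<in> Z. n mod l = r} \<subseteq> (\<lambda>k. l * k + r) ` {k. l * k + r \<in> Z}"
  proof
    fix n assume n: "n \<in> {n \<in> Z. n mod l = r}"
    then have "n = l * (n div l) + r" by auto
    then show "n \<in> (\<lambda>k. l * k + r) ` {k. l * k + r \<in> Z}" using n by (intro image_eqI[of _ _ "n div l"]) auto
  qed
  then have "infinite {k. l * k + r \<in> Z}" using r finite_surj by blast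
  then show thesis by (rule that)
qed

text \<open>The step matrix of the progression l n + r is 1 mod p, so every coordinate has k-th
  differences divisible by p^k and vanishes identically once it has infinitely many zeros. The zero
  set is common to all coordinates, so one pair l, r serves them all.\<close>

lemma skolem_mahler_lech_int:
  fixes A :: "'i \<Rightarrow> int mat" and v :: "'i \<Rightarrow> int vec"
  assumes "finite I" "\<And>i. i \<in> I \<Longrightarrow> A i \<in> carrier_mat d d" "\<And>i. i \<in> I \<Longrightarrow> v i \<in> carrier_vec d"
    and det: "\<And>i. i \<in> I \<Longrightarrow> det (A i) \<noteq> 0"
    and inf: "infinite {n. \<forall>j<d. (\<Sum>i\<in>I. (A i ^\<^sub>m n *\<^sub>v v i) $ j) = 0}"
  shows "\<exists>l\<ge>1. \<exists>r. \<forall>n. \<forall>j<d. (\<Sum>i\<in>I. (A i ^\<^sub>m (l * n + r) *\<^sub>v v i) $ j) = 0"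
proof -
  define D where "D = (\<Prod>i\<in>I. det (A i))"
  \<comment> \<open>Exceeding |D| keeps p from dividing any determinant; the summand 2 makes p odd,
    as the factorial estimate requires.\<close>
  obtain p where p: "prime p" "nat \<bar>D\<bar> + 2 < p" using bigger_prime by blast
  have "D \<noteq> 0" using det assms(1) by (simp add: D_def)
  have ndvd: "\<not> int p dvd det (A i)" if "i \<in> I" for i
  proof
    assume "int p dvd det (A i)"
    also have "det (A i) dvd D" unfolding D_def using that assms(1) by (rule dvd_prodI[rotated])
    finally have "int p \<le> \<bar>D\<bar>" using dvd_imp_le_int[OF \<open>D \<noteq> 0\<close>] by fastforce
    then show False using p by linarith
  qed
  obtain l M where
    l: "l \<ge> 1" and M: "\<And>i. i \<in> I \<Longrightarrow> M i \<in> carrier_mat d d"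
    "\<And>i. i \<in> I \<Longrightarrow> A i ^\<^sub>m l = 1\<^sub>m d + int p \<cdot>\<^sub>m M i"
    using power_congruent_one_mod_prime[where A = A, OF assms(1) p(1) assms(2) ndvd] by blast
  obtain r where r: "infinite {k. l * k + r \<in> {n. \<forall>j<d. (\<Sum>i\<in>I. (A i ^\<^sub>m n *\<^sub>v v i) $ j) = 0}}"
    using infinite_residue_class[OF inf l] .
  have eq: "A i ^\<^sub>m (l * k + r) *\<^sub>v v i = (A i ^\<^sub>m l) ^\<^sub>m k *\<^sub>v (A i ^\<^sub>m r *\<^sub>v v i)" if "i \<in> I" for i k
    using assms(2,3)[OF that]
    by (simp add: pow_mat_add pow_mat_mult assoc_mult_mat_vec[of _ d d _ d])
  have "(\<Sum>i\<in>I. (A i ^\<^sub>m (l * n + r) *\<^sub>v v i) $ j) = 0" if "j < d" for n j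
  proof -
    let ?f = "\<lambda>k. \<Sum>i\<in>I. ((A i ^\<^sub>m l) ^\<^sub>m k *\<^sub>v (A i ^\<^sub>m r *\<^sub>v v i)) $ j"
    have f: "?f k = (\<Sum>i\<in>I. (A i ^\<^sub>m (l * k + r) *\<^sub>v v i) $ j)" for k
      by (intro sum.cong refl) (simp add: eq)
    have "?f n = 0"
    proof (rule zero_of_infinitely_many_zeros[OF p(1), of ?f])
      show "p \<ge> 3" using p by simp
      show "int p ^ k dvd (fdiff ^^ k) ?f 0" for k
        by (rule power_dvd_fdiff[OF M(1) _ M(2) that])
          (use assms(2,3) in \<open>auto intro!: mult_mat_vec_carrier[of _ d d]\<close>)
      show "infinite {n. ?f n = 0}"
      proof (rule infinite_super[OF _ r], rule subsetI)
        fix k assume "k \<in> {k. l * k + r \<in> {n. \<forall>j<d. (\<Sum>i\<in>I. (A i ^\<^sub>m n *\<^sub>v v i) $ j) = 0}}"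
        then have "(\<Sum>i\<in>I. (A i ^\<^sub>m (l * k + r) *\<^sub>v v i) $ j) = 0" using that by blast
        then show "k \<in> {n. ?f n = 0}" unfolding mem_Collect_eq f .
      qed
    qed
    then show ?thesis unfolding f .
  qed
  with l show ?thesis by blast
qed

lemma common_denominator:
  assumes "finite (X :: rat set)"
  obtains N :: int where "N > 0" "\<And>x. x \<in> X \<Longrightarrow> of_int N * x \<in> \<int>"
proof -
  define N where "N = (\<Prod>x\<in>X. snd (quotient_of x))"
  have "N > 0" unfolding N_def by (intro prod_pos) (simp add: quotient_of_denom_pos')
  moreover have "of_int N * x \<in> \<int>" if "x \<in> X" for x
  proof -
    have "x = of_int (fst (quotient_of x)) / of_int (snd (quotient_of x))"
      by (metis prod.collapse quotient_of_div)
    moreover have "snd (quotient_of x) dvd N" unfolding N_def using that assms by (rule dvd_prodI[rotated])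
    then obtain k where "N = snd (quotient_of x) * k" by blast
    moreover have "snd (quotient_of x) \<noteq> 0" using quotient_of_denom_pos'[of x] by simp
    ultimately have "of_int N * x = of_int (k * fst (quotient_of x))" by (simp add: field_simps)
    then show ?thesis by (metis Ints_of_int)
  qed
  ultimately show thesis using that by blast
qed

text \<open>Scaling all matrices and vectors by one denominator N multiplies
  \<open>A i ^\<^sub>m n *\<^sub>v v i\<close> by N^(n+1). The factor does not depend on i, so the
  scaled relation holds at the same times n.\<close>

lemma skolem_mahler_lech_rat:
  fixes A :: "'i \<Rightarrow> rat mat" and v :: "'i \<Rightarrow> rat vec"
  assumes "finite I" and A: "\<And>i. i \<in> I \<Longrightarrow> A i \<in> carrier_mat d d" and v: "\<And>i. i \<in> I \<Longrightarrow> v i \<in> carrier_vec d"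
    and det: "\<And>i. i \<in> I \<Longrightarrow> det (A i) \<noteq> 0"
    and inf: "infinite {n. \<forall>j<d. (\<Sum>i\<in>I. (A i ^\<^sub>m n *\<^sub>v v i) $ j) = 0}"
  shows "\<exists>l\<ge>1. \<exists>r. \<forall>n. \<forall>j<d. (\<Sum>i\<in>I. (A i ^\<^sub>m (l * n + r) *\<^sub>v v i) $ j) = 0"
proof -
  define X where "X = (\<lambda>(i, a, b). A i $$ (a, b)) ` (I \<times> {..<d} \<times> {..<d}) \<union> (\<lambda>(i, a). v i $ a) ` (I \<times> {..<d})"
  have "finite X"
    unfolding X_def by (rule finite_UnI; rule finite_imageI)
      (rule finite_cartesian_product[OF assms(1) finite_cartesian_product[OF finite_lessThan finite_lessThan]]
            finite_cartesian_product[OF assms(1) finite_lessThan])+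
  obtain N where N: "N > 0" "\<And>x. x \<in> X \<Longrightarrow> of_int N * x \<in> \<int>"
    using common_denominator[OF \<open>finite X\<close>] by blast
  have NA: "of_int N * A i $$ (a, b) \<in> \<int>" if "i \<in> I" "a < d" "b < d" for i a b
  proof (rule N(2))
    have "(\<lambda>(i, a, b). A i $$ (a, b)) (i, a, b) \<in> X" unfolding X_def using that by blast
    then show "A i $$ (a, b) \<in> X" by simp
  qed
  have Nv: "of_int N * v i $ a \<in> \<int>" if "i \<in> I" "a < d" for i a
  proof (rule N(2))
    have "(\<lambda>(i, a). v i $ a) (i, a) \<in> X" unfolding X_def using that by blast
    then show "v i $ a \<in> X" by simp
  qed
  define A' where "A' = (\<lambda>i. mat d d (\<lambda>(a, b). \<lfloor>of_int N * A i $$ (a, b)\<rfloor>))"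
  define v' where "v' = (\<lambda>i. vec d (\<lambda>a. \<lfloor>of_int N * v i $ a\<rfloor>))"
  have A': "A' i \<in> carrier_mat d d" and v': "v' i \<in> carrier_vec d" for i by (auto simp: A'_def v'_def)
  have mapA: "map_mat rat_of_int (A' i) = of_int N \<cdot>\<^sub>m A i" if "i \<in> I" for i
    using A[OF that] NA[OF that] by (intro eq_matI) (auto simp: A'_def elim!: Ints_cases)
  have mapv: "map_vec rat_of_int (v' i) = of_int N \<cdot>\<^sub>v v i" if "i \<in> I" for i
    using v[OF that] Nv[OF that] by (intro eq_vecI) (auto simp: v'_def elim!: Ints_cases)
  have iter: "map_vec rat_of_int (A' i ^\<^sub>m n *\<^sub>v v' i) = of_int (N ^ Suc n) \<cdot>\<^sub>v (A i ^\<^sub>m n *\<^sub>v v i)" if "i \<in> I" for i n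
  proof (induction n)
    case 0
    then show ?case using A' v' A[OF that] v[OF that] mapv[OF that] by (simp add: A'_def)
  next
    case (Suc n)
    have "map_vec rat_of_int (A' i ^\<^sub>m Suc n *\<^sub>v v' i) = map_vec rat_of_int (A' i *\<^sub>v (A' i ^\<^sub>m n *\<^sub>v v' i))"
      using A' v' by (simp only: pow_mat_Suc_mult_vec(2)[of _ d])
    also have "\<dots> = (of_int N \<cdot>\<^sub>m A i) *\<^sub>v (of_int (N ^ Suc n) \<cdot>\<^sub>v (A i ^\<^sub>m n *\<^sub>v v i))"
      using A' v' by (subst of_int_hom.mult_mat_vec_hom[of _ d d])
        (auto simp: mapA[OF that] Suc intro!: mult_mat_vec_carrier[of _ d d])
    also have "\<dots> = of_int (N ^ Suc (Suc n)) \<cdot>\<^sub>v (A i *\<^sub>v (A i ^\<^sub>m n *\<^sub>v v i))"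
      using A[OF that] v[OF that]
      by (simp add: smult_mat_mult_vec[of _ d d] mult_mat_vec_smult[of _ d d] smult_smult_assoc mult_ac
          mult_mat_vec_carrier[of _ d d])
    also have "A i *\<^sub>v (A i ^\<^sub>m n *\<^sub>v v i) = A i ^\<^sub>m Suc n *\<^sub>v v i"
      using A[OF that] v[OF that] by (simp only: pow_mat_Suc_mult_vec(2)[of _ d])
    finally show ?case .
  qed
  have sum_eq: "rat_of_int (\<Sum>i\<in>I. (A' i ^\<^sub>m n *\<^sub>v v' i) $ j) = of_int (N ^ Suc n) * (\<Sum>i\<in>I. (A i ^\<^sub>m n *\<^sub>v v i) $ j)"
    if "j < d" for n j
  proof -
    have "rat_of_int ((A' i ^\<^sub>m n *\<^sub>v v' i) $ j) = of_int (N ^ Suc n) * (A i ^\<^sub>m n *\<^sub>v v i) $ j" if "i \<in> I" for i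
      using arg_cong[OF iter[OF that, of n], of "\<lambda>x. x $ j"] \<open>j < d\<close> A'[of i] v'[of i] A[OF that] v[OF that]
      by (simp add: carrier_matD)
    then show ?thesis by (simp add: sum_distrib_left)
  qed
  have zero_iff: "(\<Sum>i\<in>I. (A' i ^\<^sub>m n *\<^sub>v v' i) $ j) = 0 \<longleftrightarrow> (\<Sum>i\<in>I. (A i ^\<^sub>m n *\<^sub>v v i) $ j) = 0" if "j < d" for n j
  proof -
    have "rat_of_int (N ^ Suc n) \<noteq> 0" using N(1) by simp
    then have "rat_of_int (\<Sum>i\<in>I. (A' i ^\<^sub>m n *\<^sub>v v' i) $ j) = 0 \<longleftrightarrow> (\<Sum>i\<in>I. (A i ^\<^sub>m n *\<^sub>v v i) $ j) = 0"
      unfolding sum_eq[OF that] mult_eq_0_iff by blast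
    then show ?thesis unfolding of_int_eq_0_iff .
  qed
  have "det (A' i) \<noteq> 0" if "i \<in> I" for i
  proof -
    have "rat_of_int (det (A' i)) = of_int N ^ d * det (A i)"
      unfolding of_int_hom.hom_det[symmetric] mapA[OF that] using A[OF that] by simp
    then show ?thesis using N(1) det[OF that] by auto
  qed
  moreover have eqZ: "{n. \<forall>j<d. (\<Sum>i\<in>I. (A' i ^\<^sub>m n *\<^sub>v v' i) $ j) = 0} =
      {n. \<forall>j<d. (\<Sum>i\<in>I. (A i ^\<^sub>m n *\<^sub>v v i) $ j) = 0}"
    using zero_iff by blast
  then have "infinite {n. \<forall>j<d. (\<Sum>i\<in>I. (A' i ^\<^sub>m n *\<^sub>v v' i) $ j) = 0}"
    using inf by metis
  ultimately obtain l r where lr: "l \<ge> 1" "\<And>n j. j < d \<Longrightarrow> (\<Sum>i\<in>I. (A' i ^\<^sub>m (l * n + r) *\<^sub>v v' i) $ j) = 0"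
    using skolem_mahler_lech_int[where A = A' and v = v', OF assms(1) A' v'] by blast
  show ?thesis
  proof (intro exI conjI allI impI)
    show "l \<ge> 1" by (rule lr)
    fix n j assume "j < d"
    then show "(\<Sum>i\<in>I. (A i ^\<^sub>m (l * n + r) *\<^sub>v v i) $ j) = 0"
      using lr(2)[of j n] zero_iff[of j "l * n + r"] by blast
  qed
qed

section \<open>Relations between orbits and families of eigenvectors\<close>

text \<open>Let L be the block diagonal map with blocks \<open>B i\<close>. By \<open>rel\<close>
  the whole cyclic space of the family w lies in the kernel of the map that adds up the components,
  so an eigenvector of L in that space is a family of eigenvectors with sum zero.\<close>

lemma eigenvectors_from_relation:
  fixes B :: "'i \<Rightarrow> rat mat" and w :: "'i \<Rightarrow> rat vec"
  assumes "finite S" and B: "\<And>i. i \<in> S \<Longrightarrow> B i \<in> carrier_mat d d" and w: "\<And>i. i \<in> S \<Longrightarrow> w i \<in> carrier_vec d"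
    and rel: "\<And>n j. j < d \<Longrightarrow> (\<Sum>i\<in>S. (B i ^\<^sub>m n *\<^sub>v w i) $ j) = 0"
    and ne: "\<exists>i\<in>S. w i \<noteq> 0\<^sub>v d"
  obtains u \<mu> where "\<And>i. i \<in> S \<Longrightarrow> u i \<in> carrier_vec d"
    "\<And>i. i \<in> S \<Longrightarrow> map_mat complex_of_rat (B i) *\<^sub>v u i = \<mu> \<cdot>\<^sub>v u i"
    "\<And>j. j < d \<Longrightarrow> (\<Sum>i\<in>S. u i $ j) = 0" "\<exists>i\<in>S. u i \<noteq> 0\<^sub>v d"
proof -
  \<comment> \<open>A pair (i, j) stands for coordinate j of block i.\<close>
  define e where "e = (\<lambda>n (i, j). complex_of_rat ((B i ^\<^sub>m n *\<^sub>v w i) $ j))"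
  have fin: "finite (S \<times> {..<d})" using assms(1) by simp
  obtain i0 where i0: "i0 \<in> S" "w i0 \<noteq> 0\<^sub>v d" using ne by blast
  then obtain j0 where "j0 < d" "w i0 $ j0 \<noteq> 0" using w[OF i0(1)] by (metis carrier_vecD eq_vecI index_zero_vec)
  then have "\<exists>t\<in>S \<times> {..<d}. e 0 t \<noteq> 0" using i0 B[OF i0(1)] w[OF i0(1)]
    by (intro bexI[of _ "(i0, j0)"]) (auto simp: e_def)
  from eigenvector_from_powers[of "S \<times> {..<d}" e, OF fin this] obtain q \<mu> where q:
    "\<exists>t\<in>S \<times> {..<d}. (\<Sum>n\<le>degree q. coeff q n * e n t) \<noteq> 0"
    "\<And>t. t \<in> S \<times> {..<d} \<Longrightarrow> (\<Sum>n\<le>degree q. coeff q n * e (Suc n) t) = \<mu> * (\<Sum>n\<le>degree q. coeff q n * e n t)"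
    by blast
  define u where "u = (\<lambda>i. vec d (\<lambda>j. \<Sum>n\<le>degree q. coeff q n * e n (i, j)))"
  have u: "u i \<in> carrier_vec d" for i by (simp add: u_def)
  show thesis
  proof
    show "u i \<in> carrier_vec d" for i by (rule u)
    show "map_mat complex_of_rat (B i) *\<^sub>v u i = \<mu> \<cdot>\<^sub>v u i" if i: "i \<in> S" for i
    proof (rule eq_vecI)
      fix j assume "j < dim_vec (\<mu> \<cdot>\<^sub>v u i)"
      then have j: "j < d" by (simp add: u_def)
      have step: "(\<Sum>k<d. complex_of_rat (B i $$ (j, k)) * e n (i, k)) = e (Suc n) (i, j)" for n
      proof -
        have "(\<Sum>k<d. complex_of_rat (B i $$ (j, k)) * e n (i, k)) =
            complex_of_rat (\<Sum>k<d. B i $$ (j, k) * (B i ^\<^sub>m n *\<^sub>v w i) $ k)"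
          by (simp add: e_def of_rat_sum of_rat_mult)
        also have "(\<Sum>k<d. B i $$ (j, k) * (B i ^\<^sub>m n *\<^sub>v w i) $ k) = (B i ^\<^sub>m Suc n *\<^sub>v w i) $ j"
          unfolding pow_mat_Suc_mult_vec(2)[OF B[OF i] w[OF i]]
          by (rule index_mult_mat_vec_sum[symmetric])
            (use B[OF i] w[OF i] j in \<open>auto intro!: mult_mat_vec_carrier[of _ d d]\<close>)
        finally show ?thesis by (simp add: e_def)
      qed
      have "(map_mat complex_of_rat (B i) *\<^sub>v u i) $ j = (\<Sum>k<d. complex_of_rat (B i $$ (j, k)) * u i $ k)"
        using B[OF i] u j by (subst index_mult_mat_vec_sum[of _ d d]) (auto intro!: sum.cong)
      also have "\<dots> = (\<Sum>k<d. \<Sum>n\<le>degree q. coeff q n * (complex_of_rat (B i $$ (j, k)) * e n (i, k)))"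
        by (intro sum.cong refl) (auto simp: u_def sum_distrib_left intro!: sum.cong)
      also have "\<dots> = (\<Sum>n\<le>degree q. coeff q n * e (Suc n) (i, j))"
        by (subst sum.swap) (simp only: sum_distrib_left[symmetric] step)
      also have "\<dots> = (\<mu> \<cdot>\<^sub>v u i) $ j" using q(2)[of "(i, j)"] i j by (simp add: u_def)
      finally show "(map_mat complex_of_rat (B i) *\<^sub>v u i) $ j = (\<mu> \<cdot>\<^sub>v u i) $ j" .
    qed (use B[OF i] u[of i] in auto)
    show "(\<Sum>i\<in>S. u i $ j) = 0" if j: "j < d" for j
    proof -
      have "(\<Sum>i\<in>S. u i $ j) = (\<Sum>n\<le>degree q. coeff q n * (\<Sum>i\<in>S. e n (i, j)))"
        using j by (simp add: u_def sum_distrib_left sum.swap[of _ _ S])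
      moreover have "(\<Sum>i\<in>S. e n (i, j)) = 0" for n
        using rel[OF j, of n] by (simp add: e_def of_rat_sum[symmetric])
      ultimately show ?thesis by simp
    qed
    show "\<exists>i\<in>S. u i \<noteq> 0\<^sub>v d"
    proof -
      obtain i j where "i \<in> S" "j < d" "(\<Sum>n\<le>degree q. coeff q n * e n (i, j)) \<noteq> 0" using q(1) by auto
      then have "u i $ j \<noteq> 0\<^sub>v d $ j" by (simp add: u_def)
      then show ?thesis using \<open>i \<in> S\<close> by metis
    qed
  qed
qed

text \<open>View \<complex> as a vector space over \<rat> and extend z to a basis. Nonvanishing at a
  prescribed z is what keeps the rational relation below nontrivial.\<close>

lemma rational_functional:
  fixes z :: complex
  assumes "z \<noteq> 0"
  obtains \<phi> :: "complex \<Rightarrow> rat" where "\<And>x y. \<phi> (x + y) = \<phi> x + \<phi> y"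
    "\<And>q x. \<phi> (of_rat q * x) = q * \<phi> x" "\<phi> z \<noteq> 0"
proof -
  interpret V: vector_space "\<lambda>(q::rat) (x::complex). of_rat q * x"
    by unfold_locales (auto simp: algebra_simps of_rat_add of_rat_mult)
  interpret W: vector_space "(*) :: rat \<Rightarrow> rat \<Rightarrow> rat"
    by unfold_locales (auto simp: algebra_simps)
  interpret P: vector_space_pair "\<lambda>(q::rat) (x::complex). of_rat q * x" "(*) :: rat \<Rightarrow> rat \<Rightarrow> rat" ..
  have "V.independent {z}" using assms by (simp add: V.independent_insert)
  then obtain g where g: "Vector_Spaces.linear (\<lambda>(q::rat) (x::complex). of_rat q * x) (*) g" "\<forall>x\<in>{z}. g x = (1::rat)"
    using P.linear_independent_extend[of "{z}" "\<lambda>_. 1"] by blast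
  show thesis
    using that[of g] g P.linear_add[OF g(1)] P.linear_scale[OF g(1)] by auto
qed

text \<open>A \<open>\<rat>\<close>-linear functional on \<open>\<complex>\<close>, applied to the coordinates, commutes with rational matrices
  and so turns a complex relation between the orbits into a rational one.\<close>

lemma rational_relation_from_eigenvectors:
  fixes B :: "'i \<Rightarrow> rat mat" and u :: "'i \<Rightarrow> complex vec"
  assumes B: "\<And>i. i \<in> S \<Longrightarrow> B i \<in> carrier_mat d d" and u: "\<And>i. i \<in> S \<Longrightarrow> u i \<in> carrier_vec d"
    and eig: "\<And>i. i \<in> S \<Longrightarrow> map_mat complex_of_rat (B i) *\<^sub>v u i = \<mu> \<cdot>\<^sub>v u i"
    and sum0: "\<And>j. j < d \<Longrightarrow> (\<Sum>i\<in>S. u i $ j) = 0" and ne: "\<exists>i\<in>S. u i \<noteq> 0\<^sub>v d"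
  obtains v where "\<And>i. i \<in> S \<Longrightarrow> v i \<in> carrier_vec d" "\<exists>i\<in>S. v i \<noteq> 0\<^sub>v d"
    "\<And>n j. j < d \<Longrightarrow> (\<Sum>i\<in>S. (B i ^\<^sub>m n *\<^sub>v v i) $ j) = 0"
proof -
  obtain i0 where i0: "i0 \<in> S" "u i0 \<noteq> 0\<^sub>v d" using ne by blast
  then obtain j0 where j0: "j0 < d" "u i0 $ j0 \<noteq> 0" using u[OF i0(1)] by (metis carrier_vecD eq_vecI index_zero_vec)
  obtain \<phi> :: "complex \<Rightarrow> rat" where \<phi>: "\<And>x y. \<phi> (x + y) = \<phi> x + \<phi> y"
    "\<And>q x. \<phi> (of_rat q * x) = q * \<phi> x" "\<phi> (u i0 $ j0) \<noteq> 0"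
    using rational_functional[OF j0(2)] by blast
  have \<phi>0: "\<phi> 0 = 0" using \<phi>(2)[of 0 0] by simp
  have \<phi>_sum: "\<phi> (sum f X) = (\<Sum>x\<in>X. \<phi> (f x))" for f and X :: "nat set"
    by (induction X rule: infinite_finite_induct) (auto simp: \<phi>0 \<phi>(1))
  have \<phi>_sumi: "\<phi> (sum f X) = (\<Sum>x\<in>X. \<phi> (f x))" for f and X :: "'i set"
    by (induction X rule: infinite_finite_induct) (auto simp: \<phi>0 \<phi>(1))
  define v where "v = (\<lambda>i. vec d (\<lambda>j. \<phi> (u i $ j)))"
  have v: "v i \<in> carrier_vec d" for i by (simp add: v_def)
  show thesis
  proof
    show "v i \<in> carrier_vec d" for i by (rule v)
    have "v i0 $ j0 \<noteq> 0\<^sub>v d $ j0" using j0 \<phi>(3) by (simp add: v_def)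
    then show "\<exists>i\<in>S. v i \<noteq> 0\<^sub>v d" using i0 by metis
    fix n j assume j: "j < d"
    \<comment> \<open>\<phi> commutes with the rational matrix \<open>B i ^\<^sub>m n\<close>,
      whereas the complex factor \<mu>^n must stay inside \<phi>; the sum over i is therefore also
      taken inside, where it vanishes.\<close>
    have "(B i ^\<^sub>m n *\<^sub>v v i) $ j = \<phi> (\<mu> ^ n * u i $ j)" if i: "i \<in> S" for i
    proof -
      let ?C = "map_mat complex_of_rat (B i)"
      have C: "?C \<in> carrier_mat d d" using B[OF i] by simp
      have pow: "?C ^\<^sub>m n *\<^sub>v u i = \<mu> ^ n \<cdot>\<^sub>v u i"
      proof (induction n)
        case (Suc n)
        then show ?case unfolding pow_mat_Suc_mult_vec(2)[OF C u[OF i]]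
          using C u[OF i] by (simp add: mult_mat_vec_smult[of _ d d] eig[OF i] smult_smult_assoc mult_ac)
      qed (use B[OF i] u[OF i] in auto)
      have "(B i ^\<^sub>m n *\<^sub>v v i) $ j = (\<Sum>k<d. (B i ^\<^sub>m n) $$ (j, k) * \<phi> (u i $ k))"
        using B[OF i] j v[of i] by (subst index_mult_mat_vec_sum[of _ d d]) (auto simp: v_def)
      also have "\<dots> = \<phi> (\<Sum>k<d. (?C ^\<^sub>m n) $$ (j, k) * u i $ k)"
        using B[OF i] j by (simp add: of_rat_hom.mat_hom_pow[symmetric, of _ d] \<phi>_sum \<phi>(2))
      also have "(\<Sum>k<d. (?C ^\<^sub>m n) $$ (j, k) * u i $ k) = (?C ^\<^sub>m n *\<^sub>v u i) $ j"
        using C u[OF i] j by (subst index_mult_mat_vec_sum[of _ d d]) auto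
      finally show ?thesis using u[OF i] j by (simp add: pow)
    qed
    then have "(\<Sum>i\<in>S. (B i ^\<^sub>m n *\<^sub>v v i) $ j) = \<phi> (\<mu> ^ n * (\<Sum>i\<in>S. u i $ j))"
      by (simp add: \<phi>_sumi sum_distrib_left)
    then show "(\<Sum>i\<in>S. (B i ^\<^sub>m n *\<^sub>v v i) $ j) = 0" using sum0[OF j] by (simp add: \<phi>0)
  qed
qed

section \<open>Harmonic analysis on a compact abelian group\<close>

lemma Urysohn_compact:
  fixes K U :: "'a::t2_space set"
  assumes "compact (UNIV :: 'a set)" "compact K" "open U" "K \<subseteq> U"
  obtains f :: "'a \<Rightarrow> real" where "continuous_on UNIV f" "\<And>x. 0 \<le> f x" "\<And>x. f x \<le> 1"
    "\<And>x. x \<in> K \<Longrightarrow> f x = 1" "\<And>x. x \<notin> U \<Longrightarrow> f x = 0"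
proof -
  have haus: "Hausdorff_space (euclidean :: 'a topology)"
    unfolding Hausdorff_space_def by (auto simp: disjnt_def dest!: hausdorff)
  have comp: "compact_space (euclidean :: 'a topology)"
    using assms(1) by (simp add: compact_space_def compactin_euclidean_iff)
  have normal: "normal_space (euclidean :: 'a topology)"
    using compact_Hausdorff_or_regular_imp_normal_space comp haus by blast
  have "closedin euclidean (- U)" "closedin euclidean K"
    using assms compact_imp_closed by (auto simp: closed_closedin[symmetric])
  then obtain f :: "'a \<Rightarrow> real" where f: "continuous_map euclidean (top_of_set {0..1}) f"
      "f ` (- U) \<subseteq> {0}" "f ` K \<subseteq> {1}"
    using Urysohn_lemma[OF normal, of "- U" K 0 1] assms(4) by (force simp: disjnt_def)
  then have "continuous_on UNIV f" "\<And>x. f x \<in> {0..1}"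
    by (auto simp: continuous_map_in_subtopology Pi_iff)
  then show thesis using f(2,3) by (intro that[of f]) auto
qed

lemma compact_space_separating_function:
  fixes x y :: "'a::t2_space"
  assumes "compact (UNIV :: 'a set)" "x \<noteq> y"
  obtains f :: "'a \<Rightarrow> real" where "continuous_on UNIV f" "f x = 1" "f y = 0"
proof -
  have "compact {x}" "open (- {y})" "{x} \<subseteq> - {y}" using assms by auto
  from Urysohn_compact[OF assms(1) this] obtain f :: "'a \<Rightarrow> real" where
    "continuous_on UNIV f" "\<And>z. z \<in> {x} \<Longrightarrow> f z = 1" "\<And>z. z \<notin> - {y} \<Longrightarrow> f z = 0" by metis
  then show thesis by (intro that[of f]) auto
qed

text \<open>\<open>X\<close> is not known to be second countable, so the Borel \<open>\<sigma>\<close>-algebra of \<open>X \<times> X\<close> might exceed the product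
  \<open>\<sigma>\<close>-algebra. Stone--Weierstrass approximation by sums of products avoids the issue.\<close>

lemma continuous_borel_measurable_pair:
  fixes F :: "'a::t2_space \<times> 'a \<Rightarrow> real"
  assumes "compact (UNIV :: 'a set)" "continuous_on UNIV F"
  shows "F \<in> borel_measurable (borel \<Otimes>\<^sub>M borel)"
proof -
  define P :: "('a \<times> 'a \<Rightarrow> real) \<Rightarrow> bool" where
    "P f \<longleftrightarrow> continuous_on UNIV f \<and> f \<in> borel_measurable (borel \<Otimes>\<^sub>M borel)" for f
  \<comment> \<open>Functions of one coordinate are measurable for the product \<sigma>-algebra and
    already separate the points of X x X; sums, products and limits preserve this
    measurability.\<close>
  have P_proj: "P (\<lambda>z. g (fst z))" "P (\<lambda>z. g (snd z))" if g: "continuous_on UNIV g" for g :: "'a \<Rightarrow> real"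
  proof -
    have [measurable]: "g \<in> borel_measurable borel" using g by (rule borel_measurable_continuous_onI)
    show "P (\<lambda>z. g (fst z))" "P (\<lambda>z. g (snd z))" unfolding P_def
      by (auto intro!: continuous_on_compose2[OF g] continuous_intros)
  qed
  have compact2: "compact (UNIV :: ('a \<times> 'a) set)"
    using compact_Times[OF assms(1) assms(1)] by simp
  interpret function_ring_on "Collect P" UNIV
  proof
    fix f g assume "f \<in> Collect P" "g \<in> Collect P"
    then show "(\<lambda>x. f x + g x) \<in> Collect P" "(\<lambda>x. f x * g x) \<in> Collect P"
      unfolding P_def by (auto intro!: continuous_intros)
  next
    fix z w :: "'a \<times> 'a" assume "z \<noteq> w"
    then consider "fst z \<noteq> fst w" | "snd z \<noteq> snd w" by (auto simp: prod_eq_iff)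
    then show "\<exists>f\<in>Collect P. f z \<noteq> f w"
    proof cases
      case 1
      then obtain g :: "'a \<Rightarrow> real" where "continuous_on UNIV g" "g (fst z) = 1" "g (fst w) = 0"
        using compact_space_separating_function[OF assms(1)] by blast
      then show ?thesis by (intro bexI[of _ "\<lambda>z. g (fst z)"]) (auto intro: P_proj)
    next
      case 2
      then obtain g :: "'a \<Rightarrow> real" where "continuous_on UNIV g" "g (snd z) = 1" "g (snd w) = 0"
        using compact_space_separating_function[OF assms(1)] by blast
      then show ?thesis by (intro bexI[of _ "\<lambda>z. g (snd z)"]) (auto intro: P_proj)
    qed
  qed (use compact2 in \<open>auto simp: P_def\<close>)
  obtain G where G: "G \<in> UNIV \<rightarrow> Collect P" "uniform_limit UNIV G F sequentially"
    using Stone_Weierstrass[OF assms(2)] by blast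
  show ?thesis
  proof (rule borel_measurable_LIMSEQ_real)
    show "G n \<in> borel_measurable (borel \<Otimes>\<^sub>M borel)" for n using G(1) by (auto simp: P_def Pi_iff)
    show "(\<lambda>n. G n z) \<longlonglongrightarrow> F z" for z using tendsto_uniform_limitI[OF G(2)] by simp
  qed
qed

section \<open>Integration against Haar measure\<close>

locale compact_haar =
  fixes m :: "'a::{topological_ab_group_add, t2_space} measure"
  assumes compact_UNIV: "compact (UNIV :: 'a set)" and haar: "normalized_haar m"
begin

lemma sets_m [simp, measurable_cong]: "sets m = sets borel"
  using haar by (simp add: normalized_haar_def)

lemma emeasure_translate: "B \<in> sets borel \<Longrightarrow> emeasure m ((+) x ` B) = emeasure m B"
  using haar unfolding normalized_haar_def by blast

lemma outer_regular: "B \<in> sets borel \<Longrightarrow> emeasure m B = (INF U\<in>{U. B \<subseteq> U \<and> open U}. emeasure m U)"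
  using haar unfolding normalized_haar_def by blast

lemma inner_regular: "B \<in> sets borel \<Longrightarrow> emeasure m B = (SUP K\<in>{K. K \<subseteq> B \<and> compact K}. emeasure m K)"
  using haar unfolding normalized_haar_def by blast

lemma space_m [simp]: "space m = UNIV"
  using sets_eq_imp_space_eq[OF sets_m] by simp

lemma emeasure_UNIV [simp]: "emeasure m UNIV = 1"
  using haar by (simp add: normalized_haar_def)

sublocale finite_measure m
  by standard simp

lemma measure_UNIV [simp]: "measure m UNIV = 1"
  by (simp add: measure_def)

lemma measurable_continuous:
  fixes f :: "'a \<Rightarrow> 'b::topological_space"
  assumes "continuous_on UNIV f"
  shows "f \<in> borel_measurable m"
  using borel_measurable_continuous_onI[OF assms] by (simp cong: measurable_cong_sets)

lemma continuous_bounded: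
  fixes f :: "'a \<Rightarrow> 'b::real_normed_vector"
  assumes "continuous_on UNIV f"
  shows "\<exists>K>0. \<forall>x. norm (f x) \<le> K"
  using compact_imp_bounded[OF compact_continuous_image[OF assms compact_UNIV]]
  by (auto simp: bounded_pos)

lemma integrable_continuous:
  fixes f :: "'a \<Rightarrow> 'b::{banach, second_countable_topology}"
  assumes "continuous_on UNIV f"
  shows "integrable m f"
proof -
  obtain K where "\<forall>x. norm (f x) \<le> K" using continuous_bounded[OF assms] by blast
  then show ?thesis
    using measurable_continuous[OF assms] by (intro integrable_const_bound[of _ K]) auto
qed

lemma measurable_translate: "(+) t \<in> measurable m m"
proof -
  have "continuous_on UNIV ((+) t)"
    by (rule continuous_on_add[OF continuous_on_const continuous_on_id])
  then show ?thesis using measurable_continuous by (simp cong: measurable_cong_sets)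
qed

lemma distr_translate: "distr m m ((+) t) = m"
proof (rule measure_eqI)
  fix A assume "A \<in> sets (distr m m ((+) t))"
  then have A: "A \<in> sets borel" by simp
  have eq: "(+) t -` A = (+) (- t) ` A"
  proof (intro equalityI subsetI)
    fix x assume "x \<in> (+) t -` A"
    then show "x \<in> (+) (- t) ` A" by (intro image_eqI[of _ _ "t + x"]) auto
  qed auto
  have "emeasure (distr m m ((+) t)) A = emeasure m ((+) t -` A)"
    using A by (simp add: emeasure_distr[OF measurable_translate])
  also have "\<dots> = emeasure m A"
    unfolding eq using A by (rule emeasure_translate)
  finally show "emeasure (distr m m ((+) t)) A = emeasure m A" .
qed simp

lemma integral_translate:
  fixes f :: "'a \<Rightarrow> 'b::{banach, second_countable_topology}"
  assumes "continuous_on UNIV f"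
  shows "(\<integral>x. f (t + x) \<partial>m) = (\<integral>x. f x \<partial>m)"
proof -
  show ?thesis
    using integral_distr[OF measurable_translate measurable_continuous[OF assms]] by (simp add: distr_translate)
qed

lemma integrable_continuous_pair:
  fixes F :: "'a \<times> 'a \<Rightarrow> complex"
  assumes "continuous_on UNIV F"
  shows "integrable (m \<Otimes>\<^sub>M m) F"
proof -
  interpret P: pair_sigma_finite m m ..
  interpret finite_measure "m \<Otimes>\<^sub>M m"
    by standard (simp add: space_pair_measure emeasure_pair_measure_Times flip: UNIV_Times_UNIV)
  have compact2: "compact (UNIV :: ('a \<times> 'a) set)"
    using compact_Times[OF compact_UNIV compact_UNIV] by simp
  obtain K where K: "\<And>z. cmod (F z) \<le> K"
    using compact_imp_bounded[OF compact_continuous_image[OF assms compact2]]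
    by (auto simp: bounded_iff)
  have "(\<lambda>z. Re (F z)) \<in> borel_measurable (borel \<Otimes>\<^sub>M borel)" "(\<lambda>z. Im (F z)) \<in> borel_measurable (borel \<Otimes>\<^sub>M borel)"
    by (rule continuous_borel_measurable_pair[OF compact_UNIV], intro continuous_intros assms)+
  then have "F \<in> borel_measurable (borel \<Otimes>\<^sub>M borel)" by (simp add: borel_measurable_complex_iff)
  moreover have "sets (m \<Otimes>\<^sub>M m) = sets (borel \<Otimes>\<^sub>M borel)" by (intro sets_pair_measure_cong) simp_all
  ultimately have "F \<in> borel_measurable (m \<Otimes>\<^sub>M m)" by (simp cong: measurable_cong_sets)
  then show ?thesis using K by (intro integrable_const_bound[of _ K]) auto
qed

lemma Fubini_continuous:
  fixes F :: "'a \<Rightarrow> 'a \<Rightarrow> complex"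
  assumes "continuous_on UNIV (\<lambda>(x, y). F x y)"
  shows "(\<integral>y. (\<integral>x. F x y \<partial>m) \<partial>m) = (\<integral>x. (\<integral>y. F x y \<partial>m) \<partial>m)"
proof -
  interpret P: pair_sigma_finite m m ..
  show ?thesis by (rule P.Fubini_integral) (rule integrable_continuous_pair[OF assms])
qed

text \<open>Only translation invariance is given. Integrating f(y - x) over both variables yields
  the integral of f(-x) when x goes first and that of f when y goes first.\<close>

lemma integral_minus:
  fixes f :: "'a \<Rightarrow> complex"
  assumes "continuous_on UNIV f"
  shows "(\<integral>x. f (- x) \<partial>m) = (\<integral>x. f x \<partial>m)"
proof -
  have c: "continuous_on UNIV (\<lambda>x. f (- x))"
    by (rule continuous_on_compose2[OF assms]) (auto intro!: continuous_intros)
  have "(\<integral>x. f (- x) \<partial>m) = (\<integral>y. (\<integral>x. f (- x) \<partial>m) \<partial>m)" by simp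
  also have "\<dots> = (\<integral>y. (\<integral>x. f (y - x) \<partial>m) \<partial>m)"
    using integral_translate[OF c, of "- y" for y] by (simp add: algebra_simps)
  also have "\<dots> = (\<integral>x. (\<integral>y. f (y - x) \<partial>m) \<partial>m)"
    by (rule Fubini_continuous)
      (auto simp: case_prod_beta intro!: continuous_on_compose2[OF assms] continuous_intros)
  also have "\<dots> = (\<integral>x. (\<integral>y. f y \<partial>m) \<partial>m)"
    using integral_translate[OF assms, of "- x" for x] by (simp add: algebra_simps)
  finally show ?thesis by simp
qed

lemma integral_reflect:
  fixes f :: "'a \<Rightarrow> complex"
  assumes "continuous_on UNIV f"
  shows "(\<integral>y. f (x - y) \<partial>m) = (\<integral>y. f y \<partial>m)"
proof -
  have c: "continuous_on UNIV (\<lambda>y. f (x + y))"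
    by (rule continuous_on_compose2[OF assms]) (auto intro!: continuous_intros)
  have "(\<integral>y. f (x - y) \<partial>m) = (\<integral>y. f (x + y) \<partial>m)"
    using integral_minus[OF c] by simp
  then show ?thesis by (simp add: integral_translate[OF assms])
qed

text \<open>Finitely many translates of U cover the compact group, and all have the measure of U; a
  null set U would make X null.\<close>

lemma emeasure_open_pos:
  assumes "open U" "x \<in> U"
  shows "emeasure m U > 0"
proof (rule ccontr)
  assume "\<not> emeasure m U > 0"
  then have zero: "emeasure m U = 0" by simp
  have op: "open ((+) t ` U)" for t
  proof -
    have "(+) t ` U = (+) (- t) -` U"
    proof (intro equalityI subsetI)
      fix y assume "y \<in> (+) (- t) -` U"
      then show "y \<in> (+) t ` U" by (intro image_eqI[of _ _ "- t + y"]) auto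
    qed auto
    then show ?thesis using assms(1) by (auto intro!: open_vimage continuous_intros)
  qed
  have cover: "UNIV \<subseteq> (\<Union>t\<in>UNIV. (+) t ` U)"
  proof
    fix y show "y \<in> (\<Union>t\<in>UNIV. (+) t ` U)"
      using assms(2) by (intro UN_I[of "y - x"] image_eqI[of _ _ x]) auto
  qed
  obtain T where "T \<subseteq> UNIV" and T: "finite T" "UNIV \<subseteq> (\<Union>t\<in>T. (+) t ` U)"
    using compactE_image[OF compact_UNIV op cover] .
  have "emeasure m ((+) t ` U) = 0" for t
    using zero assms(1) by (simp add: emeasure_translate)
  then have "(\<Union>t\<in>T. (+) t ` U) \<in> null_sets m"
    using op T(1) by (intro null_sets_UN' countable_finite) (auto simp: null_sets_def)
  then have "emeasure m UNIV = 0" using T(2) by (metis null_setsD1 top.extremum_uniqueI)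
  then show False by simp
qed

lemma integral_norm_pos:
  fixes f :: "'a \<Rightarrow> real"
  assumes "continuous_on UNIV f" "\<And>x. f x \<ge> 0" "f x \<noteq> 0"
  shows "(\<integral>x. f x \<partial>m) > 0"
proof -
  have "(\<integral>x. f x \<partial>m) \<ge> 0" using assms(2) by simp
  moreover have "(\<integral>x. f x \<partial>m) \<noteq> 0"
  proof
    assume "(\<integral>x. f x \<partial>m) = 0"
    then have "AE x in m. f x = 0"
      using integral_nonneg_eq_0_iff_AE[OF integrable_continuous[OF assms(1)]] assms(2) by simp
    moreover have "open {x. f x \<noteq> 0}"
      using open_vimage[OF _ assms(1), of "- {0}"] by (simp add: vimage_def open_Compl)
    ultimately have "{x. f x \<noteq> 0} \<in> null_sets m"
      by (subst (asm) AE_iff_null) auto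
    then show False
      using emeasure_open_pos[OF \<open>open {x. f x \<noteq> 0}\<close>, of x] assms(3) by (auto simp: null_sets_def)
  qed
  ultimately show ?thesis by simp
qed

text \<open>X need not be first countable, so limits along sequences do not suffice. Compactness of
  the fibre and the tube lemma make \<open>F x\<close> uniformly close to \<open>F x0\<close> for x
  near x0.\<close>

lemma continuous_integral_parameter:
  fixes F :: "'a \<Rightarrow> 'a \<Rightarrow> complex"
  assumes "continuous_on UNIV (\<lambda>(x, y). F x y)"
  shows "continuous_on UNIV (\<lambda>x. \<integral>y. F x y \<partial>m)"
proof (rule continuous_at_imp_continuous_on, rule ballI)
  fix x0
  have slice: "continuous_on UNIV (F x)" for x
  proof -
    have "continuous_on UNIV (\<lambda>y. (\<lambda>(x, y). F x y) (x, y))"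
      by (rule continuous_on_compose2[OF assms continuous_on_Pair[OF continuous_on_const continuous_on_id]]) simp
    then show ?thesis by simp
  qed
  show "isCont (\<lambda>x. \<integral>y. F x y \<partial>m) x0"
    unfolding isCont_def
  proof (rule tendstoI)
    fix e :: real assume "e > 0"
    define W where "W = {z. cmod (F (fst z) (snd z) - F x0 (snd z)) < e / 2}"
    have c2: "continuous_on UNIV (\<lambda>(x, y). F x0 y)"
      unfolding case_prod_beta
      by (rule continuous_on_compose2[OF slice continuous_on_snd[OF continuous_on_id]]) simp
    have "open W"
      using open_vimage[OF open_lessThan[of "e / 2"] continuous_on_norm[OF continuous_on_diff[OF assms c2]]]
      by (simp add: W_def vimage_def case_prod_beta)
    moreover have "{x0} \<times> UNIV \<subseteq> W" using \<open>e > 0\<close> by (auto simp: W_def)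
    ultimately obtain X0 where X0: "x0 \<in> X0" "open X0" "X0 \<times> UNIV \<subseteq> W"
      using Elementary_Topology.tube_lemma[OF compact_UNIV, of W x0] by blast
    have "dist (\<integral>y. F x y \<partial>m) (\<integral>y. F x0 y \<partial>m) < e" if "x \<in> X0" for x
    proof -
      have bound: "cmod (F x y - F x0 y) \<le> e / 2" for y
      proof -
        have "(x, y) \<in> W" using that X0(3) by blast
        then show ?thesis by (simp add: W_def)
      qed
      have "dist (\<integral>y. F x y \<partial>m) (\<integral>y. F x0 y \<partial>m) = cmod (\<integral>y. F x y - F x0 y \<partial>m)"
        by (simp add: dist_norm Bochner_Integration.integral_diff integrable_continuous[OF slice])
      also have "\<dots> \<le> (\<integral>y. cmod (F x y - F x0 y) \<partial>m)" by (rule integral_norm_bound)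
      also have "\<dots> \<le> (\<integral>y. e / 2 \<partial>m)"
        by (intro integral_mono integrable_continuous continuous_intros slice bound)
      finally show ?thesis using \<open>e > 0\<close> by simp
    qed
    then show "\<forall>\<^sub>F x in at x0. dist (\<integral>y. F x y \<partial>m) (\<integral>y. F x0 y \<partial>m) < e"
      using X0 by (auto simp: eventually_at_topological)
  qed
qed

end

section \<open>The convolution algebra and its spectral projections\<close>

text \<open>Log-convexity makes the ratios a (n+1) / a n increase, and submultiplicativity bounds
  them by a 0; \<mu> is their limit. Then a n / \<mu>^(n+1) decreases, and letting m tend to
  infinity in a (m+n+1) / a m <= a n keeps it at least 1. The index is shifted because
  \<open>a n\<close> will be the squared norm of an (n+1)-st power.\<close>

lemma logconvex_submultiplicative_limit:
  fixes a :: "nat \<Rightarrow> real"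
  assumes pos: "\<And>n. a n > 0" and convex: "\<And>n. (a (Suc n))\<^sup>2 \<le> a n * a (Suc (Suc n))"
    and submult: "\<And>m n. a (Suc (m + n)) \<le> a m * a n"
  obtains \<mu> c where "\<mu> > 0" "c \<ge> 1" "(\<lambda>n. a n / \<mu> ^ Suc n) \<longlonglongrightarrow> c"
proof -
  define r where "r = (\<lambda>n. a (Suc n) / a n)"
  have "incseq r"
  proof (rule incseq_SucI)
    fix n show "r n \<le> r (Suc n)"
      using convex[of n] pos[of n] pos[of "Suc n"] by (simp add: r_def field_simps power2_eq_square)
  qed
  moreover have "r n \<le> a 0" for n
    using submult[of n 0] pos[of n] by (simp add: r_def field_simps)
  ultimately obtain \<mu> where \<mu>: "r \<longlonglongrightarrow> \<mu>" "\<And>n. r n \<le> \<mu>"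
    using incseq_convergent by blast
  have "r 0 > 0" using pos by (simp add: r_def)
  then have "\<mu> > 0" using \<mu>(2)[of 0] by linarith
  define c where "c = (\<lambda>n. a n / \<mu> ^ Suc n)"
  have lim: "(\<lambda>m. a (m + k) / a m) \<longlonglongrightarrow> \<mu> ^ k" for k
  proof (induction k)
    case 0
    have "a m / a m = 1" for m using pos[of m] by simp
    then show ?case by simp
  next
    case (Suc k)
    have "(\<lambda>m. a (m + k) / a m * r (m + k)) \<longlonglongrightarrow> \<mu> ^ k * \<mu>"
      by (intro tendsto_mult Suc LIMSEQ_ignore_initial_segment \<mu>(1))
    moreover have eq: "a (m + k) / a m * r (m + k) = a (m + Suc k) / a m" for m
      using pos[of "m + k"] by (simp add: r_def)
    ultimately show ?case unfolding eq power_Suc2 by simp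
  qed
  have "c n \<ge> 1" for n
  proof -
    have "a (m + Suc n) / a m \<le> a n" for m
      using submult[of m n] pos[of m] by (simp add: field_simps)
    then have "\<mu> ^ Suc n \<le> a n" using LIMSEQ_le_const2[OF lim[of "Suc n"]] by blast
    then show ?thesis using \<open>\<mu> > 0\<close> by (simp add: c_def)
  qed
  moreover have "decseq c"
  proof (rule decseq_SucI)
    fix n
    have "a (Suc n) \<le> \<mu> * a n" using \<mu>(2)[of n] pos[of n] by (simp add: r_def field_simps)
    then show "c (Suc n) \<le> c n" using \<open>\<mu> > 0\<close> by (simp add: c_def field_simps)
  qed
  ultimately obtain L where L: "c \<longlonglongrightarrow> L"
    using decseq_convergent[of c 1] by blast
  then have "L \<ge> 1" using LIMSEQ_le_const[OF L, of 1] \<open>\<And>n. c n \<ge> 1\<close> by blast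
  then show thesis using that[OF \<open>\<mu> > 0\<close> _ L[unfolded c_def]] by blast
qed

context compact_haar
begin

abbreviation cont :: "('a \<Rightarrow> complex) \<Rightarrow> bool" where
  "cont f \<equiv> continuous_on UNIV f"

definition conv :: "('a \<Rightarrow> complex) \<Rightarrow> ('a \<Rightarrow> complex) \<Rightarrow> 'a \<Rightarrow> complex" where
  "conv f g = (\<lambda>x. \<integral>y. f y * g (x - y) \<partial>m)"

definition star :: "('a \<Rightarrow> complex) \<Rightarrow> 'a \<Rightarrow> complex" where
  "star f = (\<lambda>x. cnj (f (- x)))"

text \<open>Continuous functions are in general not complete for this L2 norm, so limits are taken
  uniformly; \<open>conv_bound\<close> converts L2 estimates into uniform ones.\<close>

definition nrm :: "('a \<Rightarrow> complex) \<Rightarrow> real" where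
  "nrm f = sqrt (\<integral>x. (cmod (f x))\<^sup>2 \<partial>m)"

lemma cont_add_arg: "cont f \<Longrightarrow> cont (\<lambda>y. f (t + y))"
  by (erule continuous_on_compose2) (auto intro!: continuous_on_add continuous_on_const continuous_on_id)

lemma cont_diff_arg: "cont f \<Longrightarrow> cont (\<lambda>y. f (x - y))"
  by (erule continuous_on_compose2) (auto intro!: continuous_on_diff continuous_on_const continuous_on_id)

lemma cont_diff_arg': "cont f \<Longrightarrow> cont (\<lambda>y. f (y - x))"
  by (erule continuous_on_compose2) (auto intro!: continuous_on_diff continuous_on_const continuous_on_id)

lemma cont_star: "cont f \<Longrightarrow> cont (star f)"
  unfolding star_def
  by (intro continuous_on_cnj, erule continuous_on_compose2)
    (auto intro!: continuous_on_minus continuous_on_id)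

lemma star_star [simp]: "star (star f) = f"
  by (simp add: star_def)

lemma cont_conv:
  assumes "cont f" "cont g"
  shows "cont (conv f g)"
  unfolding conv_def
proof (rule continuous_integral_parameter)
  show "continuous_on UNIV (\<lambda>(x, y). f y * g (x - y))"
    unfolding case_prod_beta
    by (intro continuous_on_mult continuous_on_compose2[OF assms(1)] continuous_on_compose2[OF assms(2)]
        continuous_on_diff continuous_on_fst continuous_on_snd continuous_on_id) auto
qed

lemma integrable_conv: "cont f \<Longrightarrow> cont g \<Longrightarrow> integrable m (\<lambda>y. f y * g (x - y))"
  by (intro integrable_continuous continuous_on_mult cont_diff_arg)

lemma conv_commute:
  assumes "cont f" "cont g"
  shows "conv f g = conv g f"
proof
  fix x
  have "(\<integral>y. g (x - y) * f (x - (x - y)) \<partial>m) = (\<integral>y. g y * f (x - y) \<partial>m)"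
    by (rule integral_reflect) (intro continuous_on_mult cont_diff_arg assms)
  then show "conv f g x = conv g f x" by (simp add: conv_def mult.commute)
qed

lemma conv_assoc:
  assumes "cont f" "cont g" "cont h"
  shows "conv (conv f g) h = conv f (conv g h)"
proof
  fix x
  have inner: "(\<integral>y. g (y - z) * h (x - y) \<partial>m) = conv g h (x - z)" for z
  proof -
    have c: "cont (\<lambda>y. g (y - z) * h (x - y))"
      by (intro continuous_on_mult cont_diff_arg cont_diff_arg' assms)
    show ?thesis using integral_translate[OF c, of z] by (simp add: conv_def algebra_simps)
  qed
  have "conv (conv f g) h x = (\<integral>y. (\<integral>z. f z * g (y - z) * h (x - y) \<partial>m) \<partial>m)"
    by (simp add: conv_def)
  also have "\<dots> = (\<integral>z. (\<integral>y. f z * g (y - z) * h (x - y) \<partial>m) \<partial>m)"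
  proof (rule Fubini_continuous)
    show "continuous_on UNIV (\<lambda>(z, y). f z * g (y - z) * h (x - y))"
      unfolding case_prod_beta
      by (intro continuous_on_mult continuous_on_compose2[OF assms(1)] continuous_on_compose2[OF assms(2)]
        continuous_on_compose2[OF assms(3)] continuous_on_const
        continuous_on_diff continuous_on_fst continuous_on_snd continuous_on_id) auto
  qed
  also have "\<dots> = (\<integral>z. f z * (\<integral>y. g (y - z) * h (x - y) \<partial>m) \<partial>m)"
    by (simp add: mult.assoc)
  also have "\<dots> = conv f (conv g h) x" unfolding inner by (simp add: conv_def)
  finally show "conv (conv f g) h x = conv f (conv g h) x" .
qed

lemma star_conv:
  assumes "cont f" "cont g"
  shows "star (conv f g) = conv (star f) (star g)"
proof
  fix x
  have c: "cont (\<lambda>y. cnj (f y) * cnj (g (- x - y)))"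
    by (intro continuous_on_mult continuous_on_cnj cont_diff_arg assms)
  have "star (conv f g) x = (\<integral>y. cnj (f y) * cnj (g (- x - y)) \<partial>m)"
    by (simp add: star_def conv_def flip: integral_cnj complex_cnj_mult)
  also have "\<dots> = (\<integral>y. cnj (f (- y)) * cnj (g (- x - - y)) \<partial>m)"
    using integral_minus[OF c] by simp
  also have "\<dots> = conv (star f) (star g) x" by (simp add: conv_def star_def algebra_simps)
  finally show "star (conv f g) x = conv (star f) (star g) x" .
qed

lemma conv_add_right:
  assumes "cont f" "cont g" "cont h"
  shows "conv f (\<lambda>x. g x + h x) = (\<lambda>x. conv f g x + conv f h x)"
proof
  fix x
  have "conv f (\<lambda>x. g x + h x) x = (\<integral>y. f y * g (x - y) + f y * h (x - y) \<partial>m)"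
    by (simp add: conv_def algebra_simps)
  also have "\<dots> = conv f g x + conv f h x" unfolding conv_def
    by (rule Bochner_Integration.integral_add) (intro integrable_conv assms)+
  finally show "conv f (\<lambda>x. g x + h x) x = conv f g x + conv f h x" .
qed

lemma conv_cmult_right: "conv f (\<lambda>x. c * g x) = (\<lambda>x. c * conv f g x)"
  by (rule ext) (simp add: conv_def mult.left_commute flip: integral_mult_right_zero)

lemma conv_diff_right:
  assumes "cont f" "cont g" "cont h"
  shows "conv f (\<lambda>x. g x - h x) = (\<lambda>x. conv f g x - conv f h x)"
proof -
  have "cont (\<lambda>x. (- 1) * h x)" by (intro continuous_on_mult continuous_on_const assms)
  from conv_add_right[OF assms(1,2) this] show ?thesis unfolding conv_cmult_right by simp
qed

lemma conv_cmult_left: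
  assumes "cont f" "cont g"
  shows "conv (\<lambda>x. c * f x) g = (\<lambda>x. c * conv f g x)"
  by (rule ext) (simp add: conv_def mult.assoc flip: integral_mult_right_zero)

lemma conv_diff_left:
  assumes "cont f" "cont g" "cont h"
  shows "conv (\<lambda>x. g x - h x) f = (\<lambda>x. conv g f x - conv h f x)"
  using conv_diff_right[OF assms] assms
  by (simp add: conv_commute[of _ f] continuous_on_diff)

lemma conv_add_left:
  assumes "cont f" "cont g" "cont h"
  shows "conv (\<lambda>x. g x + h x) f = (\<lambda>x. conv g f x + conv h f x)"
  using conv_add_right[OF assms] assms
  by (simp add: conv_commute[of _ f] continuous_on_add)

lemma conv_translate:
  "conv f (\<lambda>y. g (t + y)) = (\<lambda>x. conv f g (t + x))"
  by (simp add: conv_def add_diff_eq)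

lemma integrable_norm_sq: "cont f \<Longrightarrow> integrable m (\<lambda>x. (cmod (f x))\<^sup>2)"
  by (intro integrable_continuous continuous_intros)

lemma nrm_sq: "(nrm f)\<^sup>2 = (\<integral>x. (cmod (f x))\<^sup>2 \<partial>m)"
  by (simp add: nrm_def)

lemma nrm_nonneg: "nrm f \<ge> 0"
  by (simp add: nrm_def)

lemma nrm_pos: "cont f \<Longrightarrow> f x \<noteq> 0 \<Longrightarrow> nrm f > 0"
  unfolding nrm_def real_sqrt_gt_0_iff
  by (rule integral_norm_pos[where x = x]) (auto intro!: continuous_intros)

lemma nrm_le:
  assumes "cont f" "\<And>x. cmod (f x) \<le> B"
  shows "nrm f \<le> B"
proof -
  have "B \<ge> 0" using assms(2)[of 0] norm_ge_zero order_trans by blast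
  have "(\<integral>x. (cmod (f x))\<^sup>2 \<partial>m) \<le> (\<integral>x. B\<^sup>2 \<partial>m)"
    using assms by (intro integral_mono integrable_norm_sq) (auto intro: power_mono)
  then show ?thesis using \<open>B \<ge> 0\<close> unfolding nrm_def by (intro real_le_lsqrt) auto
qed

text \<open>Evaluation at 0 serves as a trace on the convolution algebra: squared norms are values
  of convolution products, so norm identities reduce to algebra.\<close>

lemma conv_star_zero: "conv f (star f) 0 = of_real ((nrm f)\<^sup>2)"
proof -
  have "f y * star f (0 - y) = of_real ((cmod (f y))\<^sup>2)" for y
    by (simp only: star_def complex_norm_square) simp
  then show ?thesis by (simp only: conv_def nrm_sq integral_complex_of_real)
qed

lemma Cauchy_Schwarz:
  assumes "cont f" "cont g"
  shows "cmod (\<integral>x. f x * g x \<partial>m) \<le> nrm f * nrm g"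
proof -
  define C where "C = (\<integral>x. cmod (f x) * cmod (g x) \<partial>m)"
  have int: "integrable m (\<lambda>x. cmod (f x) * cmod (g x))"
    by (intro integrable_continuous continuous_intros assms)
  have quad: "0 \<le> (nrm f)\<^sup>2 - 2 * t * C + t\<^sup>2 * (nrm g)\<^sup>2" for t
  proof -
    have "0 \<le> (\<integral>x. (cmod (f x) - t * cmod (g x))\<^sup>2 \<partial>m)" by simp
    also have "\<dots> = (\<integral>x. (cmod (f x))\<^sup>2 - (2 * t) * (cmod (f x) * cmod (g x)) + t\<^sup>2 * (cmod (g x))\<^sup>2 \<partial>m)"
      by (simp add: power2_eq_square algebra_simps)
    also have "\<dots> = (\<integral>x. (cmod (f x))\<^sup>2 \<partial>m) - (\<integral>x. (2 * t) * (cmod (f x) * cmod (g x)) \<partial>m)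
        + (\<integral>x. t\<^sup>2 * (cmod (g x))\<^sup>2 \<partial>m)"
      using integrable_norm_sq[OF assms(1)] integrable_norm_sq[OF assms(2)] int
      by (subst Bochner_Integration.integral_add; (subst Bochner_Integration.integral_diff)?) auto
    finally show ?thesis by (simp add: nrm_sq C_def)
  qed
  have "C \<ge> 0" by (simp add: C_def)
  have "C\<^sup>2 \<le> (nrm f)\<^sup>2 * (nrm g)\<^sup>2"
  proof (cases "nrm g = 0")
    case True
    have "C = 0"
    proof (rule ccontr)
      assume "C \<noteq> 0"
      \<comment> \<open>For \<open>nrm g = 0\<close> the quadratic is affine in t, and this t gives
        it the value -1.\<close>
      then have "2 * (((nrm f)\<^sup>2 + 1) / (2 * C)) * C = (nrm f)\<^sup>2 + 1" by simp
      then show False using quad[of "((nrm f)\<^sup>2 + 1) / (2 * C)"] True by simp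
    qed
    then show ?thesis by simp
  next
    case False
    then have "0 \<le> ((nrm f)\<^sup>2 - 2 * (C / (nrm g)\<^sup>2) * C + (C / (nrm g)\<^sup>2)\<^sup>2 * (nrm g)\<^sup>2) * (nrm g)\<^sup>2"
      using quad[of "C / (nrm g)\<^sup>2"] by (intro mult_nonneg_nonneg) auto
    also have "\<dots> = (nrm f)\<^sup>2 * (nrm g)\<^sup>2 - C\<^sup>2"
      using False by (simp add: field_simps power2_eq_square)
    finally show ?thesis by simp
  qed
  then have "C \<le> nrm f * nrm g"
    by (metis nrm_nonneg mult_nonneg_nonneg power2_le_imp_le power_mult_distrib)
  moreover have "cmod (\<integral>x. f x * g x \<partial>m) \<le> C"
    using integral_norm_bound[of m "\<lambda>x. f x * g x"] by (simp add: C_def norm_mult)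
  ultimately show ?thesis by linarith
qed

lemma nrm_diff_arg:
  assumes "cont f"
  shows "nrm (\<lambda>y. f (x - y)) = nrm f"
proof -
  have "complex_of_real (\<integral>y. (cmod (f (x - y)))\<^sup>2 \<partial>m) = of_real (\<integral>y. (cmod (f y))\<^sup>2 \<partial>m)"
    unfolding integral_complex_of_real[symmetric]
    by (rule integral_reflect[of "\<lambda>y. complex_of_real ((cmod (f y))\<^sup>2)"]) (intro continuous_intros assms)
  then show ?thesis by (simp add: nrm_def)
qed

lemma conv_bound: "cont f \<Longrightarrow> cont g \<Longrightarrow> cmod (conv f g x) \<le> nrm f * nrm g"
  using Cauchy_Schwarz[of f "\<lambda>y. g (x - y)"] by (simp add: conv_def nrm_diff_arg cont_diff_arg)

text \<open>\<open>conv_pow h n\<close> has n + 1 factors, since in general the algebra has no unit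
  to serve as zeroth power; this is the origin of the shifts by \<open>Suc\<close>.\<close>

primrec conv_pow :: "('a \<Rightarrow> complex) \<Rightarrow> nat \<Rightarrow> 'a \<Rightarrow> complex" where
  "conv_pow h 0 = h"
| "conv_pow h (Suc n) = conv h (conv_pow h n)"

lemma cont_conv_pow: "cont h \<Longrightarrow> cont (conv_pow h n)"
  by (induction n) (auto intro: cont_conv)

lemma conv_conv_pow: "cont h \<Longrightarrow> conv (conv_pow h a) (conv_pow h b) = conv_pow h (Suc (a + b))"
  by (induction a) (auto simp: conv_assoc cont_conv_pow)

lemma star_conv_pow: "cont h \<Longrightarrow> star h = h \<Longrightarrow> star (conv_pow h n) = conv_pow h n"
  by (induction n) (auto simp: star_conv cont_conv_pow)

lemma nrm_sq_selfadjoint: "star g = g \<Longrightarrow> of_real ((nrm g)\<^sup>2) = conv g g 0"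
  using conv_star_zero[of g] by simp

lemma selfadjoint_diff: "star f = f \<Longrightarrow> star g = g \<Longrightarrow> star (\<lambda>x. f x - g x) = (\<lambda>x. f x - g x)"
  by (rule ext) (metis (no_types, lifting) complex_cnj_diff star_def)

lemma conv_tendsto_uniform:
  assumes "cont k" "\<And>n. cont (q n)" "cont p" "uniform_limit UNIV q p sequentially"
  shows "(\<lambda>n. conv k (q n) x) \<longlonglongrightarrow> conv k p x"
proof (rule LIMSEQ_I)
  fix e :: real assume "e > 0"
  define d where "d = e / (2 * (nrm k + 1))"
  have "d > 0" using \<open>e > 0\<close> nrm_nonneg[of k] by (simp add: d_def)
  then have "\<forall>\<^sub>F n in sequentially. \<forall>x\<in>UNIV. dist (q n x) (p x) < d"
    by (rule uniform_limitD[OF assms(4)])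
  then obtain N where N: "\<And>n x. n \<ge> N \<Longrightarrow> dist (q n x) (p x) < d"
    unfolding eventually_sequentially by blast
  have "norm (conv k (q n) x - conv k p x) < e" if "n \<ge> N" for n
  proof -
    have c: "cont (\<lambda>x. q n x - p x)" by (intro continuous_on_diff assms)
    have "norm (conv k (q n) x - conv k p x) = cmod (conv k (\<lambda>x. q n x - p x) x)"
      using assms by (simp add: conv_diff_right)
    also have "\<dots> \<le> nrm k * nrm (\<lambda>x. q n x - p x)" by (rule conv_bound[OF assms(1) c])
    also have "\<dots> \<le> nrm k * d"
      using N[OF that] nrm_nonneg by (intro mult_left_mono nrm_le c) (auto simp: dist_norm less_imp_le)
    also have "\<dots> < e"
    proof -
      have "0 \<le> e * nrm k" using \<open>e > 0\<close> nrm_nonneg[of k] by simp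
      then have "nrm k * e < e * (2 * (nrm k + 1))" using \<open>e > 0\<close>
        by (simp add: algebra_simps)
      then show ?thesis using nrm_nonneg[of k] by (simp add: d_def field_simps)
    qed
    finally show ?thesis .
  qed
  then show "\<exists>no. \<forall>n\<ge>no. norm (conv k (q n) x - conv k p x) < e" by blast
qed

text \<open>The spectral projection of \<open>h * h\<close> for its largest eigenvalue \<open>\<mu>\<close> is the uniform limit of
  \<open>(h * h)^n / \<mu>^n\<close>; the numbers \<open>\<parallel>h^n\<parallel>\<^sup>2\<close> are log-convex and submultiplicative, which forces the
  normalised powers to converge to something nonzero.\<close>

lemma spectral_projection:
  assumes h: "cont h" "star h = h" "h x0 \<noteq> 0"
  obtains p \<mu> where "cont p" "star p = p" "conv p p = p" "p 0 \<noteq> 0" "\<mu> \<noteq> 0"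
    "conv (conv h h) p = (\<lambda>x. \<mu> * p x)" "\<And>g. cont g \<Longrightarrow> conv g h = h \<Longrightarrow> conv g p = p"
proof -
  define H where "H = conv_pow h"
  have H [simp]: "cont (H n)" and star_H: "star (H n) = H n"
    and conv_H: "conv (H a) (H b) = H (Suc (a + b))" for n a b
    using h by (auto simp: H_def cont_conv_pow star_conv_pow conv_conv_pow)
  \<comment> \<open>As \<open>H n\<close> is h^(n+1), the number \<open>a n\<close> is both the
    squared norm of h^(n+1) and the value of h^(2n+2) at 0.\<close>
  define a where "a = (\<lambda>n. (nrm (H n))\<^sup>2)"
  have a_eq: "of_real (a n) = H (Suc (2 * n)) 0" for n
    using nrm_sq_selfadjoint[OF star_H[of n]] by (simp add: a_def conv_H mult_2)
  have H_down: "H n \<noteq> (\<lambda>_. 0)" if "H (n + j) \<noteq> (\<lambda>_. 0)" for n j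
    using that
  proof (induction j)
    case (Suc j)
    have "H (n + Suc j) = conv h (H (n + j))" by (simp add: H_def)
    moreover have "conv h (\<lambda>_. 0) = (\<lambda>_. 0)" by (simp add: conv_def)
    ultimately have "H (n + j) \<noteq> (\<lambda>_. 0)" using Suc.prems by metis
    then show ?case by (rule Suc.IH)
  qed simp
  have nrm_H: "nrm (H n) > 0" if "H n \<noteq> (\<lambda>_. 0)" for n
    using that nrm_pos[OF H[of n]] by blast
  \<comment> \<open>The square of a nonzero self-adjoint function has a nonzero value at 0, so
    nonzero powers of h occur arbitrarily far out; by \<open>H_down\<close> none vanishes.\<close>
  have H_up: "\<exists>j. H (n + j) \<noteq> (\<lambda>_. 0)" for n
  proof (induction n)
    case 0
    then show ?case using h(3) by (intro exI[of _ 0]) (auto simp: H_def)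
  next
    case (Suc n)
    then obtain j where "H (n + j) \<noteq> (\<lambda>_. 0)" by blast
    then have "a (n + j) \<noteq> 0" using nrm_H[of "n + j"] by (simp add: a_def)
    then have "H (Suc (2 * (n + j))) 0 \<noteq> 0" unfolding a_eq[symmetric] by simp
    moreover have "Suc n + (n + 2 * j) = Suc (2 * (n + j))" by simp
    ultimately have "H (Suc n + (n + 2 * j)) \<noteq> (\<lambda>_. 0)" by metis
    then show ?case by blast
  qed
  have "a n > 0" for n
  proof -
    obtain j where "H (n + j) \<noteq> (\<lambda>_. 0)" using H_up by blast
    then have "nrm (H n) > 0" by (rule nrm_H[OF H_down])
    then show ?thesis by (simp add: a_def)
  qed
  \<comment> \<open>Cauchy--Schwarz for h^(n+1) and h^(n+3), whose product is h^(2n+4).\<close>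
  moreover have "(a (Suc n))\<^sup>2 \<le> a n * a (Suc (Suc n))" for n
  proof -
    have "cmod (conv (H n) (H (Suc (Suc n))) 0) \<le> nrm (H n) * nrm (H (Suc (Suc n)))"
      by (rule conv_bound) auto
    moreover have "conv (H n) (H (Suc (Suc n))) 0 = of_real (a (Suc n))"
      unfolding conv_H a_eq by (simp add: mult_2)
    ultimately have "\<bar>a (Suc n)\<bar> \<le> nrm (H n) * nrm (H (Suc (Suc n)))" by simp
    then have "\<bar>a (Suc n)\<bar>\<^sup>2 \<le> (nrm (H n) * nrm (H (Suc (Suc n))))\<^sup>2" by (rule power_mono) simp
    then show ?thesis by (simp add: a_def power_mult_distrib)
  qed
  moreover have "a (Suc (i + n)) \<le> a i * a n" for i n
  proof -
    have "nrm (H (Suc (i + n))) \<le> nrm (H i) * nrm (H n)"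
      unfolding conv_H[symmetric] by (rule nrm_le) (auto intro: cont_conv conv_bound)
    then have "(nrm (H (Suc (i + n))))\<^sup>2 \<le> (nrm (H i) * nrm (H n))\<^sup>2" by (rule power_mono) (rule nrm_nonneg)
    then show ?thesis by (simp add: a_def power_mult_distrib)
  qed
  ultimately obtain \<mu> c where \<mu>: "\<mu> > 0" "c \<ge> 1" "(\<lambda>n. a n / \<mu> ^ Suc n) \<longlonglongrightarrow> c"
    using logconvex_submultiplicative_limit[of a] by metis
  define C where "C = (\<lambda>n. a n / \<mu> ^ Suc n)"
  define s where "s = (\<lambda>n. complex_of_real (1 / \<mu> ^ Suc n))"
  \<comment> \<open>\<open>q n\<close> is the (n+1)-st convolution power of h * h divided by
    \<mu>^(n+1); its value at 0 is \<open>C n\<close>, which tends to c.\<close>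
  define q where "q = (\<lambda>n x. s n * H (Suc (2 * n)) x)"
  have q_alt: "q n = (\<lambda>x. s n * H (Suc (2 * n)) x)" for n
    by (simp add: q_def)
  have s_mult: "s i * s n = s (Suc (i + n))" and s_Suc: "s n = of_real \<mu> * s (Suc n)" for i n
    using \<mu>(1) by (simp_all add: s_def power_add)
  have q [simp]: "cont (q n)" for n unfolding q_alt by (intro continuous_on_mult continuous_on_const H)
  have star_q: "star (q n) = q n" for n
    using fun_cong[OF star_H[of "Suc (2 * n)"]] by (auto simp: q_def s_def star_def)
  have q0: "q n 0 = of_real (C n)" for n by (simp add: q_def C_def s_def flip: a_eq)
  have conv_q: "conv (q i) (q n) = q (Suc (i + n))" for i n
  proof -
    have "conv (q i) (q n) = (\<lambda>x. s i * (s n * conv (H (Suc (2 * i))) (H (Suc (2 * n))) x))"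
      unfolding q_alt[of i] conv_cmult_left[OF H q] unfolding q_alt conv_cmult_right ..
    also have "\<dots> = q (Suc (i + n))"
      unfolding conv_H q_alt by (simp add: s_mult flip: mult.assoc)
    finally show ?thesis .
  qed
  define k where "k = conv h h"
  have k: "cont k" "k = H 1" using h by (auto simp: k_def H_def intro: cont_conv)
  have conv_k: "conv k (q n) = (\<lambda>x. of_real \<mu> * q (Suc n) x)" for n
    unfolding q_alt conv_cmult_right k(2) conv_H s_Suc[of n] by (simp add: mult.assoc)
  have nrm_q: "(nrm (\<lambda>x. q i x - q n x))\<^sup>2 = C (Suc (2 * i)) - 2 * C (Suc (i + n)) + C (Suc (2 * n))" for i n
  proof -
    let ?g = "\<lambda>x. q i x - q n x"
    have g: "cont ?g" by (intro continuous_on_diff q)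
    have "complex_of_real ((nrm ?g)\<^sup>2) = conv ?g ?g 0"
      by (rule nrm_sq_selfadjoint[OF selfadjoint_diff[OF star_q star_q]])
    also have "\<dots> = q (Suc (i + i)) 0 - q (Suc (i + n)) 0 - (q (Suc (n + i)) 0 - q (Suc (n + n)) 0)"
      by (simp add: conv_diff_left[OF g q q] conv_diff_right conv_q)
    also have "\<dots> = of_real (C (Suc (2 * i)) - 2 * C (Suc (i + n)) + C (Suc (2 * n)))"
      unfolding q0 mult_2[of i] mult_2[of n] add.commute[of n i] by simp
    finally show ?thesis by (simp only: of_real_eq_iff)
  qed
  \<comment> \<open>By \<open>nrm_q\<close> the sequence is Cauchy in L2, because \<open>C\<close>
    converges. One more convolution with k, which maps \<open>q n\<close> to \<mu> times
    \<open>q (Suc n)\<close>, makes it uniformly Cauchy.\<close>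
  have "uniformly_Cauchy_on UNIV q"
    unfolding uniformly_Cauchy_on_def
  proof (intro allI impI)
    fix e :: real assume "e > 0"
    define d where "d = (e * \<mu> / (nrm k + 1))\<^sup>2 / 4"
    have "nrm k + 1 > 0" using nrm_nonneg[of k] by linarith
    then have "d > 0" using \<open>e > 0\<close> \<mu>(1) by (simp add: d_def)
    obtain N where "\<forall>n\<ge>N. norm (C n - c) < d"
      using LIMSEQ_D[OF \<mu>(3) \<open>d > 0\<close>] by (auto simp only: C_def)
    then have N: "\<And>n. n \<ge> N \<Longrightarrow> \<bar>C n - c\<bar> < d" by simp
    have "dist (q i x) (q n x) < e" if i: "i \<ge> Suc N" and n: "n \<ge> Suc N" for i n x
    proof -
      obtain i' n' where in': "i = Suc i'" "n = Suc n'" "i' \<ge> N" "n' \<ge> N"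
        using i n by (metis Suc_le_D Suc_le_mono)
      have "(nrm (\<lambda>x. q i' x - q n' x))\<^sup>2 < 4 * d"
        unfolding nrm_q using N[of "Suc (2 * i')"] N[of "Suc (i' + n')"] N[of "Suc (2 * n')"] in' by linarith
      also have "4 * d = (e * \<mu> / (nrm k + 1))\<^sup>2" by (simp add: d_def)
      finally have less: "nrm (\<lambda>x. q i' x - q n' x) < e * \<mu> / (nrm k + 1)"
        by (rule power2_less_imp_less) (use \<open>e > 0\<close> \<mu>(1) \<open>nrm k + 1 > 0\<close> in auto)
      have "\<mu> * dist (q i x) (q n x) = cmod (of_real \<mu> * q i x - of_real \<mu> * q n x)"
        using \<mu>(1) by (simp add: dist_norm norm_mult flip: right_diff_distrib)
      also have "\<dots> = cmod (conv k (\<lambda>x. q i' x - q n' x) x)"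
        by (simp add: conv_diff_right k(1) conv_k in'(1,2))
      also have "\<dots> \<le> nrm k * nrm (\<lambda>x. q i' x - q n' x)"
        by (intro conv_bound k(1) continuous_on_diff q)
      also have "\<dots> \<le> (nrm k + 1) * nrm (\<lambda>x. q i' x - q n' x)"
        by (intro mult_right_mono nrm_nonneg) simp
      also have "\<dots> < \<mu> * e"
        using less \<open>nrm k + 1 > 0\<close> by (simp add: field_simps)
      finally show ?thesis using \<mu>(1) by simp
    qed
    then show "\<exists>M. \<forall>x\<in>UNIV. \<forall>i\<ge>M. \<forall>n\<ge>M. dist (q i x) (q n x) < e" by blast
  qed
  then obtain p where p: "uniform_limit UNIV q p sequentially"
    using Cauchy_uniformly_convergent unfolding uniformly_convergent_on_def by blast
  have cp: "cont p" by (rule uniform_limit_theorem[OF _ p]) auto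
  have lim: "(\<lambda>n. q n x) \<longlonglongrightarrow> p x" for x using tendsto_uniform_limitI[OF p] by simp
  have lim': "(\<lambda>n. q (Suc (n + j)) x) \<longlonglongrightarrow> p x" for x j
    using LIMSEQ_ignore_initial_segment[OF lim, of "Suc j"] by simp
  show thesis
  proof
    show "cont p" by (rule cp)
    show "star p = p"
    proof
      fix x
      have "(\<lambda>n. cnj (q n (- x))) \<longlonglongrightarrow> cnj (p (- x))" by (intro tendsto_cnj lim)
      moreover have "cnj (q n (- x)) = q n x" for n using fun_cong[OF star_q[of n], of x] by (simp add: star_def)
      ultimately show "star p x = p x" using LIMSEQ_unique[OF lim[of x]] by (simp add: star_def)
    qed
    have qp: "conv (q j) p = p" for j
    proof
      fix x
      have "(\<lambda>n. q (Suc (j + n)) x) \<longlonglongrightarrow> conv (q j) p x"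
        using conv_tendsto_uniform[OF q q cp p, of j x] by (simp add: conv_q)
      then show "conv (q j) p x = p x" using LIMSEQ_unique lim'[of j x] by (simp add: add.commute)
    qed
    show "conv p p = p"
    proof
      fix x
      have "(\<lambda>n. conv p (q n) x) \<longlonglongrightarrow> conv p p x"
        by (rule conv_tendsto_uniform[OF cp q cp p])
      then have "(\<lambda>n. p x) \<longlonglongrightarrow> conv p p x" by (simp add: conv_commute[OF cp q] qp)
      then show "conv p p x = p x" using LIMSEQ_unique tendsto_const by blast
    qed
    show "p 0 \<noteq> 0"
    proof
      assume "p 0 = 0"
      then have "(\<lambda>n. complex_of_real (C n)) \<longlonglongrightarrow> of_real 0" using lim[of 0] by (simp add: q0)
      then have "C \<longlonglongrightarrow> 0" by (simp only: tendsto_of_real_iff)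
      then show False using \<mu>(2,3) LIMSEQ_unique[of C 0 c] by (simp add: C_def)
    qed
    show "complex_of_real \<mu> \<noteq> 0" using \<mu>(1) by simp
    show "conv (conv h h) p = (\<lambda>x. of_real \<mu> * p x)"
    proof
      fix x
      have "(\<lambda>n. of_real \<mu> * q (Suc n) x) \<longlonglongrightarrow> conv k p x"
        using conv_tendsto_uniform[OF k(1) q cp p, of x] by (simp add: conv_k)
      moreover have "(\<lambda>n. of_real \<mu> * q (Suc n) x) \<longlonglongrightarrow> of_real \<mu> * p x"
        using lim'[of 0 x] by (intro tendsto_mult tendsto_const) simp
      ultimately show "conv (conv h h) p x = of_real \<mu> * p x" using LIMSEQ_unique by (auto simp: k_def)
    qed
    fix g assume g: "cont g" "conv g h = h"
    have gH: "conv g (H n) = H n" for n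
      unfolding H_def using g h(1)
      by (induction n) (auto simp: conv_assoc[symmetric] cont_conv_pow)
    show "conv g p = p"
    proof
      fix x
      have "(\<lambda>n. q n x) \<longlonglongrightarrow> conv g p x"
        using conv_tendsto_uniform[OF g(1) q cp p, of x] by (simp add: q_alt conv_cmult_right gH)
      then show "conv g p x = p x" using LIMSEQ_unique lim by blast
    qed
  qed
qed

end

section \<open>Characters and their abundance\<close>

lemma characters_one: "(\<lambda>_. 1) \<in> characters"
  by (simp add: characters_def)

lemma characters_mult: "\<phi> \<in> characters \<Longrightarrow> \<psi> \<in> characters \<Longrightarrow> (\<lambda>x. \<phi> x * \<psi> x) \<in> characters"
  by (auto simp: characters_def norm_mult intro!: continuous_on_mult)

lemma characters_cnj: "\<phi> \<in> characters \<Longrightarrow> (\<lambda>x. cnj (\<phi> x)) \<in> characters"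
  by (auto simp: characters_def intro!: continuous_on_cnj)

lemma characters_comp:
  "\<phi> \<in> characters \<Longrightarrow> continuous_on UNIV T \<Longrightarrow> (\<And>x y. T (x + y) = T x + T y) \<Longrightarrow> \<phi> \<circ> T \<in> characters"
  by (auto simp: characters_def intro!: continuous_on_compose2[of UNIV \<phi> UNIV T])

lemma characters_prod:
  "(\<And>i. i \<in> I \<Longrightarrow> \<phi> i \<in> characters) \<Longrightarrow> (\<lambda>x. \<Prod>i\<in>I. \<phi> i x) \<in> characters"
  by (induction I rule: infinite_finite_induct) (auto simp: characters_one intro!: characters_mult)

lemma characters_zero: "\<phi> \<in> characters \<Longrightarrow> \<phi> 0 = 1"
proof -
  assume "\<phi> \<in> characters"
  then have "\<phi> (0 + 0) = \<phi> 0 * \<phi> 0" "cmod (\<phi> 0) = 1" unfolding characters_def by blast+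
  then show ?thesis by auto
qed

lemma characters_add: "\<phi> \<in> characters \<Longrightarrow> \<phi> (x + y) = \<phi> x * \<phi> y"
  by (simp add: characters_def)

lemma characters_norm: "\<phi> \<in> characters \<Longrightarrow> cmod (\<phi> x) = 1"
  by (simp add: characters_def)

lemma characters_cont: "\<phi> \<in> characters \<Longrightarrow> continuous_on UNIV \<phi>"
  by (simp add: characters_def)

context compact_haar
begin

definition proj :: "('a \<Rightarrow> complex) \<Rightarrow> bool" where
  "proj p \<longleftrightarrow> cont p \<and> star p = p \<and> conv p p = p"

lemma proj_zero: "proj p \<Longrightarrow> p 0 = of_real ((nrm p)\<^sup>2)"
  using nrm_sq_selfadjoint[of p] by (simp add: proj_def)

text \<open>Since p is its own square, the supremum of |p| is at most the square of
  \<open>nrm p\<close>, while \<open>nrm p\<close> is at most that supremum. The square of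
  \<open>nrm p\<close> is the trace of p, so the traces of a projection and of a proper
  subprojection differ by at least 1.\<close>

lemma proj_nrm_ge_1:
  assumes "proj p" "p x \<noteq> 0"
  shows "(nrm p)\<^sup>2 \<ge> 1"
proof -
  have p: "cont p" "conv p p = p" using assms(1) by (simp_all add: proj_def)
  have "nrm p > 0" using p(1) assms(2) by (rule nrm_pos)
  have "cmod (p y) \<le> nrm p * nrm p" for y
    using conv_bound[OF p(1) p(1), of y] p(2) by simp
  then have "nrm p \<le> nrm p * nrm p" by (rule nrm_le[OF p(1)])
  then have "1 \<le> nrm p" using \<open>nrm p > 0\<close> by simp
  then show ?thesis by simp
qed

lemma proj_diff:
  assumes "proj p" "proj q" "conv p q = q"
  shows "proj (\<lambda>x. p x - q x)"
proof -
  have p: "cont p" "star p = p" "conv p p = p" and q: "cont q" "star q = q" "conv q q = q"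
    using assms by (simp_all add: proj_def)
  have c: "cont (\<lambda>x. p x - q x)" by (intro continuous_on_diff p q)
  have "conv q p = q" using conv_commute[OF q(1) p(1)] assms(3) by simp
  then have "conv (\<lambda>x. p x - q x) (\<lambda>x. p x - q x) = (\<lambda>x. p x - q x)"
    by (simp add: conv_diff_left[OF c p(1) q(1)] conv_diff_right p q assms(3))
  then show ?thesis using c selfadjoint_diff[OF p(2) q(2)] by (simp add: proj_def)
qed

text \<open>A projection of minimal trace spans its own ideal: every self-adjoint \<open>g = p * g\<close> has a spectral
  projection below \<open>p\<close>, hence equal to \<open>p\<close>, so that \<open>g * g\<close> is a multiple of \<open>p\<close>; polarisation with
  \<open>p\<close> shows that \<open>g\<close> is one as well. Applied to the translates of \<open>p\<close> this makes \<open>p\<close> a character up to a scalar.\<close>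

lemma exists_character_coefficient:
  assumes f: "cont f" "f x0 \<noteq> 0"
  shows "\<exists>\<chi>\<in>characters. (\<integral>y. f y * \<chi> (- y) \<partial>m) \<noteq> 0"
proof -
  define h where "h = conv f (star f)"
  have sf: "cont (star f)" by (rule cont_star[OF f(1)])
  have h: "cont h" "star h = h"
    unfolding h_def using f(1) sf by (auto simp: star_conv conv_commute intro: cont_conv)
  have "h 0 \<noteq> 0" using nrm_pos[OF f] by (simp add: h_def conv_star_zero)
  then obtain p0 \<mu> where p0: "cont p0" "star p0 = p0" "conv p0 p0 = p0" "p0 0 \<noteq> 0" "\<mu> \<noteq> 0"
    "conv (conv h h) p0 = (\<lambda>x. \<mu> * p0 x)" by (rule spectral_projection[OF h]) blast
  define k where "k = conv h h"
  have k: "cont k" unfolding k_def by (intro cont_conv h)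
  \<comment> \<open>Projections into the \<mu>-eigenspace of k; this membership is what makes the
    coefficient of f nonzero at the end.\<close>
  define P where "P = {p. proj p \<and> p 0 \<noteq> 0 \<and> conv k p = (\<lambda>x. \<mu> * p x)}"
  define I where "I = Inf ((\<lambda>p. (nrm p)\<^sup>2) ` P)"
  have "p0 \<in> P" using p0 by (simp add: P_def proj_def k_def)
  have bdd: "bdd_below ((\<lambda>p. (nrm p)\<^sup>2) ` P)" by (intro bdd_belowI[of _ 0]) auto
  \<comment> \<open>The infimum need not be attained a priori, but a trace within 1 of it is enough:
    a proper subprojection would lie in P with a trace smaller by at least 1.\<close>
  obtain p where p: "p \<in> P" "(nrm p)\<^sup>2 < I + 1"
  proof -
    have "Inf ((\<lambda>p. (nrm p)\<^sup>2) ` P) < I + 1" unfolding I_def by simp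
    then show thesis using cInf_lessD[of "(\<lambda>p. (nrm p)\<^sup>2) ` P" "I + 1"] \<open>p0 \<in> P\<close> that by blast
  qed
  have pp: "proj p" "p 0 \<noteq> 0" and kp: "conv k p = (\<lambda>x. \<mu> * p x)" using p(1) by (auto simp: P_def)
  have cp: "cont p" and sp: "star p = p" and pconv: "conv p p = p" using pp by (simp_all add: proj_def)
  have minimal: "q = p" if q: "proj q" "q 0 \<noteq> 0" "conv p q = q" for q
  proof (rule ccontr)
    assume "q \<noteq> p"
    then obtain x where x: "p x - q x \<noteq> 0" by (metis eq_iff_diff_eq_0 ext)
    have cq: "cont q" using q(1) by (simp add: proj_def)
    have "conv k q = conv (conv k p) q" using conv_assoc[OF k cp cq] q(3) by simp
    also have "\<dots> = (\<lambda>x. \<mu> * q x)" unfolding kp conv_cmult_left[OF cp cq] q(3) ..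
    finally have "q \<in> P" using q by (simp add: P_def)
    then have "I \<le> (nrm q)\<^sup>2" unfolding I_def using bdd by (intro cInf_lower) auto
    have d: "proj (\<lambda>x. p x - q x)" by (rule proj_diff[OF pp(1) q(1,3)])
    have "complex_of_real ((nrm (\<lambda>x. p x - q x))\<^sup>2) = of_real ((nrm p)\<^sup>2 - (nrm q)\<^sup>2)"
      using proj_zero[OF d] proj_zero[OF pp(1)] proj_zero[OF q(1)] by simp
    then have "(nrm (\<lambda>x. p x - q x))\<^sup>2 = (nrm p)\<^sup>2 - (nrm q)\<^sup>2" by (simp only: of_real_eq_iff)
    then show False using proj_nrm_ge_1[OF d x] \<open>I \<le> (nrm q)\<^sup>2\<close> p(2) by linarith
  qed
  have square: "\<exists>c. conv g g = (\<lambda>x. c * p x)" if g: "cont g" "star g = g" "conv p g = g" for g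
  proof (cases "\<exists>x. g x \<noteq> 0")
    case False
    then have "g = (\<lambda>x. 0)" by auto
    then show ?thesis by (intro exI[of _ 0]) (simp add: conv_def)
  next
    case True
    then obtain x where "g x \<noteq> 0" by blast
    then obtain q \<nu> where q: "cont q" "star q = q" "conv q q = q" "q 0 \<noteq> 0"
      "conv (conv g g) q = (\<lambda>x. \<nu> * q x)"
      and below: "\<And>f. cont f \<Longrightarrow> conv f g = g \<Longrightarrow> conv f q = q"
      by (rule spectral_projection[OF g(1,2)]) blast
    then have "q = p" using below[OF cp g(3)] by (intro minimal) (simp_all add: proj_def)
    then have "conv (conv g g) p = (\<lambda>x. \<nu> * p x)" using q by simp
    moreover have "conv (conv g g) p = conv g g"
      using conv_assoc[OF g(1) g(1) cp] conv_commute[OF g(1) cp] g(3) by simp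
    ultimately show ?thesis by auto
  qed
  have selfadjoint: "\<exists>c. g = (\<lambda>x. c * p x)" if g: "cont g" "star g = g" "conv p g = g" for g
  proof -
    obtain c where c: "conv g g = (\<lambda>x. c * p x)" using square[OF g] by blast
    let ?s = "\<lambda>x. p x + g x"
    have s: "cont ?s" by (intro continuous_on_add cp g)
    have "star ?s = ?s" using sp g(2) by (metis (no_types, lifting) complex_cnj_add star_def)
    moreover have "conv p ?s = ?s" by (simp add: conv_add_right cp g pconv)
    ultimately obtain c' where c': "conv ?s ?s = (\<lambda>x. c' * p x)" using square[OF s] by blast
    have gp: "conv g p = g" using conv_commute[OF g(1) cp] g(3) by simp
    have "conv ?s ?s = (\<lambda>x. p x + g x + (g x + c * p x))"
      by (simp add: conv_add_left[OF s cp g(1)] conv_add_right cp g gp pconv c)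
    then have "p x + g x + (g x + c * p x) = c' * p x" for x using fun_cong[OF c', of x] by simp
    then have "2 * g x = (c' - 1 - c) * p x" for x by (simp add: algebra_simps)
    then have "g = (\<lambda>x. (c' - 1 - c) / 2 * p x)" by (auto simp: field_simps)
    then show ?thesis by blast
  qed
  have translate: "\<exists>c. \<forall>x. p (t + x) = c * p x" for t
  proof -
    have p_cnj: "cnj (p y) = p (- y)" for y using fun_cong[OF sp, of "- y"] by (simp add: star_def)
    \<comment> \<open>A translate of p lies in the ideal of p but is not self-adjoint. Since
      \<open>star\<close> sends the translate by t to the one by -t, these are twice its real part
      and, up to sign, twice its imaginary part.\<close>
    let ?g = "\<lambda>x. p (t + x) + p (- t + x)" and ?h = "\<lambda>x. \<i> * (p (t + x) - p (- t + x))"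
    have c: "cont (\<lambda>x. p (t + x))" "cont (\<lambda>x. p (- t + x))" by (intro cont_add_arg cp)+
    have conv_p: "conv p (\<lambda>x. p (u + x)) = (\<lambda>x. p (u + x))" for u by (simp add: conv_translate pconv)
    have g: "cont ?g" "star ?g = ?g" "conv p ?g = ?g"
    proof -
      show "cont ?g" by (intro continuous_on_add c)
      show "star ?g = ?g" by (rule ext) (simp add: star_def p_cnj algebra_simps)
      show "conv p ?g = ?g" unfolding conv_add_right[OF cp c] conv_p ..
    qed
    have h: "cont ?h" "star ?h = ?h" "conv p ?h = ?h"
    proof -
      show "cont ?h" by (intro continuous_on_diff continuous_on_mult continuous_on_const c)
      show "star ?h = ?h" by (rule ext) (simp add: star_def p_cnj algebra_simps)
      show "conv p ?h = ?h" unfolding conv_cmult_right conv_diff_right[OF cp c] conv_p ..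
    qed
    obtain a b where a: "?g = (\<lambda>x. a * p x)" and b: "?h = (\<lambda>x. b * p x)"
      using selfadjoint[OF g] selfadjoint[OF h] by blast
    have "p (t + x) = (a - \<i> * b) / 2 * p x" for x
    proof -
      have "(a - \<i> * b) * p x = ?g x - \<i> * ?h x"
        using fun_cong[OF a, of x] fun_cong[OF b, of x] by (simp add: algebra_simps)
      also have "\<dots> = 2 * p (t + x)" by (simp add: algebra_simps)
      finally show ?thesis by simp
    qed
    then show ?thesis by blast
  qed
  \<comment> \<open>Each translation multiplies p by a scalar, and evaluation at 0 identifies the
    scalar as p t / p 0; so this quotient is multiplicative.\<close>
  define \<chi> where "\<chi> = (\<lambda>x. p x / p 0)"
  have chi_add: "\<chi> (t + x) = \<chi> t * \<chi> x" for t x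
  proof -
    obtain c where c: "\<And>x. p (t + x) = c * p x" using translate by blast
    then have "p t = c * p 0" by (metis add.right_neutral)
    then show ?thesis using pp(2) c[of x] by (simp add: \<chi>_def)
  qed
  have "\<chi> \<in> characters"
  proof -
    have "cnj (p 0) = p 0" using fun_cong[OF sp, of 0] by (simp add: star_def)
    then have "\<chi> (- x) = cnj (\<chi> x)" for x using fun_cong[OF sp, of "- x"] by (simp add: \<chi>_def star_def)
    moreover have "\<chi> 0 = 1" using pp(2) by (simp add: \<chi>_def)
    ultimately have "\<chi> x * cnj (\<chi> x) = 1" for x using chi_add[of x "- x"] by simp
    then have "complex_of_real ((cmod (\<chi> x))\<^sup>2) = 1" for x by (simp only: complex_norm_square)
    then have "(cmod (\<chi> x))\<^sup>2 = 1" for x by (simp only: of_real_eq_1_iff)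
    then have "cmod (\<chi> x) = 1" for x by (metis norm_ge_zero power2_eq_1_iff not_one_le_zero le_minus_one_simps(3) order_trans abs_norm_cancel abs_1 power2_eq_iff_nonneg one_power2 zero_le_one)
    moreover have "cont \<chi>" unfolding \<chi>_def using pp(2) cp by (intro continuous_on_divide continuous_on_const) auto
    ultimately show ?thesis using chi_add by (simp add: characters_def)
  qed
  \<comment> \<open>Were the coefficient zero, the convolution of f with p would vanish, hence also
    those of h and of k, against k * p = \<mu> p with \<mu> and \<open>p 0\<close> nonzero.\<close>
  moreover have "(\<integral>y. f y * \<chi> (- y) \<partial>m) \<noteq> 0"
  proof
    assume zero: "(\<integral>y. f y * \<chi> (- y) \<partial>m) = 0"
    have p_eq: "p (x - y) = p x * \<chi> (- y)" for x y
    proof -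
      have p_chi: "p z = p 0 * \<chi> z" for z using pp(2) by (simp add: \<chi>_def)
      have "p (x - y) = p 0 * \<chi> (x + - y)" using p_chi[of "x - y"] by simp
      also have "\<dots> = (p 0 * \<chi> x) * \<chi> (- y)" unfolding chi_add by simp
      finally show ?thesis unfolding p_chi[symmetric] .
    qed
    have "conv f p = (\<lambda>x. 0)"
    proof
      fix x
      have "conv f p x = (\<integral>y. p x * (f y * \<chi> (- y)) \<partial>m)" by (simp add: conv_def p_eq mult_ac)
      also have "\<dots> = 0" using zero by simp
      finally show "conv f p x = 0" .
    qed
    moreover have "conv h p = conv (star f) (conv f p)"
      unfolding h_def conv_commute[OF f(1) sf] by (rule conv_assoc[OF sf f(1) cp])
    moreover have "conv k p = conv h (conv h p)" unfolding k_def by (rule conv_assoc[OF h(1) h(1) cp])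
    ultimately have "conv k p 0 = 0" by (simp add: conv_def)
    then show False using kp p0(5) pp(2) by simp
  qed
  ultimately show ?thesis by blast
qed

text \<open>Take a continuous G that distinguishes a from 0 and a character with a nonzero
  coefficient on the difference of G and its translate by a. If its value at a were 1, translation
  invariance would make the two coefficients cancel.\<close>

lemma characters_separate:
  fixes a :: 'a
  assumes "a \<noteq> 0"
  shows "\<exists>\<chi>\<in>characters. \<chi> a \<noteq> 1"
proof -
  obtain g :: "'a \<Rightarrow> real" where g: "continuous_on UNIV g" "g a = 1" "g 0 = 0"
    using compact_space_separating_function[OF compact_UNIV assms] by metis
  define G where "G = (\<lambda>x. complex_of_real (g x))"
  have G: "cont G" unfolding G_def by (intro continuous_on_of_real g)
  have "cont (\<lambda>x. G x - G (a + x))" by (intro continuous_on_diff G cont_add_arg)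
  moreover have "G 0 - G (a + 0) \<noteq> 0" using g by (simp add: G_def)
  ultimately obtain \<chi> where \<chi>: "\<chi> \<in> characters" "(\<integral>y. (G y - G (a + y)) * \<chi> (- y) \<partial>m) \<noteq> 0"
    using exists_character_coefficient by metis
  have "\<chi> a \<noteq> 1"
  proof
    assume "\<chi> a = 1"
    have c: "cont (\<lambda>y. G y * \<chi> (- y))"
      using cont_diff_arg[OF characters_cont[OF \<chi>(1)], of 0] by (intro continuous_on_mult G) simp
    have "\<chi> (- y) = \<chi> (- (a + y))" for y
      using characters_add[OF \<chi>(1), of a "- (a + y)"] \<open>\<chi> a = 1\<close> by (simp add: algebra_simps)
    then have "(\<lambda>y. (G y - G (a + y)) * \<chi> (- y)) = (\<lambda>y. G y * \<chi> (- y) - G (a + y) * \<chi> (- (a + y)))"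
      by (simp add: left_diff_distrib)
    then have "(\<integral>y. (G y - G (a + y)) * \<chi> (- y) \<partial>m)
      = (\<integral>y. G y * \<chi> (- y) \<partial>m) - (\<integral>y. G (a + y) * \<chi> (- (a + y)) \<partial>m)"
      using integrable_continuous[OF c] integrable_continuous[OF cont_add_arg[OF c, of a]]
      by (simp only: Bochner_Integration.integral_diff)
    also have "\<dots> = 0" using integral_translate[OF c, of a] by simp
    finally show False using \<chi>(2) by simp
  qed
  then show ?thesis using \<chi>(1) by blast
qed

text \<open>Translation by t multiplies the integral by \<open>\<phi> t\<close>.\<close>

lemma integral_character:
  assumes "\<phi> \<in> characters"
  shows "(\<integral>x. \<phi> x \<partial>m) = (if \<phi> = (\<lambda>_. 1) then 1 else 0)"
proof (cases "\<phi> = (\<lambda>_. 1)")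
  case False
  then obtain t where t: "\<phi> t \<noteq> 1" by auto
  have "(\<integral>x. \<phi> x \<partial>m) = \<phi> t * (\<integral>x. \<phi> x \<partial>m)"
    using integral_translate[OF characters_cont[OF assms], of t] by (simp add: characters_add[OF assms])
  then show ?thesis using t False by auto
qed simp

end

section \<open>Trigonometric polynomials and their density\<close>

inductive trig_poly :: "('a::topological_ab_group_add \<Rightarrow> complex) \<Rightarrow> bool" where
  trig_character: "\<phi> \<in> characters \<Longrightarrow> trig_poly (\<lambda>x. c * \<phi> x)"
| trig_add: "trig_poly f \<Longrightarrow> trig_poly g \<Longrightarrow> trig_poly (\<lambda>x. f x + g x)"

lemma trig_poly_mult: "trig_poly f \<Longrightarrow> trig_poly g \<Longrightarrow> trig_poly (\<lambda>x. f x * g x)"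
proof (induction rule: trig_poly.induct)
  case (trig_character \<phi> b)
  from trig_character(2) show ?case
  proof (induction rule: trig_poly.induct)
    case (trig_character \<psi> c)
    have "trig_poly (\<lambda>x. (b * c) * (\<phi> x * \<psi> x))"
      by (intro trig_poly.trig_character characters_mult \<open>\<phi> \<in> characters\<close> trig_character)
    then show ?case by (simp add: mult_ac)
  next
    case (trig_add f g)
    then show ?case using trig_poly.trig_add by (simp add: distrib_left)
  qed
next
  case (trig_add f1 f2)
  then show ?case using trig_poly.trig_add by (simp add: distrib_right)
qed

lemma continuous_on_trig_poly: "trig_poly f \<Longrightarrow> continuous_on UNIV f"
  by (induction rule: trig_poly.induct)
    (auto intro: continuous_on_add continuous_on_mult continuous_on_const characters_cont)

context compact_haar
begin

text \<open>Real Stone--Weierstrass for the ring of real-valued trigonometric polynomials. It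
  separates points through the real or the imaginary part of a character, both of which are
  combinations of \<chi> and its conjugate.\<close>

lemma trig_poly_dense:
  fixes f :: "'a \<Rightarrow> real"
  assumes "continuous_on UNIV f" "e > 0"
  shows "\<exists>g. trig_poly g \<and> (\<forall>x. cmod (of_real (f x) - g x) < e)"
proof -
  define P :: "('a \<Rightarrow> real) \<Rightarrow> bool" where "P h \<longleftrightarrow> trig_poly (\<lambda>x. of_real (h x))" for h
  have "\<exists>g. P g \<and> (\<forall>x\<in>UNIV. \<bar>f x - g x\<bar> < e)"
  proof (rule Stone_Weierstrass_HOL[OF compact_UNIV, of P])
    show "P (\<lambda>x. c)" for c
      using trig_character[OF characters_one, of "of_real c"] by (simp add: P_def)
    show "continuous_on UNIV h" if "P h" for h
      using continuous_on_Re[OF continuous_on_trig_poly[OF that[unfolded P_def]]] by simp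
    show "P (\<lambda>x. f x + g x)" if "P f \<and> P g" for f g
      using trig_add that by (auto simp: P_def)
    show "P (\<lambda>x. f x * g x)" if "P f \<and> P g" for f g
      using trig_poly_mult that by (auto simp: P_def)
    show "\<exists>f. P f \<and> f x \<noteq> f y" if "x \<in> UNIV \<and> y \<in> UNIV \<and> x \<noteq> y" for x y
    proof -
      have "x - y \<noteq> 0" using that by simp
      then obtain \<chi> where \<chi>: "\<chi> \<in> characters" "\<chi> (x - y) \<noteq> 1"
        using characters_separate by blast
      have "\<chi> x = \<chi> (x - y) * \<chi> y" using characters_add[OF \<chi>(1), of "x - y" y] by simp
      moreover have "\<chi> y \<noteq> 0" using characters_norm[OF \<chi>(1), of y] by auto
      ultimately have ne: "\<chi> x \<noteq> \<chi> y" using \<chi>(2) by auto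
      note tc = trig_character[OF \<chi>(1)] and tcc = trig_character[OF characters_cnj[OF \<chi>(1)]]
      have Re: "P (\<lambda>x. Re (\<chi> x))"
      proof -
        have "complex_of_real (Re z) = 1 / 2 * z + 1 / 2 * cnj z" for z by (simp add: complex_eq_iff)
        then show ?thesis using trig_add[OF tc[of "1 / 2"] tcc[of "1 / 2"]] by (simp add: P_def)
      qed
      have Im: "P (\<lambda>x. Im (\<chi> x))"
      proof -
        have "complex_of_real (Im z) = (- \<i> / 2) * z + (\<i> / 2) * cnj z" for z by (simp add: complex_eq_iff)
        then show ?thesis using trig_add[OF tc[of "- \<i> / 2"] tcc[of "\<i> / 2"]] by (simp add: P_def)
      qed
      show ?thesis
      proof (cases "Re (\<chi> x) = Re (\<chi> y)")
        case True
        then have "Im (\<chi> x) \<noteq> Im (\<chi> y)" using ne by (simp add: complex_eq_iff)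
        then show ?thesis using Im by blast
      qed (use Re in blast)
    qed
  qed (use assms in auto)
  then obtain g where g: "P g" "\<And>x. \<bar>f x - g x\<bar> < e" by auto
  then show ?thesis
    by (intro exI[of _ "\<lambda>x. of_real (g x)"]) (auto simp: P_def simp flip: of_real_diff)
qed

section \<open>Invariance of Haar measure under epimorphisms\<close>

lemma epimorphism_funpow: "epimorphism T \<Longrightarrow> epimorphism (T ^^ n)"
proof (induction n)
  case 0
  then show ?case by (simp add: epimorphism_def)
next
  case (Suc n)
  then have T: "continuous_on UNIV T" "surj T" "\<And>x y. T (x + y) = T x + T y"
    and Tn: "continuous_on UNIV (T ^^ n)" "surj (T ^^ n)" "\<And>x y. (T ^^ n) (x + y) = (T ^^ n) x + (T ^^ n) y"
    by (auto simp: epimorphism_def)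
  have "continuous_on UNIV (T \<circ> T ^^ n)"
    unfolding o_def by (rule continuous_on_compose2[OF T(1) Tn(1)]) simp
  moreover have "surj (T \<circ> T ^^ n)" by (rule comp_surj[OF Tn(2) T(2)])
  ultimately show ?case by (simp add: epimorphism_def T(3) Tn(3))
qed

lemma character_comp_epimorphism:
  assumes "epimorphism T" "\<phi> \<in> characters"
  shows "\<phi> \<circ> T \<in> characters" "\<phi> \<circ> T = (\<lambda>_. 1) \<longleftrightarrow> \<phi> = (\<lambda>_. 1)"
proof -
  show "\<phi> \<circ> T \<in> characters" using assms by (intro characters_comp) (auto simp: epimorphism_def)
  show "\<phi> \<circ> T = (\<lambda>_. 1) \<longleftrightarrow> \<phi> = (\<lambda>_. 1)"
  proof
    assume eq: "\<phi> \<circ> T = (\<lambda>_. 1)"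
    show "\<phi> = (\<lambda>_. 1)"
    proof
      fix y
      obtain x where "y = T x" using assms(1) unfolding epimorphism_def by (meson surjD)
      then show "\<phi> y = 1" using fun_cong[OF eq, of x] by simp
    qed
  qed auto
qed

text \<open>Surjectivity of T keeps nontrivial characters nontrivial under composition, and only the
  trivial one has a nonzero integral.\<close>

lemma integral_epimorphism_trig:
  assumes "epimorphism T" "trig_poly f"
  shows "(\<integral>x. f (T x) \<partial>m) = (\<integral>x. f x \<partial>m)"
  using assms(2)
proof (induction rule: trig_poly.induct)
  case (trig_character \<phi> c)
  have "(\<integral>x. (\<phi> \<circ> T) x \<partial>m) = (\<integral>x. \<phi> x \<partial>m)"
    using character_comp_epimorphism[OF assms(1) trig_character] trig_character
    by (simp only: integral_character)
  then show ?case by simp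
next
  case (trig_add f g)
  have T: "continuous_on UNIV T" using assms(1) by (simp add: epimorphism_def)
  have "integrable m h" "integrable m (\<lambda>x. h (T x))" if "trig_poly h" for h
    using continuous_on_trig_poly[OF that] continuous_on_compose2[OF continuous_on_trig_poly[OF that] T]
    by (auto intro!: integrable_continuous)
  note this[OF trig_add(1)] this[OF trig_add(2)]
  then show ?case using trig_add(3,4) by simp
qed

lemma integral_epimorphism:
  fixes g :: "'a \<Rightarrow> real"
  assumes "epimorphism T" "continuous_on UNIV g"
  shows "(\<integral>x. g (T x) \<partial>m) = (\<integral>x. g x \<partial>m)"
proof -
  have T: "continuous_on UNIV T" using assms(1) by (simp add: epimorphism_def)
  have gT: "continuous_on UNIV (\<lambda>x. g (T x))" by (rule continuous_on_compose2[OF assms(2) T]) simp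
  let ?G = "\<lambda>x. complex_of_real (g x)"
  have "cmod ((\<integral>x. ?G (T x) \<partial>m) - (\<integral>x. ?G x \<partial>m)) \<le> e" if "e > 0" for e
  proof -
    obtain q where q: "trig_poly q" "\<And>x. cmod (?G x - q x) < e / 2"
      using trig_poly_dense[OF assms(2), of "e / 2"] \<open>e > 0\<close> by auto
    have cq: "cont q" by (rule continuous_on_trig_poly[OF q(1)])
    have cqT: "cont (\<lambda>x. q (T x))" by (rule continuous_on_compose2[OF cq T]) simp
    have bound: "cmod (\<integral>x. u x - v x \<partial>m) \<le> e / 2" if "cont u" "cont v" "\<And>x. cmod (u x - v x) < e / 2" for u v
    proof -
      have "cmod (\<integral>x. u x - v x \<partial>m) \<le> (\<integral>x. cmod (u x - v x) \<partial>m)" by (rule integral_norm_bound)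
      also have "\<dots> \<le> (\<integral>x. e / 2 \<partial>m)"
        using that by (intro integral_mono integrable_continuous continuous_on_norm continuous_on_diff) (auto simp: less_imp_le)
      finally show ?thesis by simp
    qed
    have c: "cont ?G" "cont (\<lambda>x. ?G (T x))" by (intro continuous_on_of_real assms gT)+
    have "(\<integral>x. ?G (T x) \<partial>m) - (\<integral>x. ?G x \<partial>m) = (\<integral>x. ?G (T x) - q (T x) \<partial>m) - (\<integral>x. ?G x - q x \<partial>m)"
      unfolding Bochner_Integration.integral_diff[OF integrable_continuous[OF c(2)] integrable_continuous[OF cqT]]
        Bochner_Integration.integral_diff[OF integrable_continuous[OF c(1)] integrable_continuous[OF cq]]
        integral_epimorphism_trig[OF assms(1) q(1)] by simp
    also have "cmod \<dots> \<le> cmod (\<integral>x. ?G (T x) - q (T x) \<partial>m) + cmod (\<integral>x. ?G x - q x \<partial>m)" by (rule norm_triangle_ineq4)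
    also have "\<dots> \<le> e / 2 + e / 2" by (intro add_mono bound c cq cqT q)
    finally show ?thesis by simp
  qed
  then have "cmod ((\<integral>x. ?G (T x) \<partial>m) - (\<integral>x. ?G x \<partial>m)) \<le> 0" by (rule field_le_epsilon) simp
  then have "complex_of_real (\<integral>x. g (T x) \<partial>m) = of_real (\<integral>x. g x \<partial>m)" by simp
  then show ?thesis by (simp only: of_real_eq_iff)
qed

lemma measure_le_integral:
  fixes g :: "'a \<Rightarrow> real"
  assumes "continuous_on UNIV g" "K \<in> sets borel" "\<And>x. indicator K x \<le> g x"
  shows "measure m K \<le> (\<integral>x. g x \<partial>m)"
proof -
  have "(\<integral>x. indicator K x \<partial>m) \<le> (\<integral>x. g x \<partial>m)"
    by (rule integral_mono[OF _ integrable_continuous[OF assms(1)]])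
      (use assms in \<open>auto simp: emeasure_eq_measure\<close>)
  then show ?thesis using assms(2) by simp
qed

lemma integral_le_measure:
  fixes g :: "'a \<Rightarrow> real"
  assumes "continuous_on UNIV g" "U \<in> sets borel" "\<And>x. g x \<le> indicator U x"
  shows "(\<integral>x. g x \<partial>m) \<le> measure m U"
proof -
  have "(\<integral>x. g x \<partial>m) \<le> (\<integral>x. indicator U x \<partial>m)"
    by (rule integral_mono[OF integrable_continuous[OF assms(1)]])
      (use assms in \<open>auto simp: emeasure_eq_measure\<close>)
  then show ?thesis using assms(2) by simp
qed

lemma measurable_epimorphism: "epimorphism T \<Longrightarrow> T \<in> measurable m m"
  using measurable_continuous[of T] by (simp add: epimorphism_def cong: measurable_cong_sets)

text \<open>Invariance of the integrals of continuous functions passes to open sets by inner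
  regularity of m and Urysohn functions. Regularity of the image measure is not presupposed: the
  reverse inequality takes a compact K in the preimage of U and a Urysohn function for the image of
  K inside U.\<close>

lemma distr_epimorphism:
  assumes "epimorphism T"
  shows "distr m m T = m"
proof -
  have T: "continuous_on UNIV T" using assms by (simp add: epimorphism_def)
  have open_eq: "emeasure (distr m m T) U = emeasure m U" if U: "open U" for U
  proof -
    have TU: "open (T -` U)" using T U by (simp add: open_vimage)
    have "emeasure m U \<le> emeasure m (T -` U)"
      unfolding inner_regular[OF borel_open[OF U]]
    proof (rule SUP_least)
      fix K assume "K \<in> {K. K \<subseteq> U \<and> compact K}"
      then have K: "K \<subseteq> U" "compact K" by auto
      obtain g :: "'a \<Rightarrow> real" where g: "continuous_on UNIV g" "\<And>x. 0 \<le> g x" "\<And>x. g x \<le> 1"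
        "\<And>x. x \<in> K \<Longrightarrow> g x = 1" "\<And>x. x \<notin> U \<Longrightarrow> g x = 0"
        using Urysohn_compact[OF compact_UNIV K(2) U K(1)] by metis
      have "measure m K \<le> (\<integral>x. g x \<partial>m)"
        using K g by (intro measure_le_integral) (auto simp: indicator_def borel_compact)
      also have "\<dots> = (\<integral>x. g (T x) \<partial>m)" by (rule integral_epimorphism[OF assms g(1), symmetric])
      also have "\<dots> \<le> measure m (T -` U)"
        using g TU by (intro integral_le_measure continuous_on_compose2[OF g(1) T]) (auto simp: indicator_def)
      finally show "emeasure m K \<le> emeasure m (T -` U)" by (simp add: emeasure_eq_measure)
    qed
    moreover have "emeasure m (T -` U) \<le> emeasure m U"
      unfolding inner_regular[OF borel_open[OF TU]]
    proof (rule SUP_least)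
      fix K assume "K \<in> {K. K \<subseteq> T -` U \<and> compact K}"
      then have K: "K \<subseteq> T -` U" "compact K" by auto
      have "compact (T ` K)" "T ` K \<subseteq> U"
        using K compact_continuous_image[OF continuous_on_subset[OF T]] by auto
      then obtain g :: "'a \<Rightarrow> real" where g: "continuous_on UNIV g" "\<And>x. 0 \<le> g x" "\<And>x. g x \<le> 1"
        "\<And>x. x \<in> T ` K \<Longrightarrow> g x = 1" "\<And>x. x \<notin> U \<Longrightarrow> g x = 0"
        using Urysohn_compact[OF compact_UNIV _ U] by metis
      have "measure m K \<le> (\<integral>x. g (T x) \<partial>m)"
        using K g by (intro measure_le_integral continuous_on_compose2[OF g(1) T]) (auto simp: indicator_def borel_compact)
      also have "\<dots> = (\<integral>x. g x \<partial>m)" by (rule integral_epimorphism[OF assms g(1)])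
      also have "\<dots> \<le> measure m U"
        using g U by (intro integral_le_measure) (auto simp: indicator_def)
      finally show "emeasure m K \<le> emeasure m U" by (simp add: emeasure_eq_measure)
    qed
    ultimately show ?thesis
      using U by (simp add: emeasure_distr[OF measurable_epimorphism[OF assms]] antisym)
  qed
  show ?thesis
  proof (rule measure_eqI_generator_eq[where E = "{U. open U}" and \<Omega> = UNIV and A = "\<lambda>_. UNIV"])
    show "Int_stable {U :: 'a set. open U}" by (auto simp: Int_stable_def)
    show "sets (distr m m T) = sigma_sets UNIV {U. open U}" "sets m = sigma_sets UNIV {U. open U}"
      by (simp_all add: borel_def)
  qed (use open_eq in auto)
qed

lemma outer_approximation:
  assumes "B \<in> sets borel" "e > 0"
  shows "\<exists>U. open U \<and> B \<subseteq> U \<and> measure m U < measure m B + e"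
proof -
  have "emeasure m B < ennreal (measure m B + e)"
    using assms(2) by (simp add: emeasure_eq_measure ennreal_less_iff)
  then have "(INF U\<in>{U. B \<subseteq> U \<and> open U}. emeasure m U) < ennreal (measure m B + e)"
    using outer_regular[OF assms(1)] by simp
  then obtain U where "B \<subseteq> U" "open U" "emeasure m U < ennreal (measure m B + e)"
    unfolding INF_less_iff by blast
  then show ?thesis by (auto simp: emeasure_eq_measure ennreal_less_iff)
qed

text \<open>Regularity gives a compact K and an open U around B with m(U - K) < e/2. A Urysohn
  function for this pair differs from the indicator of B only on U - K, by at most 1, and a
  trigonometric polynomial is within e/4 of it.\<close>

lemma trig_poly_L1_dense:
  assumes B: "B \<in> sets borel" and "e > 0"
  shows "\<exists>g. trig_poly g \<and> (\<integral>x. cmod (indicator B x - g x) \<partial>m) < e"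
proof -
  obtain U where U: "open U" "B \<subseteq> U" "measure m U < measure m B + e / 4"
    using outer_approximation[OF B, of "e / 4"] \<open>e > 0\<close> by auto
  have "- B \<in> sets borel" using B by auto
  then obtain V where V: "open V" "- B \<subseteq> V" "measure m V < measure m (- B) + e / 4"
    using outer_approximation[of "- B" "e / 4"] \<open>e > 0\<close> by auto
  define K where "K = - V"
  have compl: "measure m (- A) = 1 - measure m A" if "A \<in> sets borel" for A
    using finite_measure_compl[of A] that by (simp add: Compl_eq_Diff_UNIV)
  have K: "compact K" "K \<subseteq> B" "measure m K > measure m B - e / 4"
  proof -
    show "compact K" using compact_Int_closed[OF compact_UNIV, of K] V(1) by (simp add: K_def closed_Compl)
    show "K \<subseteq> B" using V(2) by (auto simp: K_def)
    show "measure m K > measure m B - e / 4" using V(1,3) B by (simp add: K_def compl)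
  qed
  have KU: "K \<subseteq> U" using K(2) U(2) by blast
  obtain g :: "'a \<Rightarrow> real" where g: "continuous_on UNIV g" "\<And>x. 0 \<le> g x" "\<And>x. g x \<le> 1"
    "\<And>x. x \<in> K \<Longrightarrow> g x = 1" "\<And>x. x \<notin> U \<Longrightarrow> g x = 0"
    using Urysohn_compact[OF compact_UNIV K(1) U(1) KU] by metis
  obtain q where q: "trig_poly q" "\<And>x. cmod (of_real (g x) - q x) < e / 4"
    using trig_poly_dense[OF g(1), of "e / 4"] \<open>e > 0\<close> by auto
  have cq: "cont q" by (rule continuous_on_trig_poly[OF q(1)])
  have UK: "U - K \<in> sets m" using U(1) K(1) by (auto simp: borel_compact)
  have meas: "(\<lambda>x. cmod (indicator B x - q x)) \<in> borel_measurable m"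
    using B measurable_continuous[OF cq] by measurable
  have pointwise: "cmod (indicator B x - q x) \<le> indicator (U - K) x + e / 4" for x
  proof -
    have "cmod (indicator B x - complex_of_real (g x)) \<le> indicator (U - K) x"
    proof -
      have "indicator B x - complex_of_real (g x) = of_real (indicator B x - g x)" by (simp add: indicator_def)
      then have "cmod (indicator B x - complex_of_real (g x)) = \<bar>indicator B x - g x\<bar>" by (simp only: norm_of_real)
      also have "\<dots> \<le> indicator (U - K) x"
        using g(2,3)[of x] g(4,5)[of x] K(2) U(2) by (auto simp: indicator_def)
      finally show ?thesis .
    qed
    moreover have "cmod (indicator B x - q x) \<le> cmod (indicator B x - complex_of_real (g x)) + cmod (of_real (g x) - q x)"
      using norm_triangle_ineq[of "indicator B x - complex_of_real (g x)" "of_real (g x) - q x"] by simp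
    ultimately show ?thesis using q(2)[of x] by linarith
  qed
  have int: "integrable m (\<lambda>x. indicator (U - K) x + e / 4)"
    using UK by (intro Bochner_Integration.integrable_add) (auto simp: emeasure_eq_measure)
  have "(\<integral>x. cmod (indicator B x - q x) \<partial>m) \<le> (\<integral>x. indicator (U - K) x + e / 4 \<partial>m)"
  proof (rule integral_mono[OF _ int])
    show "integrable m (\<lambda>x. cmod (indicator B x - q x))"
      using pointwise by (intro Bochner_Integration.integrable_bound[OF int meas]) (auto intro: order_trans[OF _ abs_ge_self])
  qed (rule pointwise)
  also have "\<dots> = measure m (U - K) + e / 4"
    using UK by (subst Bochner_Integration.integral_add) (auto simp: emeasure_eq_measure)
  also have "measure m (U - K) = measure m U - measure m K"
    using U(1) K(1) KU by (intro finite_measure_Diff) (auto simp: borel_compact)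
  also have "measure m U - measure m K + e / 4 < e" using U(3) K(3) \<open>e > 0\<close> by linarith
  finally show ?thesis using q(1) by blast
qed

end

section \<open>Mixing and characters\<close>

lemma prod_indicator:
  assumes "finite F"
  shows "(\<Prod>\<gamma>\<in>F. indicator (B \<gamma>) (y \<gamma>)) = (if \<forall>\<gamma>\<in>F. y \<gamma> \<in> B \<gamma> then 1 else (0::'b::comm_semiring_1))"
  using assms by (induction F rule: finite_induct) auto

context compact_haar
begin

section \<open>Correlation integrals, changed one factor at a time\<close>

text \<open>The class contains characters and indicators and is stable under products and under
  composition with epimorphisms, so every mixed product below is integrable.\<close>

definition bdd_meas :: "('a \<Rightarrow> complex) \<Rightarrow> bool" where
  "bdd_meas g \<longleftrightarrow> g \<in> borel_measurable m \<and> (\<exists>K. \<forall>x. cmod (g x) \<le> K)"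

lemma bdd_meas_continuous: "cont g \<Longrightarrow> bdd_meas g"
  using measurable_continuous[of g] continuous_bounded[of g] by (auto simp: bdd_meas_def)

lemma bdd_meas_indicator: "B \<in> sets borel \<Longrightarrow> bdd_meas (indicator B)"
proof -
  assume "B \<in> sets borel"
  moreover have "cmod (indicator B x) \<le> 1" for x by (simp add: indicator_def)
  ultimately show ?thesis unfolding bdd_meas_def by auto
qed

lemma bdd_meas_integrable: "bdd_meas g \<Longrightarrow> integrable m g"
  unfolding bdd_meas_def by (auto intro!: integrable_const_bound)

lemma bdd_meas_mult:
  assumes "bdd_meas f" "bdd_meas g"
  shows "bdd_meas (\<lambda>x. f x * g x)"
proof -
  obtain K L where "\<And>x. cmod (f x) \<le> K" "\<And>x. cmod (g x) \<le> L"
    using assms by (auto simp: bdd_meas_def)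
  then have "cmod (f x * g x) \<le> K * L" for x
    unfolding norm_mult by (intro mult_mono) (auto intro: order_trans[OF norm_ge_zero])
  then show ?thesis using assms unfolding bdd_meas_def by (blast intro: borel_measurable_times)
qed

lemma bdd_meas_comp:
  assumes "bdd_meas f" "epimorphism T"
  shows "bdd_meas (\<lambda>x. f (T x))"
  using assms measurable_compose[OF measurable_epimorphism[OF assms(2)], of f borel]
  by (auto simp: bdd_meas_def)

lemma bdd_meas_prod: "(\<And>i. i \<in> I \<Longrightarrow> bdd_meas (f i)) \<Longrightarrow> bdd_meas (\<lambda>x. \<Prod>i\<in>I. f i x)"
  by (induction I rule: infinite_finite_induct)
    (auto intro: bdd_meas_mult simp: bdd_meas_continuous continuous_on_const)

lemma integral_comp_epimorphism:
  fixes g :: "'a \<Rightarrow> 'b::{banach, second_countable_topology}"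
  assumes "g \<in> borel_measurable m" "epimorphism T"
  shows "(\<integral>x. g (T x) \<partial>m) = (\<integral>x. g x \<partial>m)"
  using integral_distr[OF measurable_epimorphism[OF assms(2)] assms(1)]
  by (simp add: distr_epimorphism[OF assms(2)])

abbreviation resonances :: "('a \<Rightarrow> 'a) set \<Rightarrow> (('a \<Rightarrow> 'a) \<Rightarrow> 'a \<Rightarrow> complex) \<Rightarrow> nat set" where
  "resonances F \<chi> \<equiv> {n. \<forall>x. (\<Prod>\<gamma>\<in>F. \<chi> \<gamma> ((\<gamma> ^^ n) x)) = 1}"

text \<open>The mixing condition with functions in place of sets: indicators give back mixing, while
  for characters both sides can be computed.\<close>

definition correlates :: "('a \<Rightarrow> 'a) set \<Rightarrow> (('a \<Rightarrow> 'a) \<Rightarrow> 'a \<Rightarrow> complex) \<Rightarrow> bool" where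
  "correlates F f \<longleftrightarrow>
     (\<lambda>n. \<integral>x. (\<Prod>\<gamma>\<in>F. f \<gamma> ((\<gamma> ^^ n) x)) \<partial>m) \<longlonglongrightarrow> (\<Prod>\<gamma>\<in>F. \<integral>x. f \<gamma> x \<partial>m)"

lemma correlates_update:
  assumes "finite F" "\<delta> \<in> F"
  shows "correlates F (f(\<delta> := g)) \<longleftrightarrow>
    (\<lambda>n. \<integral>x. g ((\<delta> ^^ n) x) * (\<Prod>\<gamma>\<in>F - {\<delta>}. f \<gamma> ((\<gamma> ^^ n) x)) \<partial>m)
      \<longlonglongrightarrow> (\<integral>x. g x \<partial>m) * (\<Prod>\<gamma>\<in>F - {\<delta>}. \<integral>x. f \<gamma> x \<partial>m)"
  unfolding correlates_def prod.remove[OF assms] by simp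

context
  fixes F :: "('a \<Rightarrow> 'a) set" and f :: "('a \<Rightarrow> 'a) \<Rightarrow> 'a \<Rightarrow> complex" and \<delta>
  assumes F: "finite F" "\<And>\<gamma>. \<gamma> \<in> F \<Longrightarrow> epimorphism \<gamma>" and \<delta>: "\<delta> \<in> F"
    and f: "\<And>\<gamma>. \<gamma> \<in> F \<Longrightarrow> bdd_meas (f \<gamma>)"
begin

lemma bdd_meas_rest: "bdd_meas (\<lambda>x. \<Prod>\<gamma>\<in>F - {\<delta>}. f \<gamma> ((\<gamma> ^^ n) x))"
  by (rule bdd_meas_prod) (use F(2) f in \<open>auto intro: bdd_meas_comp[OF _ epimorphism_funpow]\<close>)

lemma integrable_update:
  assumes "bdd_meas g"
  shows "integrable m (\<lambda>x. g ((\<delta> ^^ n) x) * (\<Prod>\<gamma>\<in>F - {\<delta>}. f \<gamma> ((\<gamma> ^^ n) x)))"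
  by (rule bdd_meas_integrable[OF bdd_meas_mult[OF
      bdd_meas_comp[OF assms epimorphism_funpow[OF F(2)[OF \<delta>]]] bdd_meas_rest]])

lemma correlates_add:
  assumes "bdd_meas g" "bdd_meas h" "correlates F (f(\<delta> := g))" "correlates F (f(\<delta> := h))"
  shows "correlates F (f(\<delta> := (\<lambda>x. g x + h x)))"
  using tendsto_add[OF assms(3,4)[unfolded correlates_update[OF F(1) \<delta>]]]
  unfolding correlates_update[OF F(1) \<delta>] distrib_right
    Bochner_Integration.integral_add[OF integrable_update[OF assms(1)] integrable_update[OF assms(2)]]
    Bochner_Integration.integral_add[OF bdd_meas_integrable[OF assms(1)] bdd_meas_integrable[OF assms(2)]] .

lemma correlates_cmult:
  assumes "correlates F (f(\<delta> := g))"
  shows "correlates F (f(\<delta> := (\<lambda>x. c * g x)))"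
  using tendsto_mult_left[OF assms[unfolded correlates_update[OF F(1) \<delta>]], of c]
  unfolding correlates_update[OF F(1) \<delta>] by (simp add: mult.assoc)

lemma correlates_trig:
  assumes "\<And>\<chi>. \<chi> \<in> characters \<Longrightarrow> correlates F (f(\<delta> := \<chi>))" "trig_poly g"
  shows "correlates F (f(\<delta> := g))"
  using assms(2)
proof (induction rule: trig_poly.induct)
  case (trig_character \<phi> c)
  then show ?case using assms(1) by (intro correlates_cmult) auto
next
  case (trig_add g h)
  then show ?case
    using correlates_add[OF bdd_meas_continuous bdd_meas_continuous] continuous_on_trig_poly by blast
qed

text \<open>The remaining factors are bounded by a constant C for all n, and the powers of \<delta>
  preserve m. Replacing g by h therefore costs at most C times their L1 distance, uniformly in
  n.\<close>

lemma correlates_L1_limit: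
  assumes g: "bdd_meas g"
    and approx: "\<And>e. e > 0 \<Longrightarrow> \<exists>h. bdd_meas h \<and> correlates F (f(\<delta> := h)) \<and> (\<integral>x. cmod (g x - h x) \<partial>m) < e"
  shows "correlates F (f(\<delta> := g))"
  unfolding correlates_update[OF F(1) \<delta>]
proof (rule LIMSEQ_I)
  fix e :: real assume "e > 0"
  define R where "R = (\<lambda>n x. \<Prod>\<gamma>\<in>F - {\<delta>}. f \<gamma> ((\<gamma> ^^ n) x))"
  define P where "P = (\<Prod>\<gamma>\<in>F - {\<delta>}. \<integral>x. f \<gamma> x \<partial>m)"
  have "\<forall>\<gamma>\<in>F. \<exists>K. \<forall>x. cmod (f \<gamma> x) \<le> K" using f by (auto simp: bdd_meas_def)
  then obtain K where K: "\<And>\<gamma> x. \<gamma> \<in> F \<Longrightarrow> cmod (f \<gamma> x) \<le> K \<gamma>" by metis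
  define C where "C = (\<Prod>\<gamma>\<in>F - {\<delta>}. K \<gamma>)"
  have R: "cmod (R n x) \<le> C" for n x
    unfolding R_def C_def prod_norm[symmetric] using K by (intro prod_mono) auto
  have "C \<ge> 0" using R[of 0 0] norm_ge_zero order_trans by blast
  \<comment> \<open>The errors are at most C d on the integrals and d |P| on the limits; the summand
    1 keeps the denominator positive.\<close>
  define D where "D = C + cmod P + 1"
  define d where "d = e / (2 * D)"
  have pos: "D > 0" using \<open>C \<ge> 0\<close> by (simp add: D_def add_nonneg_pos)
  then have "d > 0" using \<open>e > 0\<close> by (simp add: d_def)
  then obtain h where h: "bdd_meas h" "correlates F (f(\<delta> := h))" "(\<integral>x. cmod (g x - h x) \<partial>m) < d"
    using approx by blast
  have gh: "integrable m (\<lambda>x. cmod (g x - h x))"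
    by (intro integrable_norm Bochner_Integration.integrable_diff bdd_meas_integrable g h(1))
  have gh_meas: "(\<lambda>x. cmod (g x - h x)) \<in> borel_measurable m" by (rule borel_measurable_integrable[OF gh])
  have e2: "e / 2 > 0" using \<open>e > 0\<close> by simp
  obtain N where N: "\<And>n. n \<ge> N \<Longrightarrow> cmod ((\<integral>x. h ((\<delta> ^^ n) x) * R n x \<partial>m) - (\<integral>x. h x \<partial>m) * P) < e / 2"
    using LIMSEQ_D[OF h(2)[unfolded correlates_update[OF F(1) \<delta>]] e2] unfolding R_def P_def by blast
  have "norm ((\<integral>x. g ((\<delta> ^^ n) x) * R n x \<partial>m) - (\<integral>x. g x \<partial>m) * P) < e" if "n \<ge> N" for n
  proof -
    have epi: "epimorphism (\<delta> ^^ n)" using F(2)[OF \<delta>] by (rule epimorphism_funpow)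
    have comp: "(\<integral>x. cmod (g ((\<delta> ^^ n) x) - h ((\<delta> ^^ n) x)) \<partial>m) = (\<integral>x. cmod (g x - h x) \<partial>m)"
      by (rule integral_comp_epimorphism[OF gh_meas epi])
    have int_comp: "integrable m (\<lambda>x. cmod (g ((\<delta> ^^ n) x) - h ((\<delta> ^^ n) x)))"
      by (rule integrable_norm[OF Bochner_Integration.integrable_diff[OF
          bdd_meas_integrable[OF bdd_meas_comp[OF g epi]] bdd_meas_integrable[OF bdd_meas_comp[OF h(1) epi]]]])
    have "cmod ((\<integral>x. g ((\<delta> ^^ n) x) * R n x \<partial>m) - (\<integral>x. h ((\<delta> ^^ n) x) * R n x \<partial>m))
        = cmod (\<integral>x. g ((\<delta> ^^ n) x) * R n x - h ((\<delta> ^^ n) x) * R n x \<partial>m)"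
      unfolding R_def Bochner_Integration.integral_diff[OF integrable_update[OF g] integrable_update[OF h(1)]] ..
    also have "\<dots> \<le> (\<integral>x. cmod (g ((\<delta> ^^ n) x) * R n x - h ((\<delta> ^^ n) x) * R n x) \<partial>m)"
      by (rule integral_norm_bound)
    also have "\<dots> \<le> (\<integral>x. C * cmod (g ((\<delta> ^^ n) x) - h ((\<delta> ^^ n) x)) \<partial>m)"
    proof (rule integral_mono)
      show "integrable m (\<lambda>x. cmod (g ((\<delta> ^^ n) x) * R n x - h ((\<delta> ^^ n) x) * R n x))"
        unfolding R_def
        by (intro integrable_norm Bochner_Integration.integrable_diff integrable_update g h(1))
      show "integrable m (\<lambda>x. C * cmod (g ((\<delta> ^^ n) x) - h ((\<delta> ^^ n) x)))"
        using int_comp by simp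
      show "cmod (g ((\<delta> ^^ n) x) * R n x - h ((\<delta> ^^ n) x) * R n x) \<le> C * cmod (g ((\<delta> ^^ n) x) - h ((\<delta> ^^ n) x))" for x
        unfolding left_diff_distrib[symmetric] norm_mult using R[of n x]
        by (subst mult.commute) (rule mult_right_mono, auto)
    qed
    also have "\<dots> = C * (\<integral>x. cmod (g x - h x) \<partial>m)" by (simp add: comp)
    also have "\<dots> \<le> C * d" using h(3) \<open>C \<ge> 0\<close> by (intro mult_left_mono) auto
    finally have 1: "cmod ((\<integral>x. g ((\<delta> ^^ n) x) * R n x \<partial>m) - (\<integral>x. h ((\<delta> ^^ n) x) * R n x \<partial>m)) \<le> C * d" .
    have "cmod ((\<integral>x. h x \<partial>m) - (\<integral>x. g x \<partial>m)) = cmod (\<integral>x. g x - h x \<partial>m)"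
      using bdd_meas_integrable[OF g] bdd_meas_integrable[OF h(1)] by (simp add: norm_minus_commute)
    also have "\<dots> \<le> (\<integral>x. cmod (g x - h x) \<partial>m)" by (rule integral_norm_bound)
    finally have "cmod ((\<integral>x. h x \<partial>m) - (\<integral>x. g x \<partial>m)) \<le> d" using h(3) by simp
    then have 2: "cmod ((\<integral>x. h x \<partial>m) * P - (\<integral>x. g x \<partial>m) * P) \<le> d * cmod P"
      unfolding left_diff_distrib[symmetric] norm_mult by (rule mult_right_mono) simp
    have "C * d + e / 2 + d * cmod P < e"
    proof -
      have "D * d = e / 2" using pos by (simp add: d_def)
      then show ?thesis using \<open>d > 0\<close> by (simp add: D_def algebra_simps)
    qed
    moreover have "norm (a - b) \<le> norm (a - a') + norm (a' - b') + norm (b' - b)" for a b a' b' :: complex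
    proof -
      have "a - b = (a - a') + (a' - b') + (b' - b)" by simp
      then show ?thesis by (metis norm_triangle_mono norm_triangle_ineq order_refl)
    qed
    ultimately show ?thesis
      using 1 2 N[OF that] by (smt (verit, best))
  qed
  then show "\<exists>N. \<forall>n\<ge>N. norm ((\<integral>x. g ((\<delta> ^^ n) x) * (\<Prod>\<gamma>\<in>F - {\<delta>}. f \<gamma> ((\<gamma> ^^ n) x)) \<partial>m)
      - (\<integral>x. g x \<partial>m) * (\<Prod>\<gamma>\<in>F - {\<delta>}. \<integral>x. f \<gamma> x \<partial>m)) < e"
    unfolding R_def P_def by blast
qed

end

lemma character_prod_funpow:
  assumes "\<And>\<gamma>. \<gamma> \<in> F \<Longrightarrow> epimorphism \<gamma>" "\<And>\<gamma>. \<gamma> \<in> F \<Longrightarrow> \<chi> \<gamma> \<in> characters"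
  shows "(\<lambda>x. \<Prod>\<gamma>\<in>F. \<chi> \<gamma> ((\<gamma> ^^ n) x)) \<in> characters"
proof (rule characters_prod)
  fix \<gamma> assume "\<gamma> \<in> F"
  then show "(\<lambda>x. \<chi> \<gamma> ((\<gamma> ^^ n) x)) \<in> characters"
    using character_comp_epimorphism(1)[OF epimorphism_funpow[OF assms(1)] assms(2), of \<gamma> \<gamma> n]
    by (simp add: o_def)
qed

text \<open>At a time outside \<open>resonances F \<chi>\<close> the product is a nontrivial
  character and integrates to 0. For a nontrivial family the correlations are thus eventually 0, and
  so is the product of the integrals, one factor being nontrivial.\<close>

lemma correlates_characters:
  assumes "finite F" "\<And>\<gamma>. \<gamma> \<in> F \<Longrightarrow> epimorphism \<gamma>" "\<And>\<gamma>. \<gamma> \<in> F \<Longrightarrow> \<chi> \<gamma> \<in> characters"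
    and fin: "(\<exists>\<gamma>\<in>F. \<chi> \<gamma> \<noteq> (\<lambda>_. 1)) \<Longrightarrow> finite (resonances F \<chi>)"
  shows "correlates F \<chi>"
proof (cases "\<exists>\<gamma>\<in>F. \<chi> \<gamma> \<noteq> (\<lambda>_. 1)")
  case False
  then have "\<chi> \<gamma> = (\<lambda>_. 1)" if "\<gamma> \<in> F" for \<gamma> using that by blast
  then show ?thesis by (simp add: correlates_def)
next
  case True
  define Z where "Z = resonances F \<chi>"
  obtain N where N: "\<And>n. n \<in> Z \<Longrightarrow> n \<le> N"
    using fin[OF True] unfolding Z_def[symmetric] finite_nat_set_iff_bounded_le by blast
  obtain \<delta> where \<delta>: "\<delta> \<in> F" "\<chi> \<delta> \<noteq> (\<lambda>_. 1)" using True by blast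
  then have "(\<integral>x. \<chi> \<delta> x \<partial>m) = 0" using integral_character[OF assms(3)[OF \<delta>(1)]] by simp
  then have zero: "(\<Prod>\<gamma>\<in>F. \<integral>x. \<chi> \<gamma> x \<partial>m) = 0" using \<delta>(1) assms(1) by (intro prod_zero) auto
  have "(\<integral>x. (\<Prod>\<gamma>\<in>F. \<chi> \<gamma> ((\<gamma> ^^ n) x)) \<partial>m) = 0" if "n > N" for n
  proof -
    have "n \<notin> Z" using N that by force
    then have "(\<lambda>x. \<Prod>\<gamma>\<in>F. \<chi> \<gamma> ((\<gamma> ^^ n) x)) \<noteq> (\<lambda>_. 1)" unfolding Z_def by (auto dest: fun_cong)
    then show ?thesis
      using integral_character[OF character_prod_funpow[of F \<chi> n, OF assms(2,3)]] by simp
  qed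
  then show ?thesis
    unfolding correlates_def zero
    by (intro tendsto_eventually eventually_sequentiallyI[of "Suc N"]) auto
qed

text \<open>The characters are replaced by indicator functions one position at a time.\<close>

lemma correlates_indicators:
  assumes F: "finite F" "\<And>\<gamma>. \<gamma> \<in> F \<Longrightarrow> epimorphism \<gamma>"
    and fin: "\<And>\<chi>. (\<And>\<gamma>. \<gamma> \<in> F \<Longrightarrow> \<chi> \<gamma> \<in> characters) \<Longrightarrow> \<exists>\<gamma>\<in>F. \<chi> \<gamma> \<noteq> (\<lambda>_. 1) \<Longrightarrow>
      finite (resonances F \<chi>)"
    and "finite G" "G \<subseteq> F" "\<And>\<gamma>. \<gamma> \<in> G \<Longrightarrow> \<exists>B\<in>sets borel. f \<gamma> = indicator B"
    "\<And>\<gamma>. \<gamma> \<in> F - G \<Longrightarrow> f \<gamma> \<in> characters"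
  shows "correlates F f"
  using assms(4-7)
proof (induction G arbitrary: f rule: finite_induct)
  case empty
  then show ?case using F fin by (intro correlates_characters) auto
next
  case (insert \<delta> G)
  have \<delta>: "\<delta> \<in> F" using insert by simp
  obtain B where B: "B \<in> sets borel" "f \<delta> = indicator B" using insert by blast
  have f: "bdd_meas (f \<gamma>)" if "\<gamma> \<in> F" for \<gamma>
  proof (cases "\<gamma> \<in> insert \<delta> G")
    case True
    then obtain A where "A \<in> sets borel" "f \<gamma> = indicator A" using insert.prems(2) by blast
    then show ?thesis by (simp add: bdd_meas_indicator)
  next
    case False
    then show ?thesis using insert.prems(3) that by (intro bdd_meas_continuous characters_cont) auto
  qed
  \<comment> \<open>With a character back in slot \<delta> the indicators are confined to G and the
    hypothesis applies; linearity and L1 approximation then bring in the indicator of B.\<close>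
  have chars: "correlates F (f(\<delta> := \<chi>))" if "\<chi> \<in> characters" for \<chi>
  proof (rule insert.IH)
    show "G \<subseteq> F" using insert.prems by simp
    show "\<exists>B\<in>sets borel. (f(\<delta> := \<chi>)) \<gamma> = indicator B" if "\<gamma> \<in> G" for \<gamma>
      using insert.prems(2)[of \<gamma>] insert.hyps(2) that by auto
    show "(f(\<delta> := \<chi>)) \<gamma> \<in> characters" if "\<gamma> \<in> F - G" for \<gamma>
      using insert.prems(3)[of \<gamma>] that \<open>\<chi> \<in> characters\<close> by auto
  qed
  have "correlates F (f(\<delta> := indicator B))"
  proof (rule correlates_L1_limit[OF F \<delta> f bdd_meas_indicator[OF B(1)]])
    fix e :: real assume "e > 0"
    then obtain g where g: "trig_poly g" "(\<integral>x. cmod (indicator B x - g x) \<partial>m) < e"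
      using trig_poly_L1_dense[OF B(1)] by blast
    then show "\<exists>h. bdd_meas h \<and> correlates F (f(\<delta> := h)) \<and> (\<integral>x. cmod (indicator B x - h x) \<partial>m) < e"
      using correlates_trig[OF F \<delta> f chars g(1)] bdd_meas_continuous[OF continuous_on_trig_poly[OF g(1)]] by blast
  qed
  then show ?case using B(2) by (metis fun_upd_triv)
qed

section \<open>Mixing on the completed \<sigma>-algebra\<close>

lemma vimage_epimorphism_sets:
  "epimorphism T \<Longrightarrow> B \<in> sets m \<Longrightarrow> T -` B \<in> sets m"
  using measurable_sets[OF measurable_epimorphism, of T B] by simp

lemma vimage_epimorphism_null:
  assumes "epimorphism T" "N \<in> null_sets m"
  shows "T -` N \<in> null_sets m"
proof -
  have N: "N \<in> sets m" "emeasure m N = 0" using assms(2) by (auto simp: null_sets_def)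
  have "emeasure m (T -` N) = emeasure (distr m m T) N"
    using emeasure_distr[OF measurable_epimorphism[OF assms(1)] N(1)] by simp
  then have "emeasure m (T -` N) = 0" using N(2) by (simp add: distr_epimorphism[OF assms(1)])
  then show ?thesis using vimage_epimorphism_sets[OF assms(1) N(1)] by (simp add: null_sets_def)
qed

lemma measure_completion_sandwich:
  assumes "S \<in> sets m" "N \<in> null_sets m" "S \<subseteq> A" "A \<subseteq> S \<union> N"
  shows "measure (completion m) A = measure m S"
proof -
  have N: "N \<in> sets m" "emeasure m N = 0" using assms(2) by (auto simp: null_sets_def)
  have A: "A \<in> sets (completion m)"
    by (rule sets_completionI[of A S "A - S" N]) (use assms in auto)
  have "emeasure m S = emeasure (completion m) S" using assms(1) by simp
  also have "\<dots> \<le> emeasure (completion m) A" using A assms(3) by (intro emeasure_mono)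
  finally have 1: "emeasure m S \<le> emeasure (completion m) A" .
  have "emeasure (completion m) A \<le> emeasure (completion m) (S \<union> N)"
    using assms(1,4) N(1) by (intro emeasure_mono) auto
  also have "\<dots> = emeasure m (S \<union> N)" using assms(1) N(1) by (simp del: sets_m)
  also have "\<dots> = emeasure m S" by (rule emeasure_Un_null_set[OF assms(1,2)])
  finally show ?thesis using 1 by (simp add: measure_def antisym)
qed

text \<open>A set of the completion is a Borel set S up to a null set. Epimorphisms pull null sets
  back to null sets, so B may be replaced by S at every time n, and mixing becomes
  \<open>correlates\<close> for indicators.\<close>

lemma mixing_if_characters:
  assumes F: "finite F" "\<And>\<gamma>. \<gamma> \<in> F \<Longrightarrow> epimorphism \<gamma>"
    and fin: "\<And>\<chi>. (\<And>\<gamma>. \<gamma> \<in> F \<Longrightarrow> \<chi> \<gamma> \<in> characters) \<Longrightarrow> \<exists>\<gamma>\<in>F. \<chi> \<gamma> \<noteq> (\<lambda>_. 1) \<Longrightarrow>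
      finite (resonances F \<chi>)"
  shows "mixing m F"
  unfolding mixing_def
proof (intro conjI allI impI)
  show "finite F" by fact
  fix B assume "\<forall>\<gamma>\<in>F. B \<gamma> \<in> sets (completion m)"
  then have "\<forall>\<gamma>\<in>F. \<exists>S N. S \<in> sets m \<and> N \<in> null_sets m \<and> S \<subseteq> B \<gamma> \<and> B \<gamma> \<subseteq> S \<union> N"
  proof (intro ballI)
    fix \<gamma> assume B: "\<forall>\<gamma>\<in>F. B \<gamma> \<in> sets (completion m)" and "\<gamma> \<in> F"
    then have "B \<gamma> \<in> sets (completion m)" by blast
    then obtain S N N' where "B \<gamma> = S \<union> N" "N \<subseteq> N'" "N' \<in> null_sets m" "S \<in> sets m"
      by (rule sets_completionE)
    then show "\<exists>S N. S \<in> sets m \<and> N \<in> null_sets m \<and> S \<subseteq> B \<gamma> \<and> B \<gamma> \<subseteq> S \<union> N" by blast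
  qed
  then obtain S N where SN: "\<And>\<gamma>. \<gamma> \<in> F \<Longrightarrow> S \<gamma> \<in> sets m" "\<And>\<gamma>. \<gamma> \<in> F \<Longrightarrow> N \<gamma> \<in> null_sets m"
    "\<And>\<gamma>. \<gamma> \<in> F \<Longrightarrow> S \<gamma> \<subseteq> B \<gamma>" "\<And>\<gamma>. \<gamma> \<in> F \<Longrightarrow> B \<gamma> \<subseteq> S \<gamma> \<union> N \<gamma>"
    by metis
  have S_sets: "(\<Inter>\<gamma>\<in>F. (\<gamma> ^^ n) -` S \<gamma>) \<in> sets m" for n
  proof (cases "F = {}")
    case False
    then show ?thesis
      by (intro sets.finite_INT vimage_epimorphism_sets epimorphism_funpow F SN(1))
  qed simp
  have S_eq: "measure (completion m) (\<Inter>\<gamma>\<in>F. (\<gamma> ^^ n) -` B \<gamma>) = measure m (\<Inter>\<gamma>\<in>F. (\<gamma> ^^ n) -` S \<gamma>)" for n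
  proof (rule measure_completion_sandwich[OF S_sets, of "\<Union>\<gamma>\<in>F. (\<gamma> ^^ n) -` N \<gamma>"])
    show "(\<Union>\<gamma>\<in>F. (\<gamma> ^^ n) -` N \<gamma>) \<in> null_sets m"
      by (intro null_sets_UN' countable_finite vimage_epimorphism_null epimorphism_funpow F SN(2))
    show "(\<Inter>\<gamma>\<in>F. (\<gamma> ^^ n) -` S \<gamma>) \<subseteq> (\<Inter>\<gamma>\<in>F. (\<gamma> ^^ n) -` B \<gamma>)" 
      by (rule INF_superset_mono[OF order_refl vimage_mono[OF SN(3)]])
    show "(\<Inter>\<gamma>\<in>F. (\<gamma> ^^ n) -` B \<gamma>) \<subseteq> (\<Inter>\<gamma>\<in>F. (\<gamma> ^^ n) -` S \<gamma>) \<union> (\<Union>\<gamma>\<in>F. (\<gamma> ^^ n) -` N \<gamma>)"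
    proof
      fix x assume x: "x \<in> (\<Inter>\<gamma>\<in>F. (\<gamma> ^^ n) -` B \<gamma>)"
      have "(\<gamma> ^^ n) x \<in> S \<gamma> \<or> (\<gamma> ^^ n) x \<in> N \<gamma>" if "\<gamma> \<in> F" for \<gamma>
        using x SN(4)[OF that] that by auto
      then show "x \<in> (\<Inter>\<gamma>\<in>F. (\<gamma> ^^ n) -` S \<gamma>) \<union> (\<Union>\<gamma>\<in>F. (\<gamma> ^^ n) -` N \<gamma>)"
        by (simp only: Un_iff INT_iff UN_iff vimage_eq) metis
    qed
  qed
  have B_eq: "measure (completion m) (B \<gamma>) = measure m (S \<gamma>)" if "\<gamma> \<in> F" for \<gamma>
    using measure_completion_sandwich[OF SN(1-4)[OF that]] .
  have "correlates F (\<lambda>\<gamma>. indicator (S \<gamma>))"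
    using SN(1) by (intro correlates_indicators[OF F fin, of F]) (auto simp: F)
  moreover have "(\<integral>x. (\<Prod>\<gamma>\<in>F. indicator (S \<gamma>) ((\<gamma> ^^ n) x)) \<partial>m) = complex_of_real (measure m (\<Inter>\<gamma>\<in>F. (\<gamma> ^^ n) -` S \<gamma>))" for n
  proof -
    have "(\<Prod>\<gamma>\<in>F. indicator (S \<gamma>) ((\<gamma> ^^ n) x)) = complex_of_real (indicator (\<Inter>\<gamma>\<in>F. (\<gamma> ^^ n) -` S \<gamma>) x)" for x
      unfolding prod_indicator[OF F(1)] by (simp add: indicator_def)
    then show ?thesis using S_sets[of n] by simp
  qed
  moreover have "(\<integral>x. indicator (S \<gamma>) x \<partial>m) = complex_of_real (measure m (S \<gamma>))" if "\<gamma> \<in> F" for \<gamma>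
  proof -
    have "indicator (S \<gamma>) x = complex_of_real (indicator (S \<gamma>) x)" for x by (simp add: indicator_def)
    then show ?thesis using SN(1)[OF that] by simp
  qed
  ultimately have "(\<lambda>n. complex_of_real (measure m (\<Inter>\<gamma>\<in>F. (\<gamma> ^^ n) -` S \<gamma>)))
      \<longlonglongrightarrow> of_real (\<Prod>\<gamma>\<in>F. measure m (S \<gamma>))"
    unfolding correlates_def by simp
  then have "(\<lambda>n. measure m (\<Inter>\<gamma>\<in>F. (\<gamma> ^^ n) -` S \<gamma>)) \<longlonglongrightarrow> (\<Prod>\<gamma>\<in>F. measure m (S \<gamma>))"
    by (simp only: tendsto_of_real_iff)
  then show "(\<lambda>n. measure (completion m) (\<Inter>\<gamma>\<in>F. (\<gamma> ^^ n) -` B \<gamma>))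
      \<longlonglongrightarrow> (\<Prod>\<gamma>\<in>F. measure (completion m) (B \<gamma>))"
    by (simp add: S_eq B_eq)
qed

text \<open>Small neighbourhoods of points \<open>z \<gamma>\<close> of the circle with \<open>\<Prod>z \<noteq> 1\<close> have preimages that never
  meet at a time \<open>n\<close> at which the product of the characters is trivial.\<close>

lemma characters_if_mixing:
  assumes mix: "mixing m F" and epi: "\<And>\<gamma>. \<gamma> \<in> F \<Longrightarrow> epimorphism \<gamma>"
    and \<chi>: "\<And>\<gamma>. \<gamma> \<in> F \<Longrightarrow> \<chi> \<gamma> \<in> characters" "\<exists>\<gamma>\<in>F. \<chi> \<gamma> \<noteq> (\<lambda>_. 1)"
  shows "finite (resonances F \<chi>)"
proof -
  have "finite F" using mix by (simp add: mixing_def)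
  obtain \<delta> where "\<delta> \<in> F" "\<chi> \<delta> \<noteq> (\<lambda>_. 1)" using \<chi>(2) by blast
  then obtain x0 where \<delta>: "\<delta> \<in> F" "\<chi> \<delta> x0 \<noteq> 1" by (meson ext)
  \<comment> \<open>With x0 in slot \<delta> and 0 in the others the product of the
    \<open>z \<gamma>\<close> is \<open>\<chi> \<delta> x0\<close>, which is not 1.\<close>
  define w where "w = (\<lambda>\<gamma>. if \<gamma> = \<delta> then x0 else 0)"
  define z where "z = (\<lambda>\<gamma>. \<chi> \<gamma> (w \<gamma>))"
  have prod_z: "(\<Prod>\<gamma>\<in>F. z \<gamma>) = \<chi> \<delta> x0"
  proof -
    have "(\<Prod>\<gamma>\<in>F - {\<delta>}. z \<gamma>) = 1"
      using \<chi>(1) by (intro prod.neutral) (auto simp: z_def w_def characters_zero)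
    then show ?thesis by (simp add: prod.remove[OF \<open>finite F\<close> \<delta>(1)] z_def w_def)
  qed
  have "card F > 0" using \<open>finite F\<close> \<delta>(1) by (auto simp: card_gt_0_iff)
  \<comment> \<open>Moving each of card F unimodular factors by less than e moves their product by
    less than card F times e, the distance of the product of the \<open>z \<gamma>\<close> from
    1.\<close>
  define e where "e = cmod (\<chi> \<delta> x0 - 1) / real (card F)"
  have "e > 0" using \<delta>(2) \<open>card F > 0\<close> by (simp add: e_def)
  define B where "B = (\<lambda>\<gamma>. {x. cmod (\<chi> \<gamma> x - z \<gamma>) < e})"
  have B_open: "open (B \<gamma>)" if "\<gamma> \<in> F" for \<gamma>
  proof -
    have "continuous_on UNIV (\<lambda>x. cmod (\<chi> \<gamma> x - z \<gamma>))"
      by (intro continuous_on_norm continuous_on_diff continuous_on_const characters_cont \<chi>(1) that)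
    then show ?thesis using open_vimage[OF open_lessThan[of e]] by (simp add: B_def vimage_def)
  qed
  have B_pos: "measure m (B \<gamma>) > 0" if "\<gamma> \<in> F" for \<gamma>
    using emeasure_open_pos[OF B_open[OF that], of "w \<gamma>"] \<open>e > 0\<close>
    by (simp add: B_def z_def emeasure_eq_measure)
  have "(\<lambda>n. measure (completion m) (\<Inter>\<gamma>\<in>F. (\<gamma> ^^ n) -` B \<gamma>))
      \<longlonglongrightarrow> (\<Prod>\<gamma>\<in>F. measure (completion m) (B \<gamma>))"
  proof -
    have "\<forall>\<gamma>\<in>F. B \<gamma> \<in> sets (completion m)" using B_open by simp
    then show ?thesis using mix unfolding mixing_def by blast
  qed
  moreover have "(\<Prod>\<gamma>\<in>F. measure (completion m) (B \<gamma>)) > 0"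
    using B_pos B_open by (intro prod_pos) simp
  ultimately have "\<forall>\<^sub>F n in sequentially. measure (completion m) (\<Inter>\<gamma>\<in>F. (\<gamma> ^^ n) -` B \<gamma>) > 0"
    by (rule order_tendstoD(1))
  then obtain N where N: "\<And>n. n \<ge> N \<Longrightarrow> measure (completion m) (\<Inter>\<gamma>\<in>F. (\<gamma> ^^ n) -` B \<gamma>) > 0"
    unfolding eventually_sequentially by blast
  have "n < N" if n: "\<forall>x. (\<Prod>\<gamma>\<in>F. \<chi> \<gamma> ((\<gamma> ^^ n) x)) = 1" for n
  proof (rule ccontr)
    assume "\<not> n < N"
    then have "measure (completion m) (\<Inter>\<gamma>\<in>F. (\<gamma> ^^ n) -` B \<gamma>) > 0" using N by simp
    then have "(\<Inter>\<gamma>\<in>F. (\<gamma> ^^ n) -` B \<gamma>) \<noteq> {}" by (metis less_irrefl measure_empty)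
    then obtain x where x: "\<And>\<gamma>. \<gamma> \<in> F \<Longrightarrow> cmod (\<chi> \<gamma> ((\<gamma> ^^ n) x) - z \<gamma>) < e"
      by (auto simp: B_def)
    have "cmod (\<chi> \<delta> x0 - 1) = cmod ((\<Prod>\<gamma>\<in>F. \<chi> \<gamma> ((\<gamma> ^^ n) x)) - (\<Prod>\<gamma>\<in>F. z \<gamma>))"
      using n by (simp add: prod_z norm_minus_commute)
    also have "\<dots> \<le> (\<Sum>\<gamma>\<in>F. cmod (\<chi> \<gamma> ((\<gamma> ^^ n) x) - z \<gamma>))"
      using \<chi>(1) by (intro norm_prod_diff) (auto simp: z_def characters_norm)
    also have "\<dots> < (\<Sum>\<gamma>\<in>F. e)"
      using x \<open>finite F\<close> \<delta>(1) by (intro sum_strict_mono) auto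
    also have "\<dots> = cmod (\<chi> \<delta> x0 - 1)" using \<open>card F > 0\<close> by (simp add: e_def)
    finally show False by simp
  qed
  then have "resonances F \<chi> \<subseteq> {..<N}" by auto
  then show ?thesis using finite_subset by blast
qed

text \<open>The maps outside G are given the whole space as their set.\<close>

lemma mixing_subset:
  assumes "mixing m F" "G \<subseteq> F"
  shows "mixing m G"
  unfolding mixing_def
proof (intro conjI allI impI)
  have F: "finite F" using assms(1) by (simp add: mixing_def)
  show "finite G" using F assms(2) finite_subset by blast
  fix B assume B: "\<forall>\<gamma>\<in>G. B \<gamma> \<in> sets (completion m)"
  define C where "C = (\<lambda>\<gamma>. if \<gamma> \<in> G then B \<gamma> else UNIV)"
  have "UNIV \<in> sets (completion m)" using sets.top[of "completion m"] by (simp del: sets.top)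
  then have "\<forall>\<gamma>\<in>F. C \<gamma> \<in> sets (completion m)" using B by (simp add: C_def)
  then have "(\<lambda>n. measure (completion m) (\<Inter>\<gamma>\<in>F. (\<gamma> ^^ n) -` C \<gamma>))
      \<longlonglongrightarrow> (\<Prod>\<gamma>\<in>F. measure (completion m) (C \<gamma>))"
    using assms(1) unfolding mixing_def by blast
  moreover have "(\<Inter>\<gamma>\<in>F. (\<gamma> ^^ n) -` C \<gamma>) = (\<Inter>\<gamma>\<in>G. (\<gamma> ^^ n) -` B \<gamma>)" for n
  proof -
    have "(\<forall>\<gamma>\<in>F. (\<gamma> ^^ n) x \<in> C \<gamma>) \<longleftrightarrow> (\<forall>\<gamma>\<in>G. (\<gamma> ^^ n) x \<in> B \<gamma>)" for x
      using assms(2) by (auto simp: C_def)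
    then show ?thesis by auto
  qed
  moreover have "(\<Prod>\<gamma>\<in>F. measure (completion m) (C \<gamma>)) = (\<Prod>\<gamma>\<in>G. measure (completion m) (B \<gamma>))"
  proof -
    have "measure (completion m) UNIV = 1" using measure_completion[of UNIV m] by simp
    then have "(\<Prod>\<gamma>\<in>G. measure (completion m) (C \<gamma>)) = (\<Prod>\<gamma>\<in>F. measure (completion m) (C \<gamma>))"
      by (intro prod.mono_neutral_left F assms(2)) (auto simp: C_def)
    then show ?thesis by (simp add: C_def)
  qed
  ultimately show "(\<lambda>n. measure (completion m) (\<Inter>\<gamma>\<in>G. (\<gamma> ^^ n) -` B \<gamma>))
      \<longlonglongrightarrow> (\<Prod>\<gamma>\<in>G. measure (completion m) (B \<gamma>))" by simp
qed

end

section \<open>The dual action\<close>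

locale dual_setting = compact_haar m
  for m :: "'a::{topological_ab_group_add, t2_space} measure" +
  fixes d :: nat and \<iota> :: "('a \<Rightarrow> complex) \<Rightarrow> rat vec"
  assumes dual: "dual_identification d \<iota>"
begin

lemma iota_carrier: "\<phi> \<in> characters \<Longrightarrow> \<iota> \<phi> \<in> carrier_vec d"
  using dual unfolding dual_identification_def by blast

lemma iota_inj: "\<phi> \<in> characters \<Longrightarrow> \<psi> \<in> characters \<Longrightarrow> \<iota> \<phi> = \<iota> \<psi> \<Longrightarrow> \<phi> = \<psi>"
  using dual unfolding dual_identification_def by (meson inj_onD)

lemma iota_mult: "\<phi> \<in> characters \<Longrightarrow> \<psi> \<in> characters \<Longrightarrow> \<iota> (\<lambda>x. \<phi> x * \<psi> x) = \<iota> \<phi> + \<iota> \<psi>"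
  using dual unfolding dual_identification_def by blast

lemma iota_surj_int: "v \<in> carrier_vec d \<Longrightarrow> \<forall>i<d. v $ i \<in> \<int> \<Longrightarrow> \<exists>\<phi>\<in>characters. \<iota> \<phi> = v"
  using dual unfolding dual_identification_def by blast

lemma iota_surj_unit: "\<exists>\<phi>\<in>characters. \<iota> \<phi> = unit_vec d j"
  by (rule iota_surj_int) (auto simp: unit_vec_def)

text \<open>Only integral vectors are known to be values of \<open>\<iota>\<close>. The denominator
  is common to all i because a linear relation between orbits survives multiplication by a common
  factor only.\<close>

lemma iota_surj_multiple:
  assumes "finite S" "\<And>i. i \<in> S \<Longrightarrow> v i \<in> carrier_vec d"
  shows "\<exists>N>0. \<forall>i\<in>S. \<exists>\<phi>\<in>characters. \<iota> \<phi> = of_int N \<cdot>\<^sub>v v i"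
proof -
  have fin: "finite ((\<lambda>(i, j). v i $ j) ` (S \<times> {..<d}))"
    by (rule finite_imageI[OF finite_cartesian_product[OF assms(1) finite_lessThan]])
  obtain N where N: "N > 0" "\<And>x. x \<in> (\<lambda>(i, j). v i $ j) ` (S \<times> {..<d}) \<Longrightarrow> of_int N * x \<in> \<int>"
    using common_denominator[OF fin] by blast
  have "\<exists>\<phi>\<in>characters. \<iota> \<phi> = of_int N \<cdot>\<^sub>v v i" if i: "i \<in> S" for i
  proof (rule iota_surj_int)
    show "of_int N \<cdot>\<^sub>v v i \<in> carrier_vec d" using assms(2)[OF i] by simp
    show "\<forall>j<d. (of_int N \<cdot>\<^sub>v v i) $ j \<in> \<int>"
    proof (intro allI impI)
      fix j assume "j < d"
      then have "(\<lambda>(i, j). v i $ j) (i, j) \<in> (\<lambda>(i, j). v i $ j) ` (S \<times> {..<d})" using i by blast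
      then show "(of_int N \<cdot>\<^sub>v v i) $ j \<in> \<int>" using N(2) assms(2)[OF i] \<open>j < d\<close> by simp
    qed
  qed
  then show ?thesis using N(1) by blast
qed

lemma iota_mult_index:
  assumes "\<phi> \<in> characters" "\<psi> \<in> characters" "j < d"
  shows "\<iota> (\<lambda>x. \<phi> x * \<psi> x) $ j = \<iota> \<phi> $ j + \<iota> \<psi> $ j"
  using iota_mult[OF assms(1,2)] iota_carrier[OF assms(2)] assms(3) by simp

lemma iota_one_index: "j < d \<Longrightarrow> \<iota> (\<lambda>_. 1) $ j = 0"
  using iota_mult_index[OF characters_one characters_one, of j] by simp

lemma iota_one: "\<iota> (\<lambda>_. 1) = 0\<^sub>v d"
  using iota_carrier[OF characters_one] iota_one_index by (intro eq_vecI) auto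

lemma iota_eq_zero_iff:
  assumes "\<phi> \<in> characters"
  shows "\<iota> \<phi> = 0\<^sub>v d \<longleftrightarrow> \<phi> = (\<lambda>_. 1)"
proof
  assume "\<iota> \<phi> = 0\<^sub>v d"
  then have "\<iota> \<phi> = \<iota> (\<lambda>_. 1)" by (simp add: iota_one)
  then show "\<phi> = (\<lambda>_. 1)" by (rule iota_inj[OF assms characters_one])
qed (simp add: iota_one)

lemma iota_cnj_index:
  assumes "\<phi> \<in> characters" "j < d"
  shows "\<iota> (\<lambda>x. cnj (\<phi> x)) $ j = - \<iota> \<phi> $ j"
proof -
  have "\<phi> x * cnj (\<phi> x) = 1" for x
    using characters_norm[OF assms(1), of x] by (simp flip: complex_norm_square)
  then have "\<iota> (\<lambda>_. 1) $ j = \<iota> \<phi> $ j + \<iota> (\<lambda>x. cnj (\<phi> x)) $ j"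
    using iota_mult_index[OF assms(1) characters_cnj[OF assms(1)] assms(2)] by simp
  then show ?thesis using iota_one_index[OF assms(2)] by simp
qed

lemma iota_prod_index:
  assumes "finite I" "\<And>i. i \<in> I \<Longrightarrow> \<phi> i \<in> characters" "j < d"
  shows "\<iota> (\<lambda>x. \<Prod>i\<in>I. \<phi> i x) $ j = (\<Sum>i\<in>I. \<iota> (\<phi> i) $ j)"
  using assms(1,2)
proof (induction I rule: finite_induct)
  case empty
  then show ?case using iota_one_index[OF assms(3)] by simp
next
  case (insert i I)
  then show ?case
    using iota_mult_index[OF _ characters_prod[of I \<phi>] assms(3), of "\<phi> i"] by simp
qed

text \<open>Integer powers; \<open>cnj\<close> inverts a character.\<close>

definition zpow :: "('a \<Rightarrow> complex) \<Rightarrow> int \<Rightarrow> 'a \<Rightarrow> complex" where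
  "zpow \<phi> z = (\<lambda>x. \<Prod>_\<in>{..<nat \<bar>z\<bar>}. if z \<ge> 0 then \<phi> x else cnj (\<phi> x))"

lemma zpow_characters: "\<phi> \<in> characters \<Longrightarrow> zpow \<phi> z \<in> characters"
  unfolding zpow_def by (cases "z \<ge> 0") (auto intro!: characters_prod characters_cnj simp del: prod_constant)

lemma zpow_comp: "zpow \<phi> z \<circ> T = zpow (\<phi> \<circ> T) z"
  by (simp add: zpow_def o_def)

lemma iota_zpow_index:
  assumes "\<phi> \<in> characters" "j < d"
  shows "\<iota> (zpow \<phi> z) $ j = of_int z * \<iota> \<phi> $ j"
proof (cases "z \<ge> 0")
  case True
  have "\<iota> (\<lambda>x. \<Prod>_\<in>{..<nat \<bar>z\<bar>}. \<phi> x) $ j = (\<Sum>_\<in>{..<nat \<bar>z\<bar>}. \<iota> \<phi> $ j)"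
    by (rule iota_prod_index[OF finite_lessThan assms(1) assms(2)])
  then show ?thesis using True by (simp add: zpow_def)
next
  case False
  have "\<iota> (\<lambda>x. \<Prod>_\<in>{..<nat \<bar>z\<bar>}. cnj (\<phi> x)) $ j = (\<Sum>_\<in>{..<nat \<bar>z\<bar>}. \<iota> (\<lambda>x. cnj (\<phi> x)) $ j)"
    by (rule iota_prod_index[OF finite_lessThan characters_cnj[OF assms(1)] assms(2)])
  then show ?thesis using False iota_cnj_index[OF assms] by (simp add: zpow_def)
qed

section \<open>The matrix of the dual endomorphism\<close>

text \<open>The columns come from characters that correspond to the unit vectors. For a general
  \<phi> some multiple N of \<open>\<iota> \<phi>\<close> is integral, so \<phi>^N is a product of
  integer powers of these characters; composition with T respects products, and N can be divided
  out.\<close>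

lemma dual_matrix_exists:
  assumes T: "continuous_on UNIV T" "\<And>x y. T (x + y) = T x + T y"
  shows "\<exists>A. A \<in> carrier_mat d d \<and> (\<forall>\<phi>\<in>characters. \<iota> (\<phi> \<circ> T) = A *\<^sub>v \<iota> \<phi>)"
proof -
  obtain E where E: "\<And>j. E j \<in> characters" "\<And>j. \<iota> (E j) = unit_vec d j"
    using iota_surj_unit by metis
  define A where "A = mat d d (\<lambda>(i, j). \<iota> (E j \<circ> T) $ i)"
  have A: "A \<in> carrier_mat d d" by (simp add: A_def)
  have comp: "\<phi> \<circ> T \<in> characters" if "\<phi> \<in> characters" for \<phi> by (rule characters_comp[OF that T])
  have "\<iota> (\<phi> \<circ> T) = A *\<^sub>v \<iota> \<phi>" if \<phi>: "\<phi> \<in> characters" for \<phi>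
  proof (rule eq_vecI)
    let ?v = "\<iota> \<phi>"
    have v: "?v \<in> carrier_vec d" by (rule iota_carrier[OF \<phi>])
    show "dim_vec (\<iota> (\<phi> \<circ> T)) = dim_vec (A *\<^sub>v \<iota> \<phi>)"
      using iota_carrier[OF comp[OF \<phi>]] A by simp
    fix i assume "i < dim_vec (A *\<^sub>v \<iota> \<phi>)"
    then have i: "i < d" using A by simp
    have fin: "finite ((\<lambda>j. ?v $ j) ` {..<d})" by simp
    obtain N where N: "N > 0" "\<And>x. x \<in> (\<lambda>j. ?v $ j) ` {..<d} \<Longrightarrow> of_int N * x \<in> \<int>"
      using common_denominator[OF fin] by blast
    define z where "z = (\<lambda>j. \<lfloor>of_int N * ?v $ j\<rfloor>)"
    have z: "of_int (z j) = of_int N * ?v $ j" if "j < d" for j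
      using N(2)[of "?v $ j"] that by (auto simp: z_def elim: Ints_cases)
    have zE: "zpow (E j) (z j) \<in> characters" for j by (rule zpow_characters[OF E(1)])
    have eq: "zpow \<phi> N = (\<lambda>x. \<Prod>j<d. zpow (E j) (z j) x)"
    proof (rule iota_inj[OF zpow_characters[OF \<phi>] characters_prod[OF zE]], rule eq_vecI)
      have c: "\<iota> (\<lambda>x. \<Prod>j<d. zpow (E j) (z j) x) \<in> carrier_vec d" "\<iota> (zpow \<phi> N) \<in> carrier_vec d"
        by (intro iota_carrier characters_prod zE zpow_characters \<phi>)+
      then show "dim_vec (\<iota> (zpow \<phi> N)) = dim_vec (\<iota> (\<lambda>x. \<Prod>j<d. zpow (E j) (z j) x))" by simp
      fix k assume "k < dim_vec (\<iota> (\<lambda>x. \<Prod>j<d. zpow (E j) (z j) x))"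
      then have k: "k < d" using c by simp
      have "\<iota> (\<lambda>x. \<Prod>j<d. zpow (E j) (z j) x) $ k = (\<Sum>j<d. of_int (z j) * unit_vec d j $ k)"
        using iota_prod_index[OF finite_lessThan zE k] iota_zpow_index[OF E(1) k] by (simp add: E(2))
      also have "\<dots> = (\<Sum>j<d. if j = k then of_int (z j) else 0)"
        using k by (intro sum.cong) auto
      also have "\<dots> = of_int N * ?v $ k" using k z by simp
      finally show "\<iota> (zpow \<phi> N) $ k = \<iota> (\<lambda>x. \<Prod>j<d. zpow (E j) (z j) x) $ k"
        using iota_zpow_index[OF \<phi> k] by simp
    qed
    have "of_int N * \<iota> (\<phi> \<circ> T) $ i = \<iota> (zpow \<phi> N \<circ> T) $ i"
      by (simp add: zpow_comp iota_zpow_index[OF comp[OF \<phi>] i])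
    also have "zpow \<phi> N \<circ> T = (\<lambda>x. \<Prod>j<d. zpow (E j \<circ> T) (z j) x)"
      unfolding eq zpow_comp[symmetric] by (simp add: o_def)
    also have "\<iota> \<dots> $ i = (\<Sum>j<d. of_int (z j) * \<iota> (E j \<circ> T) $ i)"
      using iota_prod_index[OF finite_lessThan zpow_characters[OF comp[OF E(1)]] i]
        iota_zpow_index[OF comp[OF E(1)] i] by simp
    also have "\<dots> = of_int N * (\<Sum>j<d. A $$ (i, j) * ?v $ j)"
      unfolding sum_distrib_left using i by (intro sum.cong) (auto simp: z A_def)
    also have "(\<Sum>j<d. A $$ (i, j) * ?v $ j) = (A *\<^sub>v ?v) $ i"
      by (rule index_mult_mat_vec_sum[OF A v i, symmetric])
    finally show "\<iota> (\<phi> \<circ> T) $ i = (A *\<^sub>v \<iota> \<phi>) $ i" using N(1) by (simp add: o_def)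
  qed
  then show ?thesis using A by blast
qed

lemma dual_matrix_unique:
  assumes A: "A \<in> carrier_mat d d" "\<forall>\<phi>\<in>characters. F \<phi> = A *\<^sub>v \<iota> \<phi>"
    and B: "B \<in> carrier_mat d d" "\<forall>\<phi>\<in>characters. F \<phi> = B *\<^sub>v \<iota> \<phi>"
  shows "A = B"
proof (rule eq_matI)
  fix i j assume "i < dim_row B" "j < dim_col B"
  then have ij: "i < d" "j < d" using B by auto
  obtain \<phi> where \<phi>: "\<phi> \<in> characters" "\<iota> \<phi> = unit_vec d j"
    using iota_surj_unit by blast
  have entry: "(C *\<^sub>v unit_vec d j) $ i = C $$ (i, j)" if "C \<in> carrier_mat d d" for C :: "rat mat"
  proof -
    have "(C *\<^sub>v unit_vec d j) $ i = (\<Sum>k<d. if k = j then C $$ (i, k) else 0)"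
      unfolding index_mult_mat_vec_sum[OF that unit_vec_carrier ij(1)]
      using ij by (intro sum.cong) auto
    then show ?thesis using ij by simp
  qed
  have "A *\<^sub>v unit_vec d j = B *\<^sub>v unit_vec d j" using A(2) B(2) \<phi> by metis
  then show "A $$ (i, j) = B $$ (i, j)" using entry[OF A(1)] entry[OF B(1)] by metis
qed (use A B in auto)

lemma dual_matrix_eqI:
  assumes "A \<in> carrier_mat d d" "\<And>\<phi>. \<phi> \<in> characters \<Longrightarrow> \<iota> (\<phi> \<circ> T) = A *\<^sub>v \<iota> \<phi>"
  shows "dual_matrix d \<iota> T = A"
  unfolding dual_matrix_def
proof (rule the_equality)
  show "A \<in> carrier_mat d d \<and> (\<forall>\<phi>\<in>characters. \<iota> (\<phi> \<circ> T) = A *\<^sub>v \<iota> \<phi>)" using assms by blast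
  fix B assume "B \<in> carrier_mat d d \<and> (\<forall>\<phi>\<in>characters. \<iota> (\<phi> \<circ> T) = B *\<^sub>v \<iota> \<phi>)"
  then show "B = A" using dual_matrix_unique[of B "\<lambda>\<phi>. \<iota> (\<phi> \<circ> T)" A] assms by blast
qed

lemma dual_matrix:
  assumes "epimorphism T"
  shows "dual_matrix d \<iota> T \<in> carrier_mat d d"
    and "\<And>\<phi>. \<phi> \<in> characters \<Longrightarrow> \<iota> (\<phi> \<circ> T) = dual_matrix d \<iota> T *\<^sub>v \<iota> \<phi>"
proof -
  have T: "continuous_on UNIV T" "\<And>x y. T (x + y) = T x + T y"
    using assms by (simp_all add: epimorphism_def)
  obtain A where A: "A \<in> carrier_mat d d" "\<forall>\<phi>\<in>characters. \<iota> (\<phi> \<circ> T) = A *\<^sub>v \<iota> \<phi>"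
    using dual_matrix_exists[OF T] by blast
  have "dual_matrix d \<iota> T = A" by (rule dual_matrix_eqI) (use A in auto)
  then show "dual_matrix d \<iota> T \<in> carrier_mat d d"
    and "\<And>\<phi>. \<phi> \<in> characters \<Longrightarrow> \<iota> (\<phi> \<circ> T) = dual_matrix d \<iota> T *\<^sub>v \<iota> \<phi>"
    using A by auto
qed

lemma iota_comp_funpow:
  assumes T: "epimorphism T" and "\<phi> \<in> characters"
  shows "\<iota> (\<phi> \<circ> T ^^ n) = dual_matrix d \<iota> T ^\<^sub>m n *\<^sub>v \<iota> \<phi>"
  using assms(2)
proof (induction n arbitrary: \<phi>)
  case 0
  then show ?case using dual_matrix(1)[OF T] iota_carrier[OF 0] by (simp add: o_def)
next
  case (Suc n)
  have "\<phi> \<circ> T ^^ Suc n = (\<phi> \<circ> T) \<circ> T ^^ n" by (simp add: o_assoc)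
  then have "\<iota> (\<phi> \<circ> T ^^ Suc n) = dual_matrix d \<iota> T ^\<^sub>m n *\<^sub>v (dual_matrix d \<iota> T *\<^sub>v \<iota> \<phi>)"
    using Suc.IH[OF character_comp_epimorphism(1)[OF T Suc.prems]] dual_matrix(2)[OF T Suc.prems] by (simp only:)
  then show ?case
    by (simp only: pow_mat_Suc_mult_vec(1)[OF dual_matrix(1)[OF T] iota_carrier[OF Suc.prems]])
qed

lemma dual_matrix_funpow:
  assumes "epimorphism T"
  shows "dual_matrix d \<iota> (T ^^ n) = dual_matrix d \<iota> T ^\<^sub>m n"
  by (rule dual_matrix_eqI) (use dual_matrix(1)[OF assms] iota_comp_funpow[OF assms] in auto)

text \<open>A rational kernel vector has a nonzero multiple of the form
  \<open>\<iota> \<phi>\<close>; then \<open>\<phi> \<circ> T\<close> is trivial, and so is \<phi>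
  by surjectivity of T.\<close>

lemma det_dual_matrix:
  assumes T: "epimorphism T"
  shows "det (dual_matrix d \<iota> T) \<noteq> 0"
proof
  let ?A = "dual_matrix d \<iota> T"
  note A = dual_matrix(1)[OF T]
  assume "det ?A = 0"
  then obtain v where v: "v \<in> carrier_vec d" "v \<noteq> 0\<^sub>v d" "?A *\<^sub>v v = 0\<^sub>v d"
    using det_0_iff_vec_prod_zero_field[OF A] by blast
  obtain N \<phi> where N: "N > 0" and \<phi>: "\<phi> \<in> characters" "\<iota> \<phi> = of_int N \<cdot>\<^sub>v v"
    using iota_surj_multiple[of "{()}" "\<lambda>_. v"] v(1) by auto
  have "\<iota> (\<phi> \<circ> T) = of_int N \<cdot>\<^sub>v (?A *\<^sub>v v)"
    using dual_matrix(2)[OF T \<phi>(1)] \<phi>(2) mult_mat_vec_smult[OF A v(1)] by simp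
  also have "\<dots> = \<iota> (\<lambda>_. 1)" unfolding v(3) iota_one by (intro eq_vecI) auto
  finally have "\<phi> \<circ> T = (\<lambda>_. 1)"
    by (rule iota_inj[OF character_comp_epimorphism(1)[OF T \<phi>(1)] characters_one])
  then have "\<phi> = (\<lambda>_. 1)" using character_comp_epimorphism(2)[OF T \<phi>(1)] by simp
  then have zero: "of_int N \<cdot>\<^sub>v v = 0\<^sub>v d" using \<phi>(2) iota_one by simp
  have "v = 0\<^sub>v d"
  proof (rule eq_vecI)
    fix i assume "i < dim_vec (0\<^sub>v d :: rat vec)"
    then have "of_int N * v $ i = 0" using arg_cong[OF zero, of "\<lambda>x. x $ i"] v(1) by simp
    then show "v $ i = 0\<^sub>v d $ i" using N \<open>i < dim_vec (0\<^sub>v d)\<close> by simp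
  qed (use v(1) in simp)
  then show False using v(2) by simp
qed

section \<open>Resonances of characters as rational relations\<close>

context
  fixes T :: "'i \<Rightarrow> 'a \<Rightarrow> 'a" and S :: "'i set"
  assumes S: "finite S" and epi: "\<And>i. i \<in> S \<Longrightarrow> epimorphism (T i)" and inj: "inj_on T S"
begin

abbreviation "relations v \<equiv>
  {n. \<forall>j<d. (\<Sum>i\<in>S. (dual_matrix d \<iota> (T i) ^\<^sub>m n *\<^sub>v v i) $ j) = 0}"

text \<open>\<open>\<iota>\<close> turns products of characters into sums, and composition with the
  n-th iterate into the n-th power of the dual matrix.\<close>

lemma characters_relation_iff:
  assumes \<phi>: "\<And>i. i \<in> S \<Longrightarrow> \<phi> i \<in> characters"
  shows "(\<forall>x. (\<Prod>i\<in>S. \<phi> i ((T i ^^ n) x)) = 1) \<longleftrightarrow> n \<in> relations (\<lambda>i. \<iota> (\<phi> i))"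
proof -
  let ?P = "\<lambda>x. \<Prod>i\<in>S. \<phi> i ((T i ^^ n) x)"
  have chars: "(\<lambda>x. \<phi> i ((T i ^^ n) x)) \<in> characters" if "i \<in> S" for i
    using character_comp_epimorphism(1)[OF epimorphism_funpow[OF epi[OF that]] \<phi>[OF that]] by (simp add: o_def)
  have P: "?P \<in> characters" by (rule characters_prod[OF chars])
  have index: "\<iota> ?P $ j = (\<Sum>i\<in>S. (dual_matrix d \<iota> (T i) ^\<^sub>m n *\<^sub>v \<iota> (\<phi> i)) $ j)" if "j < d" for j
    using iota_prod_index[OF S chars that] iota_comp_funpow[OF epi \<phi>] by (simp add: o_def)
  have "(\<forall>x. ?P x = 1) \<longleftrightarrow> ?P = (\<lambda>_. 1)" by (auto simp: fun_eq_iff)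
  also have "\<dots> \<longleftrightarrow> \<iota> ?P = 0\<^sub>v d" by (rule iota_eq_zero_iff[OF P, symmetric])
  also have "\<dots> \<longleftrightarrow> (\<forall>j<d. \<iota> ?P $ j = 0)"
  proof
    assume zero: "\<forall>j<d. \<iota> ?P $ j = 0"
    show "\<iota> ?P = 0\<^sub>v d" by (rule eq_vecI) (use zero iota_carrier[OF P] in auto)
  qed simp
  finally show ?thesis using index by auto
qed

lemma not_mixing_relation:
  assumes "\<not> mixing m (T ` S)"
  obtains v where "\<And>i. i \<in> S \<Longrightarrow> v i \<in> carrier_vec d" "\<exists>i\<in>S. v i \<noteq> 0\<^sub>v d" "infinite (relations v)"
proof -
  have "\<exists>\<chi>. (\<forall>\<gamma>\<in>T ` S. \<chi> \<gamma> \<in> characters) \<and> (\<exists>\<gamma>\<in>T ` S. \<chi> \<gamma> \<noteq> (\<lambda>_. 1)) \<and>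
      infinite (resonances (T ` S) \<chi>)"
  proof (rule ccontr)
    assume "\<not> ?thesis"
    then have "mixing m (T ` S)" using S epi by (intro mixing_if_characters) auto
    then show False using assms by simp
  qed
  then obtain \<chi> where \<chi>: "\<And>i. i \<in> S \<Longrightarrow> \<chi> (T i) \<in> characters" "\<exists>i\<in>S. \<chi> (T i) \<noteq> (\<lambda>_. 1)"
    "infinite (resonances (T ` S) \<chi>)" by auto
  show thesis
  proof
    show "\<iota> (\<chi> (T i)) \<in> carrier_vec d" if "i \<in> S" for i by (rule iota_carrier[OF \<chi>(1)[OF that]])
    show "\<exists>i\<in>S. \<iota> (\<chi> (T i)) \<noteq> 0\<^sub>v d"
      using \<chi>(1,2) iota_eq_zero_iff by blast
    have "resonances (T ` S) \<chi> = relations (\<lambda>i. \<iota> (\<chi> (T i)))"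
      unfolding prod.reindex[OF inj] o_def using characters_relation_iff[of "\<lambda>i. \<chi> (T i)", OF \<chi>(1)] by blast
    then show "infinite (relations (\<lambda>i. \<iota> (\<chi> (T i))))" using \<chi>(3) by metis
  qed
qed

lemma relation_not_mixing:
  assumes v: "\<And>i. i \<in> S \<Longrightarrow> v i \<in> carrier_vec d" "\<exists>i\<in>S. v i \<noteq> 0\<^sub>v d" and inf: "infinite (relations v)"
  shows "\<not> mixing m (T ` S)"
proof
  assume mix: "mixing m (T ` S)"
  obtain N where N: "N > 0" "\<forall>i\<in>S. \<exists>\<phi>\<in>characters. \<iota> \<phi> = of_int N \<cdot>\<^sub>v v i"
    using iota_surj_multiple[of S v, OF S v(1)] by blast
  then obtain \<phi> where \<phi>: "\<And>i. i \<in> S \<Longrightarrow> \<phi> i \<in> characters" "\<And>i. i \<in> S \<Longrightarrow> \<iota> (\<phi> i) = of_int N \<cdot>\<^sub>v v i"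
    by metis
  \<comment> \<open>Resonances are indexed by maps, relations by indices; injectivity of T on S
    allows the translation.\<close>
  define \<chi> where "\<chi> = (\<lambda>\<gamma>. \<phi> (the_inv_into S T \<gamma>))"
  have chi: "\<chi> (T i) = \<phi> i" if "i \<in> S" for i using the_inv_into_f_f[OF inj that] by (simp add: \<chi>_def)
  have "finite (resonances (T ` S) \<chi>)"
  proof (rule characters_if_mixing[OF mix])
    obtain i where i: "i \<in> S" "v i \<noteq> 0\<^sub>v d" using v(2) by blast
    then obtain j where j: "j < d" "v i $ j \<noteq> 0" using v(1) by (metis carrier_vecD eq_vecI index_zero_vec)
    have "\<iota> (\<phi> i) $ j \<noteq> 0" using \<phi>(2)[OF i(1)] v(1)[OF i(1)] j N(1) by simp
    then have "\<phi> i \<noteq> (\<lambda>_. 1)" using iota_one_index[OF j(1)] by metis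
    then show "\<exists>\<gamma>\<in>T ` S. \<chi> \<gamma> \<noteq> (\<lambda>_. 1)" using i(1) chi by (intro bexI[of _ "T i"]) auto
  qed (use epi chi \<phi>(1) in auto)
  moreover have "relations v \<subseteq> resonances (T ` S) \<chi>"
  proof
    fix n assume n: "n \<in> relations v"
    have "n \<in> relations (\<lambda>i. \<iota> (\<phi> i))"
    proof (rule CollectI, intro allI impI)
      fix j assume j: "j < d"
      have "(dual_matrix d \<iota> (T i) ^\<^sub>m n *\<^sub>v \<iota> (\<phi> i)) $ j = of_int N * (dual_matrix d \<iota> (T i) ^\<^sub>m n *\<^sub>v v i) $ j"
        if i: "i \<in> S" for i
        using mult_mat_vec_smult[OF pow_carrier_mat[OF dual_matrix(1)[OF epi[OF i]]] v(1)[OF i], of n "of_int N"]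
          dual_matrix(1)[OF epi[OF i]] v(1)[OF i] j by (simp add: \<phi>(2)[OF i])
      then have "(\<Sum>i\<in>S. (dual_matrix d \<iota> (T i) ^\<^sub>m n *\<^sub>v \<iota> (\<phi> i)) $ j)
          = of_int N * (\<Sum>i\<in>S. (dual_matrix d \<iota> (T i) ^\<^sub>m n *\<^sub>v v i) $ j)"
        unfolding sum_distrib_left by (rule sum.cong[OF refl])
      then show "(\<Sum>i\<in>S. (dual_matrix d \<iota> (T i) ^\<^sub>m n *\<^sub>v \<iota> (\<phi> i)) $ j) = 0" using n j by simp
    qed
    then have "\<forall>x. (\<Prod>i\<in>S. \<phi> i ((T i ^^ n) x)) = 1" using characters_relation_iff[of \<phi> n, OF \<phi>(1)] by blast
    then show "n \<in> resonances (T ` S) \<chi>"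
      by (simp add: prod.reindex[OF inj] chi)
  qed
  ultimately show False using inf finite_subset by blast
qed

text \<open>The \<rat>-linear functional yields a relation between the l-th powers that holds for
  every n, hence at the infinitely many times l n.\<close>

lemma common_eigenvectors_not_mixing:
  assumes "l \<ge> 1" and u: "\<And>i. i \<in> S \<Longrightarrow> u i \<in> carrier_vec d"
    and eig: "\<And>i. i \<in> S \<Longrightarrow> map_mat complex_of_rat (dual_matrix d \<iota> (T i) ^\<^sub>m l) *\<^sub>v u i = \<mu> \<cdot>\<^sub>v u i"
    and sum0: "\<And>j. j < d \<Longrightarrow> (\<Sum>i\<in>S. u i $ j) = 0" and ne: "\<exists>i\<in>S. u i \<noteq> 0\<^sub>v d"
  shows "\<not> mixing m (T ` S)"
proof -
  have B: "dual_matrix d \<iota> (T i) ^\<^sub>m l \<in> carrier_mat d d" if "i \<in> S" for i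
    using dual_matrix(1)[OF epi[OF that]] by simp
  obtain v where v: "\<And>i. i \<in> S \<Longrightarrow> v i \<in> carrier_vec d" "\<exists>i\<in>S. v i \<noteq> 0\<^sub>v d"
    "\<And>n j. j < d \<Longrightarrow> (\<Sum>i\<in>S. ((dual_matrix d \<iota> (T i) ^\<^sub>m l) ^\<^sub>m n *\<^sub>v v i) $ j) = 0"
    by (rule rational_relation_from_eigenvectors[where B = "\<lambda>i. dual_matrix d \<iota> (T i) ^\<^sub>m l" and u = u,
        OF B u eig sum0 ne]) blast+
  have "range (\<lambda>n. l * n) \<subseteq> relations v"
  proof (rule image_subsetI, rule CollectI, intro allI impI)
    fix n j assume "j < d"
    have "(\<Sum>i\<in>S. (dual_matrix d \<iota> (T i) ^\<^sub>m (l * n) *\<^sub>v v i) $ j)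
        = (\<Sum>i\<in>S. ((dual_matrix d \<iota> (T i) ^\<^sub>m l) ^\<^sub>m n *\<^sub>v v i) $ j)"
      by (rule sum.cong[OF refl]) (simp only: pow_mat_mult[OF dual_matrix(1)[OF epi]])
    then show "(\<Sum>i\<in>S. (dual_matrix d \<iota> (T i) ^\<^sub>m (l * n) *\<^sub>v v i) $ j) = 0" using v(3)[OF \<open>j < d\<close>] by simp
  qed
  moreover have "infinite (range (\<lambda>n. l * n))"
    using \<open>l \<ge> 1\<close> by (intro range_inj_infinite) (auto simp: inj_on_def)
  ultimately have "infinite (relations v)" using infinite_super by blast
  then show ?thesis using relation_not_mixing[of v] v(1,2) by blast
qed

end

section \<open>Common eigenvalues and the failure of mixing\<close>

lemma Spec_iff:
  assumes "epimorphism T"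
  shows "\<mu> \<in> Spec d \<iota> (T ^^ l) \<longleftrightarrow> (\<exists>u. u \<in> carrier_vec d \<and> u \<noteq> 0\<^sub>v d \<and>
    map_mat complex_of_rat (dual_matrix d \<iota> T ^\<^sub>m l) *\<^sub>v u = \<mu> \<cdot>\<^sub>v u)"
  using dual_matrix(1)[OF assms]
  by (simp add: Spec_def spectrum_def eigenvalue_def eigenvector_def dual_matrix_funpow[OF assms])

text \<open>By the Skolem--Mahler--Lech theorem a failure of mixing is witnessed by a relation along an arithmetic
  progression; the cyclic space of that relation contains a family of eigenvectors with sum zero.\<close>

lemma not_mixing_common_eigenvalue:
  fixes T :: "'i \<Rightarrow> 'a \<Rightarrow> 'a"
  assumes S: "finite S" and epi: "\<And>i. i \<in> S \<Longrightarrow> epimorphism (T i)" and inj: "inj_on T S"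
    and not_mixing: "\<not> mixing m (T ` S)"
  shows "\<exists>l\<ge>1. \<exists>R\<subseteq>S. \<exists>\<mu>. card R \<ge> 2 \<and> (\<forall>i\<in>R. \<mu> \<in> Spec d \<iota> (T i ^^ l)) \<and> \<not> mixing m (T ` R)"
proof -
  let ?A = "\<lambda>i. dual_matrix d \<iota> (T i)"
  have A: "?A i \<in> carrier_mat d d" and det: "det (?A i) \<noteq> 0" if "i \<in> S" for i
    using dual_matrix(1)[OF epi[OF that]] det_dual_matrix[OF epi[OF that]] by auto
  obtain v where v: "\<And>i. i \<in> S \<Longrightarrow> v i \<in> carrier_vec d" "\<exists>i\<in>S. v i \<noteq> 0\<^sub>v d"
    "infinite {n. \<forall>j<d. (\<Sum>i\<in>S. (?A i ^\<^sub>m n *\<^sub>v v i) $ j) = 0}"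
    by (rule not_mixing_relation[OF S epi inj not_mixing]) blast+
  obtain l r where l: "l \<ge> 1" and lr: "\<And>n j. j < d \<Longrightarrow> (\<Sum>i\<in>S. (?A i ^\<^sub>m (l * n + r) *\<^sub>v v i) $ j) = 0"
    using skolem_mahler_lech_rat[where A = ?A and v = v, OF S A v(1) det v(3)] by blast
  \<comment> \<open>The shift by r makes the relation hold for all powers of the matrices
    \<open>?A i ^\<^sub>m l\<close>, starting at the zeroth; invertibility keeps the family
    nonzero.\<close>
  define w where "w = (\<lambda>i. ?A i ^\<^sub>m r *\<^sub>v v i)"
  have B: "?A i ^\<^sub>m l \<in> carrier_mat d d" and w: "w i \<in> carrier_vec d" if "i \<in> S" for i
    using A[OF that] v(1)[OF that] by (auto simp: w_def intro!: mult_mat_vec_carrier[of _ d d])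
  have rel: "(\<Sum>i\<in>S. ((?A i ^\<^sub>m l) ^\<^sub>m n *\<^sub>v w i) $ j) = 0" if "j < d" for n j
  proof -
    have "(?A i ^\<^sub>m l) ^\<^sub>m n *\<^sub>v w i = ?A i ^\<^sub>m (l * n + r) *\<^sub>v v i" if "i \<in> S" for i
      using A[OF that] v(1)[OF that]
      by (simp add: w_def pow_mat_add[of _ d] pow_mat_mult[of _ d] assoc_mult_mat_vec[of _ d d _ d])
    then show ?thesis using lr[OF that, of n] by simp
  qed
  have w_ne: "\<exists>i\<in>S. w i \<noteq> 0\<^sub>v d"
  proof -
    obtain i where i: "i \<in> S" "v i \<noteq> 0\<^sub>v d" using v(2) by blast
    have "det (?A i ^\<^sub>m r) \<noteq> 0" using det[OF i(1)] det_pow_mat[OF A[OF i(1)]] by simp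
    then have "w i \<noteq> 0\<^sub>v d"
      using det_0_iff_vec_prod_zero_field[OF pow_carrier_mat[OF A[OF i(1)]]] v(1)[OF i(1)] i(2)
      unfolding w_def by blast
    then show ?thesis using i(1) by blast
  qed
  obtain u \<mu> where u: "\<And>i. i \<in> S \<Longrightarrow> u i \<in> carrier_vec d"
    "\<And>i. i \<in> S \<Longrightarrow> map_mat complex_of_rat (?A i ^\<^sub>m l) *\<^sub>v u i = \<mu> \<cdot>\<^sub>v u i"
    "\<And>j. j < d \<Longrightarrow> (\<Sum>i\<in>S. u i $ j) = 0" "\<exists>i\<in>S. u i \<noteq> 0\<^sub>v d"
    by (rule eigenvectors_from_relation[where S = S and B = "\<lambda>i. ?A i ^\<^sub>m l" and d = d and w = w, OF S])
      (use B w rel w_ne in blast)+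
  \<comment> \<open>Dropping the zero vectors keeps the sum zero. At least two vectors remain, since
    a single nonzero vector has a nonzero sum, and by themselves they show that the subfamily R is
    not mixing.\<close>
  define R where "R = {i \<in> S. u i \<noteq> 0\<^sub>v d}"
  have R: "R \<subseteq> S" "finite R" using S by (auto simp: R_def)
  have sumR: "(\<Sum>i\<in>R. u i $ j) = 0" if "j < d" for j
  proof -
    have "(\<Sum>i\<in>R. u i $ j) = (\<Sum>i\<in>S. u i $ j)"
      by (rule sum.mono_neutral_left[OF S R(1)]) (use that in \<open>auto simp: R_def\<close>)
    then show ?thesis using u(3)[OF that] by simp
  qed
  have "R \<noteq> {}" using u(4) by (auto simp: R_def)
  moreover have "card R \<noteq> 1"
  proof
    assume "card R = 1"
    then obtain i where i: "R = {i}" by (auto simp: card_1_singleton_iff)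
    then have "i \<in> S" "u i \<noteq> 0\<^sub>v d" by (auto simp: R_def)
    moreover have "u i = 0\<^sub>v d"
      by (rule eq_vecI) (use sumR u(1)[OF \<open>i \<in> S\<close>] i in auto)
    ultimately show False by simp
  qed
  ultimately have "card R \<ge> 2" using R(2) by (cases "card R" rule: nat.exhaust) (auto simp: Suc_le_eq)
  moreover have "\<mu> \<in> Spec d \<iota> (T i ^^ l)" if "i \<in> R" for i
  proof -
    have i: "i \<in> S" "u i \<noteq> 0\<^sub>v d" using that by (auto simp: R_def)
    then show ?thesis unfolding Spec_iff[OF epi[OF i(1)]] using u(1,2)[OF i(1)] by blast
  qed
  moreover have "\<not> mixing m (T ` R)"
  proof (rule common_eigenvectors_not_mixing[OF R(2) _ _ l, of T u \<mu>])
    show "\<exists>i\<in>R. u i \<noteq> 0\<^sub>v d" using \<open>R \<noteq> {}\<close> by (auto simp: R_def)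
    show "inj_on T R" using inj R(1) by (rule inj_on_subset)
  qed (use R(1) epi u(1,2) sumR in auto)
  ultimately show ?thesis using l R(1) by blast
qed

lemma common_eigenvalue_not_mixing:
  fixes T :: "'i \<Rightarrow> 'a \<Rightarrow> 'a"
  assumes S: "finite S" and epi: "\<And>i. i \<in> S \<Longrightarrow> epimorphism (T i)" and inj: "inj_on T S"
    and "l \<ge> 1" "card S > d" and common: "\<And>i. i \<in> S \<Longrightarrow> \<mu> \<in> Spec d \<iota> (T i ^^ l)"
  shows "\<not> mixing m (T ` S)"
proof -
  have "\<exists>u. u \<in> carrier_vec d \<and> u \<noteq> 0\<^sub>v d \<and>
      map_mat complex_of_rat (dual_matrix d \<iota> (T i) ^\<^sub>m l) *\<^sub>v u = \<mu> \<cdot>\<^sub>v u" if "i \<in> S" for i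
    using common[OF that] unfolding Spec_iff[OF epi[OF that]] .
  then obtain u where u: "\<And>i. i \<in> S \<Longrightarrow> u i \<in> carrier_vec d" "\<And>i. i \<in> S \<Longrightarrow> u i \<noteq> 0\<^sub>v d"
    "\<And>i. i \<in> S \<Longrightarrow> map_mat complex_of_rat (dual_matrix d \<iota> (T i) ^\<^sub>m l) *\<^sub>v u i = \<mu> \<cdot>\<^sub>v u i" by metis
  have "card {..<d} < card S" using assms(5) by simp
  \<comment> \<open>A linear dependence of more than d vectors in dimension d: the vectors
    \<open>c i \<cdot>\<^sub>v u i\<close> still satisfy the eigenvalue equation for \<mu> and now
    sum to zero.\<close>
  then obtain c where c: "\<exists>i\<in>S. c i \<noteq> 0" "\<forall>j\<in>{..<d}. (\<Sum>i\<in>S. u i $ j * c i) = 0"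
    using homogeneous_system_nontrivial[of "{..<d}" S "\<lambda>j i. u i $ j"] S by blast
  show ?thesis
  proof (rule common_eigenvectors_not_mixing[OF S epi inj \<open>l \<ge> 1\<close>, where u = "\<lambda>i. c i \<cdot>\<^sub>v u i" and \<mu> = \<mu>])
    show "c i \<cdot>\<^sub>v u i \<in> carrier_vec d" if "i \<in> S" for i using u(1)[OF that] by simp
    show "map_mat complex_of_rat (dual_matrix d \<iota> (T i) ^\<^sub>m l) *\<^sub>v (c i \<cdot>\<^sub>v u i) = \<mu> \<cdot>\<^sub>v (c i \<cdot>\<^sub>v u i)"
      if i: "i \<in> S" for i
      using dual_matrix(1)[OF epi[OF i]] u(1)[OF i]
      by (simp add: mult_mat_vec_smult[of _ d d] u(3)[OF i] smult_smult_assoc mult.commute)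
    show "(\<Sum>i\<in>S. (c i \<cdot>\<^sub>v u i) $ j) = 0" if "j < d" for j
    proof -
      have "(c i \<cdot>\<^sub>v u i) $ j = u i $ j * c i" if "i \<in> S" for i
        using u(1)[OF that] \<open>j < d\<close> by (simp add: mult.commute)
      then show ?thesis using c(2) that by simp
    qed
    obtain i where i: "i \<in> S" "c i \<noteq> 0" using c(1) by blast
    obtain j where "j < d" "u i $ j \<noteq> 0" using u(1,2)[OF i(1)] by (metis carrier_vecD eq_vecI index_zero_vec)
    then have "(c i \<cdot>\<^sub>v u i) $ j \<noteq> 0\<^sub>v d $ j" using i(2) u(1)[OF i(1)] by simp
    then show "\<exists>i\<in>S. c i \<cdot>\<^sub>v u i \<noteq> 0\<^sub>v d" using i(1) by metis
  qed
qed

end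

section \<open>The three criteria for mixing in terms of spectra\<close>

theorem corollary1p7:
  fixes m :: "'a::{topological_ab_group_add, t2_space} measure"
    and T :: "nat \<Rightarrow> 'a \<Rightarrow> 'a"
    and \<iota> :: "('a \<Rightarrow> complex) \<Rightarrow> rat vec"
    and d s :: nat
  assumes "compact (UNIV :: 'a set)"
    and "connected (UNIV :: 'a set)"
    and "has_dim (euclidean :: 'a topology) d"
    and "normalized_haar m"
    and "dual_identification d \<iota>"
    and "\<forall>i\<in>{1..s}. epimorphism (T i)"
    and "inj_on T {1..s}"
  shows
    "((\<forall>l\<ge>1. \<forall>i\<in>{1..s}. \<forall>j\<in>{1..s}. i \<noteq> j \<longrightarrow> Spec d \<iota> (T i ^^ l) \<inter> Spec d \<iota> (T j ^^ l) = {})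
        \<longrightarrow> mixing m (T ` {1..s}))
     \<and> ((\<exists>l\<ge>1. \<exists>S\<subseteq>{1..s}. card S > d \<and> (\<Inter>i\<in>S. Spec d \<iota> (T i ^^ l)) \<noteq> {})
        \<longrightarrow> \<not> mixing m (T ` {1..s}))
     \<and> (d \<le> s \<longrightarrow>
        (\<forall>l\<ge>1. \<forall>S\<subseteq>{1..s}. card S > d \<longrightarrow> (\<Inter>i\<in>S. Spec d \<iota> (T i ^^ l)) = {})
        \<longrightarrow> (mixing m (T ` {1..s}) \<longleftrightarrow> (\<forall>F\<subseteq>T ` {1..s}. card F = d \<longrightarrow> mixing m F)))"
proof -
  interpret dual_setting m d \<iota>
    using assms by (simp add: dual_setting_def dual_setting_axioms_def compact_haar_def)
  have epi: "\<And>i. i \<in> {1..s} \<Longrightarrow> epimorphism (T i)" using assms(6) by blast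
  note inj = assms(7)
  have not_mixing: "\<exists>l\<ge>1. \<exists>R\<subseteq>{1..s}. \<exists>\<mu>. card R \<ge> 2 \<and> (\<forall>i\<in>R. \<mu> \<in> Spec d \<iota> (T i ^^ l)) \<and> \<not> mixing m (T ` R)"
    if "\<not> mixing m (T ` {1..s})"
    by (rule not_mixing_common_eigenvalue[OF finite_atLeastAtMost epi inj that])
  show ?thesis
  proof (intro conjI impI)
    assume disjoint: "\<forall>l\<ge>1. \<forall>i\<in>{1..s}. \<forall>j\<in>{1..s}. i \<noteq> j \<longrightarrow> Spec d \<iota> (T i ^^ l) \<inter> Spec d \<iota> (T j ^^ l) = {}"
    show "mixing m (T ` {1..s})"
    proof (rule ccontr)
      assume "\<not> mixing m (T ` {1..s})"
      then obtain l R \<mu> where R: "l \<ge> 1" "R \<subseteq> {1..s}" "card R \<ge> 2" "\<forall>i\<in>R. \<mu> \<in> Spec d \<iota> (T i ^^ l)"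
        using not_mixing by blast
      obtain i j where "i \<in> R" "j \<in> R" "i \<noteq> j"
        using R(3) by (metis card_le_Suc0_iff_eq card.infinite not_less_eq_eq numeral_2_eq_2 zero_le)
      then have "\<mu> \<in> Spec d \<iota> (T i ^^ l) \<inter> Spec d \<iota> (T j ^^ l)" using R(4) by blast
      moreover have "Spec d \<iota> (T i ^^ l) \<inter> Spec d \<iota> (T j ^^ l) = {}"
        using disjoint R(1,2) \<open>i \<in> R\<close> \<open>j \<in> R\<close> \<open>i \<noteq> j\<close> by blast
      ultimately show False by blast
    qed
  next
    assume "\<exists>l\<ge>1. \<exists>S\<subseteq>{1..s}. card S > d \<and> (\<Inter>i\<in>S. Spec d \<iota> (T i ^^ l)) \<noteq> {}"
    then obtain l S \<mu> where S: "l \<ge> 1" "S \<subseteq> {1..s}" "card S > d" "\<And>i. i \<in> S \<Longrightarrow> \<mu> \<in> Spec d \<iota> (T i ^^ l)"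
      by blast
    have "\<not> mixing m (T ` S)"
    proof (rule common_eigenvalue_not_mixing[OF _ _ _ S(1,3,4)])
      show "finite S" using S(2) finite_subset by blast
      show "inj_on T S" by (rule inj_on_subset[OF inj S(2)])
    qed (use epi S(2) in auto)
    then show "\<not> mixing m (T ` {1..s})" using mixing_subset[OF _ image_mono[OF S(2), of T]] by blast
  next
    assume "d \<le> s"
      and empty: "\<forall>l\<ge>1. \<forall>S\<subseteq>{1..s}. card S > d \<longrightarrow> (\<Inter>i\<in>S. Spec d \<iota> (T i ^^ l)) = {}"
    show "mixing m (T ` {1..s}) \<longleftrightarrow> (\<forall>F\<subseteq>T ` {1..s}. card F = d \<longrightarrow> mixing m F)"
    proof
      assume subsets: "\<forall>F\<subseteq>T ` {1..s}. card F = d \<longrightarrow> mixing m F"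
      show "mixing m (T ` {1..s})"
      proof (rule ccontr)
        assume "\<not> mixing m (T ` {1..s})"
        then obtain l R \<mu> where R: "l \<ge> 1" "R \<subseteq> {1..s}" "\<forall>i\<in>R. \<mu> \<in> Spec d \<iota> (T i ^^ l)" "\<not> mixing m (T ` R)"
          using not_mixing by blast
        have "card R \<le> d"
        proof (rule ccontr)
          assume "\<not> card R \<le> d"
          then have "(\<Inter>i\<in>R. Spec d \<iota> (T i ^^ l)) = {}" using empty R(1,2) by simp
          then show False using R(3) by blast
        qed
        then have "card (T ` R) \<le> d" using card_image[OF inj_on_subset[OF inj R(2)]] by simp
        moreover have "d \<le> card (T ` {1..s})" using \<open>d \<le> s\<close> card_image[OF inj] by simp
        moreover have "T ` R \<subseteq> T ` {1..s}" by (rule image_mono[OF R(2)])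
        \<comment> \<open>As d <= s, the non-mixing subfamily can be enlarged to exactly d maps, and
          mixing of the larger set would be inherited.\<close>
        ultimately have "\<exists>F. T ` R \<subseteq> F \<and> F \<subseteq> T ` {1..s} \<and> card F = d"
          by (intro exists_subset_between) auto
        then obtain F where F: "T ` R \<subseteq> F" "F \<subseteq> T ` {1..s}" "card F = d" by blast
        have "mixing m F" using subsets F(2,3) by blast
        then have "mixing m (T ` R)" by (rule mixing_subset[OF _ F(1)])
        then show False using R(4) by blast
      qed
    next
      assume mix: "mixing m (T ` {1..s})"
      show "\<forall>F\<subseteq>T ` {1..s}. card F = d \<longrightarrow> mixing m F" using mixing_subset[OF mix] by blast
    qed
  qed
qed

end
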